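(* Let $K_1\subset\mathbb C$ and $K_2\subset\mathbb C^m$ be compact sets such that $\overline{\mathcal O}(K_1)=A_D(K_1)$ and $\overline{\mathcal O}(K_2)=A_D(K_2)$. Then \[ \overline{\mathcal O}(K_1\times K_2)=A_D(K_1\times K_2). \]
   Context: For a compact $K\subset\mathbb C^n$: $\overline{\mathcal O}(K)$ is the closure in $C(K)$ (supremum norm) of the restrictions to $K$ of functions holomorphic on some open neighbourhood of $K$ (depending on the function); $A_D(K)$ is the set of continuous functions $f:K\to\mathbb C$ such that for every open disc $D\subset\mathbb C$ and every injective holomorphic mapping $\phi:D\to\mathbb C^n$ with $\phi(D)\subset K$, the composition $f\circ\phi$ is holomorphic on $D$. For planar compact sets $A_D$ coincides with $A$, the algebra of continuous functions holomorphic on the interior. *)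

theory Defs
  imports "HOL-Analysis.Analysis"
begin

text \<open>Points of C^n are modelled as complex ^ 'n (index type 'n finite).
  A function g on an open set U of C^n is holomorphic if it is complex
  (Frechet) differentiable at every point of U: the real derivative is
  complex linear.\<close>

definition holo_n :: "(complex ^ 'n) set \<Rightarrow> (complex ^ 'n \<Rightarrow> complex) \<Rightarrow> bool" where
  "holo_n U g \<longleftrightarrow> (\<forall>z\<in>U. \<exists>g'. (g has_derivative g') (at z) \<and>
       (\<forall>(c::complex) v. g' (c *s v) = c * g' v))"

definition Obar :: "(complex ^ 'n) set \<Rightarrow> (complex ^ 'n \<Rightarrow> complex) set" where
  "Obar K = {f. continuous_on K f \<and>
     (\<forall>e>0. \<exists>U g. open U \<and> K \<subseteq> U \<and> holo_n U g \<and> (\<forall>z\<in>K. norm (f z - g z) < e))}"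

definition A_D :: "(complex ^ 'n) set \<Rightarrow> (complex ^ 'n \<Rightarrow> complex) set" where
  "A_D K = {f. continuous_on K f \<and>
     (\<forall>(c::complex) (r::real) (\<phi>::complex \<Rightarrow> complex ^ 'n).
        r > 0 \<longrightarrow> (\<forall>i. (\<lambda>t. \<phi> t $ i) holomorphic_on ball c r) \<longrightarrow>
        inj_on \<phi> (ball c r) \<longrightarrow> \<phi> ` ball c r \<subseteq> K \<longrightarrow>
        (f \<circ> \<phi>) holomorphic_on ball c r)}"

definition prod_set :: "(complex ^ 'a) set \<Rightarrow> (complex ^ 'b) set \<Rightarrow> (complex ^ ('a + 'b)) set" where
  "prod_set K1 K2 = {z. (\<chi> i. z $ Inl i) \<in> K1 \<and> (\<chi> j. z $ Inr j) \<in> K2}"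

end

(* Fix f in A_D(K1 x K2). The functions f(., w) lie in A(K1) and the functions f(z, .) lie in
   A_D(K2), so it suffices to approximate f uniformly by finite sums of products p(z) c(w) with p in
   A_D(K1) and c in A_D(K2); this is the approximation property of A(K1), obtained from Vitushkin's
   localisation. After extending z |-> f(z, w) to the plane, linearly in f, one splits
   f(., w) = sum_k T_k f(., w) over the points k of a fine square lattice, where T_k f(., w) has size
   comparable to the oscillation of f at that scale and the expansion
   m_0(w) / (z - k) + m_1(w) / (z - k)^2 + O(|z - k|^-3) away from k, with moments m_0, m_1 in A_D(K2).
   Two nearly extremal functions p, q in A(K1) of the same kind at k suffice to cancel both moments by
   a combination whose coefficients are linear in m_0, m_1 and of comparable size. The errors then
   decay like |z - k|^-3, which is summable over the lattice, so the total error is at most a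
   universal constant times the oscillation. *)

theory Submission
  imports Defs "HOL-Complex_Analysis.Complex_Analysis" "HOL-Probability.Sinc_Integral"
begin

section \<open>Integrals over the plane\<close>

text \<open>Matching only the first coefficient would leave errors of order |z - k|^-2, whose sum
  over a planar lattice grows like the logarithm of its size; hence two coefficients must be
  removed. Classically one compares them with analytic capacities. Here they are compared with the
  class of all functions that have the same size bounds and the same kind of expansion at k. Since
  T_k f(., w) is, up to scaling, a member of that class, its coefficients are dominated by the
  nearly largest ones, with no geometric information about K1. The functions p, q depend on k and K1
  alone, so w enters only through the moments. These are plane integrals of values f(s(\<zeta>), w)
  against fixed weights, where s is a discontinuous retraction onto K1 that is the same for all w;
  this is why the moments inherit continuity and holomorphy along discs from f(z, .). Instead of
  refining the lattice, the compact set is rescaled: the lattice stays inside the Gaussian integers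
  and all constants are absolute.\<close>

lemma holomorphic_on_lebesgue_integral:
  fixes q :: "complex \<Rightarrow> 'a \<Rightarrow> complex"
  assumes U: "open U"
    and meas: "\<And>z. z \<in> U \<Longrightarrow> q z \<in> borel_measurable M"
    and hol: "\<And>x. x \<in> space M \<Longrightarrow> (\<lambda>z. q z x) holomorphic_on U"
    and bound: "\<And>z x. z \<in> U \<Longrightarrow> x \<in> space M \<Longrightarrow> norm (q z x) \<le> B x"
    and B: "integrable M B"
  shows "(\<lambda>z. \<integral>x. q z x \<partial>M) holomorphic_on U"
  unfolding holomorphic_on_open[OF U]
proof
  fix z0 assume "z0 \<in> U"
  then obtain r0 where "r0 > 0" and r0: "cball z0 r0 \<subseteq> U"
    using U open_contains_cball by blast
  define r where "r = r0 / 2"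
  have r: "r > 0" and rU: "cball z0 (2 * r) \<subseteq> U"
    using \<open>r0 > 0\<close> r0 by (auto simp: r_def)
  have sub: "cball z r \<subseteq> U" if "z \<in> ball z0 r" for z
  proof -
    have "cball z r \<subseteq> cball z0 (2 * r)"
      using that by (intro subsetI) (metis dist_commute dist_triangle_le mem_ball mem_cball
          add_mono less_imp_le mult_2)
    then show ?thesis using rU by blast
  qed
  \<comment> \<open>Cauchy's inequality on circles of the fixed radius \<open>r\<close>, which stay
    in \<open>U\<close> because \<open>r\<close> is half of \<open>r0\<close>, turns
    \<open>B\<close> into a majorant of the derivatives and hence of the difference quotients. This
    is what dominated convergence needs.\<close>
  have derb: "norm (deriv (\<lambda>z. q z x) z) \<le> B x / r" if "z \<in> ball z0 r" "x \<in> space M" for z x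
  proof -
    have h: "(\<lambda>z. q z x) holomorphic_on cball z r"
      using hol[OF that(2)] sub[OF that(1)] holomorphic_on_subset by blast
    have "norm ((deriv ^^ 1) (\<lambda>z. q z x) z) \<le> fact 1 * B x / r ^ 1"
    proof (rule Cauchy_inequality[OF _ _ r])
      show "(\<lambda>z. q z x) holomorphic_on ball z r"
        using h ball_subset_cball holomorphic_on_subset by blast
      show "continuous_on (cball z r) (\<lambda>z. q z x)"
        using h holomorphic_on_imp_continuous_on by blast
      fix w assume "norm (z - w) = r"
      then have "w \<in> U" using sub[OF that(1)] by (auto simp: dist_norm)
      then show "norm (q w x) \<le> B x" using bound that(2) by blast
    qed
    then show ?thesis by simp
  qed
  have fd: "((\<lambda>z. q z x) has_field_derivative deriv (\<lambda>z. q z x) z) (at z)"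
    if "z \<in> U" "x \<in> space M" for z x
    using holomorphic_derivI[OF hol[OF that(2)] U that(1)] .
  have ballU: "ball z0 r \<subseteq> U" using rU r by (auto simp: subset_iff)
  have lip: "norm (q z x - q z0 x) \<le> B x / r * norm (z - z0)"
    if "z \<in> ball z0 r" "x \<in> space M" for z x
  proof (rule field_differentiable_bound[where S="ball z0 r"])
    show "((\<lambda>z. q z x) has_field_derivative deriv (\<lambda>z. q z x) w) (at w within ball z0 r)"
      if "w \<in> ball z0 r" for w
      using fd[of w x] that ballU \<open>x \<in> space M\<close> has_field_derivative_at_within by blast
  qed (use that derb r in auto)
  have int: "integrable M (q z)" if "z \<in> U" for z
    by (rule Bochner_Integration.integrable_bound[OF B meas[OF that]])
      (use bound[OF that] in \<open>auto intro!: AE_I2 order_trans[OF _ abs_ge_self]\<close>)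
  define D where "D = (\<integral>x. deriv (\<lambda>z. q z x) z0 \<partial>M)"
  have "((\<lambda>z. ((\<integral>x. q z x \<partial>M) - (\<integral>x. q z0 x \<partial>M)) / (z - z0)) \<longlongrightarrow> D) (at z0 within ball z0 r)"
    unfolding tendsto_at_iff_sequentially
  proof (intro allI impI)
    fix X assume X: "\<forall>i. X i \<in> ball z0 r - {z0}" and lim: "X \<longlonglongrightarrow> z0"
    let ?s = "\<lambda>i x. (q (X i) x - q z0 x) / (X i - z0)"
    have XU: "X i \<in> U" for i using X ballU by blast
    have conv: "(\<lambda>i. ?s i x) \<longlonglongrightarrow> deriv (\<lambda>z. q z x) z0" if "x \<in> space M" for x
    proof -
      have "((\<lambda>z. (q z x - q z0 x) / (z - z0)) \<longlongrightarrow> deriv (\<lambda>z. q z x) z0) (at z0 within ball z0 r)"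
        using fd[OF \<open>z0 \<in> U\<close> that] has_field_derivative_at_within[of _ _ z0 "ball z0 r"]
        by (auto simp: has_field_derivative_iff)
      then show ?thesis
        using X lim unfolding tendsto_at_iff_sequentially by (auto simp: o_def)
    qed
    have ms: "?s i \<in> borel_measurable M" for i
      using meas[OF XU[of i]] meas[OF \<open>z0 \<in> U\<close>] by measurable
    have "(\<lambda>i. \<integral>x. ?s i x \<partial>M) \<longlonglongrightarrow> D"
      unfolding D_def
    proof (rule integral_dominated_convergence[where w="\<lambda>x. B x / r"])
      \<comment> \<open>Measurability of the derivative in \<open>x\<close> is not assumed; it is
        inherited from the difference quotients as their pointwise limit.\<close>
      show "(\<lambda>x. deriv (\<lambda>z. q z x) z0) \<in> borel_measurable M"
        using borel_measurable_LIMSEQ_metric[OF ms conv] .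
      show "integrable M (\<lambda>x. B x / r)" using B by simp
      show "AE x in M. norm (?s i x) \<le> B x / r" for i
      proof (rule AE_I2)
        fix x assume "x \<in> space M"
        have "X i \<noteq> z0" "X i \<in> ball z0 r" using X by auto
        then show "norm (?s i x) \<le> B x / r"
          using lip[OF \<open>X i \<in> ball z0 r\<close> \<open>x \<in> space M\<close>] by (simp add: norm_divide divide_le_eq)
      qed
    qed (use conv ms in auto)
    moreover have "(\<integral>x. ?s i x \<partial>M) = ((\<integral>x. q (X i) x \<partial>M) - (\<integral>x. q z0 x \<partial>M)) / (X i - z0)" for i
      using int[OF XU] int[OF \<open>z0 \<in> U\<close>] by simp
    ultimately show "((\<lambda>z. ((\<integral>x. q z x \<partial>M) - (\<integral>x. q z0 x \<partial>M)) / (z - z0)) \<circ> X) \<longlonglongrightarrow> D"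
      by (simp only: o_def)
  qed
  then have "((\<lambda>z. \<integral>x. q z x \<partial>M) has_field_derivative D) (at z0)"
    using r by (simp add: has_field_derivative_iff at_within_open[of z0 "ball z0 r"])
  then show "\<exists>f'. ((\<lambda>z. \<integral>x. q z x \<partial>M) has_field_derivative f') (at z0)" by blast
qed

section \<open>Fubini in the complex plane and integrable kernels\<close>

lemma measurable_Complex_pair:
  "(\<lambda>(x, y). Complex x y) \<in> (lborel \<Otimes>\<^sub>M lborel) \<rightarrow>\<^sub>M borel"
  by (simp add: case_prod_unfold Complex_eq)

text \<open>Lebesgue measure is determined by the volumes of boxes, and a box in the plane is the
  image of a product of two intervals.\<close>

lemma lborel_complex_eq:
  "(lborel :: complex measure) = distr (lborel \<Otimes>\<^sub>M lborel) borel (\<lambda>(x, y). Complex x y)"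
proof (rule lborel_eqI)
  note measurable_Complex_pair [measurable]
  fix l u :: complex
  assume lu: "\<And>b. b \<in> Basis \<Longrightarrow> l \<bullet> b \<le> u \<bullet> b"
  have "(\<lambda>(x, y). Complex x y) -` box l u = {Re l<..<Re u} \<times> {Im l<..<Im u}"
    by (auto simp: box_def Basis_complex_def)
  moreover have "Re l \<le> Re u" "Im l \<le> Im u"
    using lu[of 1] lu[of \<i>] by (auto simp: Basis_complex_def)
  ultimately show "emeasure (distr (lborel \<Otimes>\<^sub>M lborel) borel (\<lambda>(x, y). Complex x y)) (box l u)
      = (\<Prod>b\<in>Basis. (u - l) \<bullet> b)"
    by (subst emeasure_distr)
      (auto simp: lborel.emeasure_pair_measure_Times space_pair_measure Basis_complex_def ennreal_mult)
qed simp

lemma nn_integral_complex_iterated: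
  assumes "f \<in> borel_measurable borel"
  shows "(\<integral>\<^sup>+z. f z \<partial>(lborel :: complex measure)) = (\<integral>\<^sup>+x. \<integral>\<^sup>+y. f (Complex x y) \<partial>lborel \<partial>lborel)"
proof -
  note m = measurable_Complex_pair
  have m2: "(\<lambda>p. f (case p of (x, y) \<Rightarrow> Complex x y)) \<in> borel_measurable (lborel \<Otimes>\<^sub>M lborel)"
    using measurable_compose[OF m assms] .
  show ?thesis
    unfolding lborel_complex_eq
    by (subst nn_integral_distr[OF m])
      (use assms lborel.nn_integral_fst[OF m2] in simp_all)
qed

text \<open>Both orders are wanted: to integrate a partial derivative away, the inner integral must
  be taken in the variable of differentiation.\<close>

lemma complex_integral_iterated:
  fixes f :: "complex \<Rightarrow> complex"
  assumes "integrable lborel f"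
  shows "(\<integral>z. f z \<partial>lborel) = (\<integral>x. \<integral>y. f (Complex x y) \<partial>lborel \<partial>lborel)"
    and "(\<integral>z. f z \<partial>lborel) = (\<integral>y. \<integral>x. f (Complex x y) \<partial>lborel \<partial>lborel)"
proof -
  note m = measurable_Complex_pair
  have fm: "f \<in> borel_measurable borel" using assms by auto
  have i: "integrable (lborel \<Otimes>\<^sub>M lborel) (\<lambda>(x, y). f (Complex x y))"
    using assms unfolding lborel_complex_eq
    by (subst (asm) integrable_distr_eq[OF m fm]) (simp add: case_prod_unfold)
  have e: "(\<integral>z. f z \<partial>lborel) = (\<integral>(x, y). f (Complex x y) \<partial>(lborel \<Otimes>\<^sub>M lborel))"
    unfolding lborel_complex_eq by (subst integral_distr[OF m fm]) (simp add: case_prod_unfold)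
  show "(\<integral>z. f z \<partial>lborel) = (\<integral>x. \<integral>y. f (Complex x y) \<partial>lborel \<partial>lborel)"
    unfolding e by (rule lborel_pair.integral_fst[OF i, symmetric])
  show "(\<integral>z. f z \<partial>lborel) = (\<integral>y. \<integral>x. f (Complex x y) \<partial>lborel \<partial>lborel)"
    unfolding e by (rule lborel_pair.integral_snd[OF i, symmetric])
qed

text \<open>A majorant that splits over the coordinates reduces plane integrability to one real
  integral. The bound is asked off the axes only, a null set, so that \<open>g\<close> may be
  singular at 0.\<close>

lemma integrable_complex_product_bound:
  fixes f :: "complex \<Rightarrow> 'b::{banach, second_countable_topology}" and g :: "real \<Rightarrow> real"
  assumes [measurable]: "f \<in> borel_measurable borel" "g \<in> borel_measurable borel"
    and fin: "(\<integral>\<^sup>+x. ennreal (g x) \<partial>lborel) < \<infinity>"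
    and g: "\<And>x. 0 \<le> g x"
    and bound: "\<And>x y. x \<noteq> 0 \<Longrightarrow> y \<noteq> 0 \<Longrightarrow> norm (f (Complex x y)) \<le> g x * g y"
  shows "integrable lborel f"
proof (rule integrableI_bounded)
  have "(\<integral>\<^sup>+z. ennreal (norm (f z)) \<partial>lborel)
      = (\<integral>\<^sup>+x. \<integral>\<^sup>+y. ennreal (norm (f (Complex x y))) \<partial>lborel \<partial>lborel)"
    by (rule nn_integral_complex_iterated) simp
  also have "\<dots> \<le> (\<integral>\<^sup>+x. \<integral>\<^sup>+y. ennreal (g x) * ennreal (g y) \<partial>lborel \<partial>lborel)"
  proof (rule nn_integral_mono_AE)
    have ne: "AE x in lborel. x \<noteq> (0::real)" by (rule AE_lborel_singleton)
    show "AE x in lborel. (\<integral>\<^sup>+y. ennreal (norm (f (Complex x y))) \<partial>lborel)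
        \<le> (\<integral>\<^sup>+y. ennreal (g x) * ennreal (g y) \<partial>lborel)"
      using ne
    proof eventually_elim
      fix x :: real assume "x \<noteq> 0"
      show "(\<integral>\<^sup>+y. ennreal (norm (f (Complex x y))) \<partial>lborel)
          \<le> (\<integral>\<^sup>+y. ennreal (g x) * ennreal (g y) \<partial>lborel)"
        by (rule nn_integral_mono_AE, use ne in eventually_elim)
          (use bound[OF \<open>x \<noteq> 0\<close>] g in \<open>auto simp flip: ennreal_mult intro!: ennreal_leI\<close>)
    qed
  qed
  also have "\<dots> = (\<integral>\<^sup>+x. ennreal (g x) \<partial>lborel) * (\<integral>\<^sup>+x. ennreal (g x) \<partial>lborel)"
    by (simp add: nn_integral_cmult nn_integral_multc)
  also have "\<dots> < \<infinity>" using fin by (simp add: ennreal_mult_less_top)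
  finally show "(\<integral>\<^sup>+z. ennreal (norm (f z)) \<partial>lborel) < \<infinity>" .
qed simp

lemma nn_integral_abs_powr_finite:
  assumes "R \<ge> 0"
  shows "(\<integral>\<^sup>+x. ennreal (indicator {-R..R} x * \<bar>x\<bar> powr (-1/2)) \<partial>lborel) < \<infinity>"
proof -
  let ?h = "\<lambda>x::real. ennreal (indicator {0..R} x * x powr (-1/2))"
  have "((\<lambda>x. x powr (-1/2)) has_integral R powr (-1/2 + 1) / (-1/2 + 1)) {0..R}"
    by (rule has_integral_powr_from_0) (use assms in auto)
  then have "(\<integral>\<^sup>+x. ?h x \<partial>lborel) = ennreal (R powr (-1/2 + 1) / (-1/2 + 1))"
    by (intro nn_integral_has_integral_lebesgue) auto
  then have fin: "(\<integral>\<^sup>+x. ?h x \<partial>lborel) < \<infinity>" by simp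
  have refl: "(\<integral>\<^sup>+x. ?h (- x) \<partial>lborel) = (\<integral>\<^sup>+x. ?h x \<partial>lborel)"
    using nn_integral_real_affine[of ?h "-1" 0] by simp
  have "(\<integral>\<^sup>+x. ennreal (indicator {-R..R} x * \<bar>x\<bar> powr (-1/2)) \<partial>lborel)
      \<le> (\<integral>\<^sup>+x. ?h x + ?h (- x) \<partial>lborel)"
    by (intro nn_integral_mono) (auto simp: indicator_def abs_if)
  also have "\<dots> = (\<integral>\<^sup>+x. ?h x \<partial>lborel) + (\<integral>\<^sup>+x. ?h (- x) \<partial>lborel)"
    by (rule nn_integral_add) simp_all
  also have "\<dots> < \<infinity>" using fin refl by simp
  finally show ?thesis .
qed

text \<open>Replaces polar coordinates: since |x| |y| is at most x^2 + y^2, the kernel 1/|v| is at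
  most |x|^(-1/2) |y|^(-1/2), and each factor is integrable near 0.\<close>

lemma integrable_inverse_norm_cball:
  "integrable lborel (\<lambda>v::complex. indicator (cball 0 R) v / norm v)"
proof (cases "R \<ge> 0")
  case True
  show ?thesis
  proof (rule integrable_complex_product_bound[OF _ _ nn_integral_abs_powr_finite[OF True]])
    fix x y :: real assume "x \<noteq> 0" "y \<noteq> 0"
    have "(2 * \<bar>x\<bar> * \<bar>y\<bar>) \<le> \<bar>x\<bar>\<^sup>2 + \<bar>y\<bar>\<^sup>2"
      using sum_squares_bound[of "\<bar>x\<bar>" "\<bar>y\<bar>"] by simp
    then have "2 * (\<bar>x\<bar> * \<bar>y\<bar>) \<le> x\<^sup>2 + y\<^sup>2" by simp
    moreover have "0 \<le> \<bar>x\<bar> * \<bar>y\<bar>" by simp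
    ultimately have "\<bar>x\<bar> * \<bar>y\<bar> \<le> x\<^sup>2 + y\<^sup>2" by linarith
    then have "sqrt (\<bar>x\<bar> * \<bar>y\<bar>) \<le> norm (Complex x y)"
      by (simp add: complex_norm)
    moreover have "\<bar>x\<bar> powr (-1/2) * \<bar>y\<bar> powr (-1/2) = 1 / sqrt (\<bar>x\<bar> * \<bar>y\<bar>)"
      by (simp add: powr_minus powr_half_sqrt real_sqrt_mult field_simps)
    moreover have "sqrt (\<bar>x\<bar> * \<bar>y\<bar>) > 0" using \<open>x \<noteq> 0\<close> \<open>y \<noteq> 0\<close> by simp
    ultimately have "1 / norm (Complex x y) \<le> \<bar>x\<bar> powr (-1/2) * \<bar>y\<bar> powr (-1/2)"
      by (simp add: frac_le)
    moreover have "\<bar>x\<bar> \<le> R" "\<bar>y\<bar> \<le> R" if "norm (Complex x y) \<le> R"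
      using that abs_Re_le_cmod[of "Complex x y"] abs_Im_le_cmod[of "Complex x y"] by auto
    ultimately show "norm (indicator (cball 0 R) (Complex x y) / norm (Complex x y))
        \<le> (indicator {-R..R} x * \<bar>x\<bar> powr (-1/2)) * (indicator {-R..R} y * \<bar>y\<bar> powr (-1/2))"
      by (auto simp: indicator_def abs_le_iff)
  next
    show "(\<lambda>v::complex. indicat_real (cball 0 R) v / norm v) \<in> borel_measurable borel"
      by (intro borel_measurable_divide borel_measurable_indicator borel_measurable_continuous_onI)
        (auto intro: borel_closed continuous_intros)
  qed auto
qed (simp add: cball_empty)

lemma nn_integral_inverse_1_plus_square:
  "(\<integral>\<^sup>+x. ennreal (1 / (1 + x\<^sup>2)) \<partial>(lborel :: real measure)) < \<infinity>"
proof -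
  have "integrable lborel (\<lambda>x::real. 1 / (1 + x\<^sup>2))"
    using integrable_inverse_1_plus_square
    by (simp add: set_integrable_def einterval_def inverse_eq_divide)
  then show ?thesis
    by (simp add: integrable_iff_bounded)
qed

text \<open>Up to scaling this is the d-bar derivative of the regularised Cauchy kernel
  \<open>cnj u / (|u|^2 + e^2)\<close>, the approximate identity behind the Cauchy--Pompeiu
  formula.\<close>

lemma integrable_poisson_kernel:
  "integrable lborel (\<lambda>v::complex. 1 / (1 + (norm v)\<^sup>2)\<^sup>2)"
proof (rule integrable_complex_product_bound[OF _ _ nn_integral_inverse_1_plus_square])
  fix x y :: real
  have "(1 + x\<^sup>2) * (1 + y\<^sup>2) \<le> (1 + (x\<^sup>2 + y\<^sup>2)) * (1 + (x\<^sup>2 + y\<^sup>2))"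
    by (intro mult_mono) auto
  then show "norm (1 / (1 + (norm (Complex x y))\<^sup>2)\<^sup>2) \<le> 1 / (1 + x\<^sup>2) * (1 / (1 + y\<^sup>2))"
    by (simp add: cmod_power2 power2_eq_square[of "1 + _"] frac_le add_pos_nonneg)
qed auto

text \<open>The normalising constant of the Cauchy--Pompeiu formula, left symbolic so that the
  integral need not be evaluated. Its positivity allows the division at the end.\<close>

definition kernel_mass :: real where
  "kernel_mass = (\<integral>v. 1 / (1 + (norm (v :: complex))\<^sup>2)\<^sup>2 \<partial>lborel)"

lemma kernel_mass_pos: "kernel_mass > 0"
proof -
  have nn: "AE v::complex in lborel. 0 \<le> 1 / (1 + (norm v)\<^sup>2)\<^sup>2" by auto
  have "kernel_mass \<noteq> 0"
  proof
    assume "kernel_mass = 0"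
    then have "AE v::complex in lborel. 1 / (1 + (norm v)\<^sup>2)\<^sup>2 = 0"
      unfolding kernel_mass_def
      using integral_nonneg_eq_0_iff_AE[OF integrable_poisson_kernel nn] by simp
    moreover have "1 / (1 + (norm v)\<^sup>2)\<^sup>2 \<noteq> 0" for v :: complex
      by (metis add_pos_nonneg divide_eq_0_iff less_numeral_extra(1,3) power_eq_0_iff zero_le_power2 zero_neq_one)
    ultimately have "AE v::complex in lborel. False" by auto
    then have "emeasure (lborel :: complex measure) UNIV = 0"
      by (auto simp: AE_iff_null dest: null_setsD1)
    then show False by simp
  qed
  moreover have "kernel_mass \<ge> 0" unfolding kernel_mass_def by (simp add: integral_nonneg)
  ultimately show ?thesis by simp
qed

section \<open>A smooth partition of unity on the Gaussian integers\<close>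

text \<open>A quadratic spline with knots 0, 1/2, 1 that rises from 0 to 1. It is C^1, which is
  enough because only first derivatives of a cell are ever taken.\<close>

definition step :: "real \<Rightarrow> real" where
  "step x = 2 * ((max 0 x)\<^sup>2 - 2 * (max 0 (x - 1/2))\<^sup>2 + (max 0 (x - 1))\<^sup>2)"

definition dstep :: "real \<Rightarrow> real" where
  "dstep x = 4 * (max 0 x - 2 * max 0 (x - 1/2) + max 0 (x - 1))"

text \<open>A difference of two unit translates of \<open>step\<close>, so that sums over integer
  translates telescope; the support is [-1, 1].\<close>

definition bump :: "real \<Rightarrow> real" where
  "bump x = step (x + 1) - step x"

definition dbump :: "real \<Rightarrow> real" where
  "dbump x = dstep (x + 1) - dstep x"

definition cell :: "complex \<Rightarrow> complex" where
  "cell z = of_real (bump (Re z) * bump (Im z))"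

text \<open>The Wirtinger derivative of \<^const>\<open>cell\<close> with respect to the conjugate variable.\<close>

definition dcell :: "complex \<Rightarrow> complex" where
  "dcell z = (of_real (dbump (Re z) * bump (Im z)) + \<i> * of_real (bump (Re z) * dbump (Im z))) / 2"

lemma has_derivative_max_0_square:
  "((\<lambda>x::real. (max 0 x)\<^sup>2) has_field_derivative 2 * max 0 x) (at x)"
proof -
  consider "x < 0" | "x = 0" | "x > 0" by linarith
  then show ?thesis
  proof cases
    case 1
    have "((\<lambda>x::real. 0) has_field_derivative 2 * max 0 x) (at x)" using 1 by simp
    then show ?thesis
      by (rule has_field_derivative_transform_within_open[where S="{..<0}"]) (use 1 in auto)
  next
    case 2
    have "((\<lambda>h::real. (max 0 h)\<^sup>2 / h) \<longlongrightarrow> 0) (at 0)"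
    proof (rule Lim_null_comparison)
      show "\<forall>\<^sub>F h in at 0. norm ((max 0 h)\<^sup>2 / h) \<le> \<bar>h::real\<bar>"
        by (rule always_eventually) (auto simp: max_def power2_eq_square)
      show "((\<lambda>h::real. \<bar>h\<bar>) \<longlongrightarrow> 0) (at 0)" by (auto intro!: tendsto_eq_intros)
    qed
    then show ?thesis using 2 by (simp add: has_field_derivative_iff)
  next
    case 3
    have "((\<lambda>x::real. x\<^sup>2) has_field_derivative 2 * max 0 x) (at x)"
      using 3 by (auto intro!: derivative_eq_intros)
    then show ?thesis
      by (rule has_field_derivative_transform_within_open[where S="{0<..}"]) (use 3 in auto)
  qed
qed

lemma step_has_derivative: "(step has_field_derivative dstep x) (at x)"
proof -
  have "((\<lambda>x. (max 0 (x - c))\<^sup>2) has_field_derivative 2 * max 0 (x - c)) (at x)" for c :: real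
    using DERIV_shift[of "\<lambda>x. (max 0 x)\<^sup>2" "2 * max 0 (x - c)" x "- c"]
      has_derivative_max_0_square[of "x - c"] by simp
  from DERIV_cmult[OF DERIV_add[OF DERIV_diff[OF this[of 0] DERIV_cmult[OF this[of "1/2"], of 2]]
        this[of 1]], of 2]
  show ?thesis
    unfolding step_def[abs_def] dstep_def by (simp add: algebra_simps)
qed

lemma bump_has_derivative: "(bump has_field_derivative dbump x) (at x)"
  unfolding bump_def[abs_def] dbump_def
  by (intro DERIV_diff DERIV_shift[THEN iffD1] step_has_derivative)

lemma continuous_on_bump [continuous_intros]:
  "continuous_on S f \<Longrightarrow> continuous_on S (\<lambda>x. bump (f x))"
  and continuous_on_dbump [continuous_intros]:
  "continuous_on S f \<Longrightarrow> continuous_on S (\<lambda>x. dbump (f x))"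
  unfolding bump_def step_def dbump_def dstep_def by (intro continuous_intros; assumption)+

lemma step_0: "x \<le> 0 \<Longrightarrow> step x = 0" and step_1: "x \<ge> 1 \<Longrightarrow> step x = 1"
  and dstep_0: "x \<le> 0 \<Longrightarrow> dstep x = 0" and dstep_1: "x \<ge> 1 \<Longrightarrow> dstep x = 0"
  by (auto simp: step_def dstep_def max_def power2_eq_square algebra_simps)

lemma step_bounds: "0 \<le> step x" "step x \<le> 1"
proof -
  consider "x \<le> 0" | "0 \<le> x" "x \<le> 1/2" | "1/2 \<le> x" "x \<le> 1" | "x \<ge> 1" by linarith
  then have "0 \<le> step x \<and> step x \<le> 1"
  proof cases
    case 2
    then have "step x = 2 * x\<^sup>2" by (auto simp: step_def max_def)
    moreover have "x\<^sup>2 \<le> (1/2)\<^sup>2" using 2 by (intro power_mono) auto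
    ultimately show ?thesis by (simp add: power2_eq_square)
  next
    case 3
    then have "step x = 1 - 2 * (1 - x)\<^sup>2"
      by (auto simp: step_def max_def power2_eq_square algebra_simps)
    moreover have "(1 - x)\<^sup>2 \<le> (1/2)\<^sup>2" using 3 by (intro power_mono) auto
    ultimately show ?thesis by (simp add: power2_eq_square)
  qed (auto simp: step_0 step_1)
  then show "0 \<le> step x" "step x \<le> 1" by auto
qed

lemma dstep_bounds: "0 \<le> dstep x" "dstep x \<le> 2"
  by (auto simp: dstep_def max_def)

lemma bump_le: "\<bar>bump x\<bar> \<le> 1" and dbump_le: "\<bar>dbump x\<bar> \<le> 2"
  using step_bounds[of x] step_bounds[of "x + 1"] dstep_bounds[of x] dstep_bounds[of "x + 1"]
  by (auto simp: bump_def dbump_def)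

lemma bump_eq_0: "\<bar>x\<bar> \<ge> 1 \<Longrightarrow> bump x = 0" and dbump_eq_0: "\<bar>x\<bar> \<ge> 1 \<Longrightarrow> dbump x = 0"
  by (cases "x \<ge> 0"; simp add: bump_def dbump_def step_0 step_1 dstep_0 dstep_1)+

text \<open>Both sums telescope. The hypothesis places the two end arguments,
  \<open>x + M + 1\<close> and \<open>x - M\<close>, where \<open>step\<close> is 1 and 0 and
  \<open>dstep\<close> vanishes.\<close>

lemma sum_bump:
  assumes "\<bar>x\<bar> \<le> real M"
  shows "(\<Sum>i\<le>2 * M. bump (x - (real i - real M))) = 1"
    and "(\<Sum>i\<le>2 * M. dbump (x - (real i - real M))) = 0"
proof -
  have "(\<Sum>i\<le>2 * M. bump (x - (real i - real M)))
      = (\<Sum>i\<le>2 * M. step (x + M + 1 - real i) - step (x + M + 1 - real (Suc i)))"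
    by (intro sum.cong) (auto simp: bump_def algebra_simps)
  also have "\<dots> = 1"
    using assms by (subst sum_telescope) (simp add: step_0 step_1)
  finally show "(\<Sum>i\<le>2 * M. bump (x - (real i - real M))) = 1" .
  have "(\<Sum>i\<le>2 * M. dbump (x - (real i - real M)))
      = (\<Sum>i\<le>2 * M. dstep (x + M + 1 - real i) - dstep (x + M + 1 - real (Suc i)))"
    by (intro sum.cong) (auto simp: dbump_def algebra_simps)
  also have "\<dots> = 0"
    using assms by (subst sum_telescope) (simp add: dstep_0 dstep_1)
  finally show "(\<Sum>i\<le>2 * M. dbump (x - (real i - real M))) = 0" .
qed

text \<open>The support is a square of half-side 1. The generous radius 2 follows from
  \<open>cmod_le\<close> and is the radius used in all later estimates.\<close>

lemma cell_eq_0: "norm z \<ge> 2 \<Longrightarrow> cell z = 0" and dcell_eq_0: "norm z \<ge> 2 \<Longrightarrow> dcell z = 0"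
proof -
  assume "norm z \<ge> 2"
  then have "\<bar>Re z\<bar> \<ge> 1 \<or> \<bar>Im z\<bar> \<ge> 1" using cmod_le[of z] by linarith
  then show "cell z = 0" "dcell z = 0"
    by (auto simp: cell_def dcell_def bump_eq_0 dbump_eq_0)
qed

lemma norm_dcell_le: "norm (dcell z) \<le> 2"
proof -
  have "norm (dcell z) \<le> (\<bar>dbump (Re z) * bump (Im z)\<bar> + \<bar>bump (Re z) * dbump (Im z)\<bar>) / 2"
    using norm_triangle_ineq[of "of_real (dbump (Re z) * bump (Im z)) :: complex"
        "\<i> * of_real (bump (Re z) * dbump (Im z))"]
    unfolding dcell_def norm_divide by (simp add: norm_mult abs_mult)
  also have "\<dots> \<le> (2 * 1 + 1 * 2) / 2"
    unfolding abs_mult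
    by (intro divide_right_mono add_mono mult_mono bump_le dbump_le) auto
  finally show ?thesis by simp
qed

lemma continuous_on_cell [continuous_intros]:
  "continuous_on S f \<Longrightarrow> continuous_on S (\<lambda>x. cell (f x))"
  and continuous_on_dcell [continuous_intros]:
  "continuous_on S f \<Longrightarrow> continuous_on S (\<lambda>x. dcell (f x))"
  unfolding cell_def dcell_def by (intro continuous_intros; simp)+

lemma dcell_measurable [measurable]: "dcell \<in> borel_measurable borel"
  and cell_measurable [measurable]: "cell \<in> borel_measurable borel"
  by (intro borel_measurable_continuous_onI continuous_intros)+

section \<open>The Cauchy--Pompeiu formula for a cell\<close>

lemma integral_derivative_compact_support:
  fixes Q Q' :: "real \<Rightarrow> complex"
  assumes der: "\<And>x. (Q has_vector_derivative Q' x) (at x)"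
    and cont: "continuous_on UNIV Q'"
    and supp: "\<And>x. R \<le> \<bar>x\<bar> \<Longrightarrow> Q x = 0" "\<And>x. R \<le> \<bar>x\<bar> \<Longrightarrow> Q' x = 0"
    and R: "R \<ge> 0"
  shows "(\<integral>x. Q' x \<partial>lborel) = 0"
proof -
  have "(\<integral>x. indicator {-R..R} x *\<^sub>R Q' x \<partial>lborel) = Q R - Q (- R)"
  proof (rule integral_FTC_Icc)
    show "(Q has_vector_derivative Q' x) (at x within {-R..R})" for x
      using der has_vector_derivative_at_within by blast
    show "continuous_on {-R..R} Q'" using cont continuous_on_subset by blast
  qed (use R in auto)
  moreover have "indicator {-R..R} x *\<^sub>R Q' x = Q' x" for x
    using supp(2)[of x] by (auto simp: indicator_def)
  ultimately show ?thesis using supp(1)[of R] supp(1)[of "- R"] R by simp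
qed

lemma integrable_continuous_compact_support:
  fixes f :: "complex \<Rightarrow> complex"
  assumes "continuous_on UNIV f" and "\<And>x. R \<le> norm x \<Longrightarrow> f x = 0"
  shows "integrable lborel f"
proof -
  have "integrable lborel (\<lambda>x. indicator (cball 0 R) x *\<^sub>R f x)"
    by (rule borel_integrable_compact) (use assms(1) continuous_on_subset in auto)
  moreover have "(\<lambda>x. indicator (cball 0 R) x *\<^sub>R f x) = f"
    using assms(2) by (auto simp: indicator_def fun_eq_iff)
  ultimately show ?thesis by simp
qed

lemma integral_scale_complex:
  fixes f :: "complex \<Rightarrow> complex"
  assumes [measurable]: "f \<in> borel_measurable borel" and "e > 0"
  shows "(\<integral>u. f u \<partial>lborel) = (\<integral>v. e\<^sup>2 *\<^sub>R f (e *\<^sub>R v) \<partial>lborel)"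
  using assms(2)
  by (subst lborel_affine[of e 0]) (simp_all add: integral_density integral_distr density_1)

lemma integral_reflect_complex:
  fixes f :: "complex \<Rightarrow> complex"
  assumes [measurable]: "f \<in> borel_measurable borel"
  shows "(\<integral>u. f u \<partial>lborel) = (\<integral>v. f (z - v) \<partial>lborel)"
  by (subst lborel_affine[of "-1" z]) (simp_all add: integral_density integral_distr density_1)

lemma integrable_reflect_complex_iff:
  fixes f :: "complex \<Rightarrow> complex"
  assumes [measurable]: "f \<in> borel_measurable borel"
  shows "integrable lborel (\<lambda>v. f (z - v)) \<longleftrightarrow> integrable lborel f"
proof -
  have "integrable lborel f \<longleftrightarrow>
      integrable (density (distr lborel borel (\<lambda>x. z + (- 1) *\<^sub>R x)) (\<lambda>_. ennreal (\<bar>- 1\<bar> ^ DIM(complex)))) f"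
    by (subst lborel_affine[of "-1" z]) simp_all
  also have "\<dots> \<longleftrightarrow> integrable lborel (\<lambda>v. f (z - v))"
    by (simp add: density_1 integrable_distr_eq)
  finally show ?thesis by simp
qed

lemma bump_diff_has_derivative:
  "((\<lambda>x. bump (c - x)) has_real_derivative - dbump (c - x)) (at x)"
proof -
  have "((\<lambda>x. c - x) has_real_derivative -1) (at x)"
    by (auto intro!: derivative_eq_intros)
  from DERIV_chain2[OF bump_has_derivative this] show ?thesis by simp
qed

text \<open>Integration by parts for d-bar. The kernel \<open>cnj u / (|u|^2 + e^2)\<close> is a
  smooth substitute for 1/u; its d-bar derivative is the weight on the right, and the d-bar
  derivative of the compactly supported product \<open>cell (z - u) * k u\<close> has integral
  0.\<close>

lemma dcell_regularised_kernel:
  assumes "e > 0"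
  shows "(\<integral>u. dcell (z - u) * (cnj u / of_real ((norm u)\<^sup>2 + e\<^sup>2)) \<partial>lborel)
    = (\<integral>u. cell (z - u) * of_real (e\<^sup>2 / ((norm u)\<^sup>2 + e\<^sup>2)\<^sup>2) \<partial>lborel)"
proof -
  define S where "S u = (norm u)\<^sup>2 + e\<^sup>2" for u :: complex
  define R where "R = norm z + 2"
  have S_pos: "S u > 0" for u using assms by (simp add: S_def add_nonneg_pos)
  have S_C: "S (Complex x y) = x\<^sup>2 + y\<^sup>2 + e\<^sup>2" for x y by (simp add: S_def cmod_power2)
  define k where "k u = cnj u / of_real (S u)" for u
  define kx where "kx u = 1 / of_real (S u) - cnj u * of_real (2 * Re u) / of_real ((S u)\<^sup>2)" for u
  define ky where "ky u = - \<i> / of_real (S u) - cnj u * of_real (2 * Im u) / of_real ((S u)\<^sup>2)" for u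
  \<comment> \<open>\<open>G1\<close> and \<open>G2\<close> are minus the partial derivatives of
    \<open>cell (z - u) * k u\<close> in the real and the imaginary part of
    \<open>u\<close>.\<close>
  define G1 where "G1 u = of_real (bump (Im (z - u))) *
    (of_real (dbump (Re (z - u))) * k u - of_real (bump (Re (z - u))) * kx u)" for u
  define G2 where "G2 u = of_real (bump (Re (z - u))) *
    (of_real (dbump (Im (z - u))) * k u - of_real (bump (Im (z - u))) * ky u)" for u
  have S_cont [continuous_intros]: "continuous_on T (\<lambda>x. S (f x))" if "continuous_on T f"
    for T and f :: "'b::topological_space \<Rightarrow> complex"
    unfolding S_def using that by (intro continuous_intros)
  have cont: "continuous_on UNIV k" "continuous_on UNIV kx" "continuous_on UNIV ky"
    unfolding k_def kx_def ky_def
    by (intro continuous_intros; use S_pos in \<open>simp add: less_imp_neq[THEN not_sym]\<close>)+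
  have cG: "continuous_on UNIV G1" "continuous_on UNIV G2"
    unfolding G1_def G2_def by (intro continuous_intros cont)+
  have far: "1 \<le> \<bar>Re (z - u)\<bar> \<or> 1 \<le> \<bar>Im (z - u)\<bar>" if "R \<le> norm u" for u
  proof -
    have "norm (z - u) \<ge> 2"
      using that norm_triangle_ineq2[of u z] by (simp add: R_def norm_minus_commute)
    then show ?thesis using cmod_le[of "z - u"] by linarith
  qed
  have "G1 u = 0" "G2 u = 0" if "R \<le> norm u" for u
    using far[OF that] by (auto simp: G1_def G2_def bump_eq_0 dbump_eq_0)
  then have iG: "integrable lborel G1" "integrable lborel G2"
    by (auto intro: integrable_continuous_compact_support[where R=R] cG)
  have k_der: "((\<lambda>x. k (Complex x y)) has_vector_derivative kx (Complex x y)) (at x)" for x y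
  proof -
    have S0: "x\<^sup>2 + y\<^sup>2 + e\<^sup>2 \<noteq> 0" using S_pos[of "Complex x y"] by (simp add: S_C)
    have "((\<lambda>x. (of_real x - \<i> * of_real y)) has_vector_derivative (1 :: complex)) (at x)"
      by (auto intro!: derivative_eq_intros)
    moreover have "((\<lambda>x. 1 / (x\<^sup>2 + y\<^sup>2 + e\<^sup>2)) has_real_derivative
        - (2 * x) / (x\<^sup>2 + y\<^sup>2 + e\<^sup>2)\<^sup>2) (at x)"
      using S0 by (auto intro!: derivative_eq_intros simp: power2_eq_square)
    ultimately have "((\<lambda>x. (of_real x - \<i> * of_real y) * of_real (1 / (x\<^sup>2 + y\<^sup>2 + e\<^sup>2)))
        has_vector_derivative (of_real x - \<i> * of_real y) * of_real (- (2 * x) / (x\<^sup>2 + y\<^sup>2 + e\<^sup>2)\<^sup>2)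
          + 1 * of_real (1 / (x\<^sup>2 + y\<^sup>2 + e\<^sup>2))) (at x)"
      by (intro has_vector_derivative_mult has_vector_derivative_of_real)
    moreover have "k (Complex x y) = (of_real x - \<i> * of_real y) * of_real (1 / (x\<^sup>2 + y\<^sup>2 + e\<^sup>2))" for x
      unfolding k_def S_C by (simp add: Complex_eq)
    moreover have "(of_real x - \<i> * of_real y) * of_real (- (2 * x) / (x\<^sup>2 + y\<^sup>2 + e\<^sup>2)\<^sup>2)
          + 1 * of_real (1 / (x\<^sup>2 + y\<^sup>2 + e\<^sup>2)) = kx (Complex x y)"
      unfolding kx_def S_C by (simp add: Complex_eq minus_divide_left[symmetric])
    ultimately show ?thesis by simp
  qed
  have k_der': "((\<lambda>y. k (Complex x y)) has_vector_derivative ky (Complex x y)) (at y)" for x y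
  proof -
    have S0: "x\<^sup>2 + y\<^sup>2 + e\<^sup>2 \<noteq> 0" using S_pos[of "Complex x y"] by (simp add: S_C)
    have "((\<lambda>y. (of_real x - \<i> * of_real y)) has_vector_derivative (- \<i> :: complex)) (at y)"
      by (auto intro!: derivative_eq_intros)
    moreover have "((\<lambda>y. 1 / (x\<^sup>2 + y\<^sup>2 + e\<^sup>2)) has_real_derivative
        - (2 * y) / (x\<^sup>2 + y\<^sup>2 + e\<^sup>2)\<^sup>2) (at y)"
      using S0 by (auto intro!: derivative_eq_intros simp: power2_eq_square)
    ultimately have "((\<lambda>y. (of_real x - \<i> * of_real y) * of_real (1 / (x\<^sup>2 + y\<^sup>2 + e\<^sup>2)))
        has_vector_derivative (of_real x - \<i> * of_real y) * of_real (- (2 * y) / (x\<^sup>2 + y\<^sup>2 + e\<^sup>2)\<^sup>2)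
          + - \<i> * of_real (1 / (x\<^sup>2 + y\<^sup>2 + e\<^sup>2))) (at y)"
      by (intro has_vector_derivative_mult has_vector_derivative_of_real)
    moreover have "k (Complex x y) = (of_real x - \<i> * of_real y) * of_real (1 / (x\<^sup>2 + y\<^sup>2 + e\<^sup>2))" for y
      unfolding k_def S_C by (simp add: Complex_eq)
    moreover have "(of_real x - \<i> * of_real y) * of_real (- (2 * y) / (x\<^sup>2 + y\<^sup>2 + e\<^sup>2)\<^sup>2)
          + - \<i> * of_real (1 / (x\<^sup>2 + y\<^sup>2 + e\<^sup>2)) = ky (Complex x y)"
      unfolding ky_def S_C by (simp add: Complex_eq minus_divide_left[symmetric])
    ultimately show ?thesis by simp
  qed
  have contC: "continuous_on UNIV (\<lambda>x. h (Complex x y))" "continuous_on UNIV (\<lambda>y. h (Complex x y))"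
    if "continuous_on UNIV h" for h :: "complex \<Rightarrow> complex" and x y
    by (rule continuous_on_compose2[OF that], auto simp: Complex_eq intro!: continuous_intros)+
  have "(\<integral>x. G1 (Complex x y) \<partial>lborel) = 0" for y
  proof (rule integral_derivative_compact_support)
    show "((\<lambda>x. - of_real (bump (Im z - y)) * (of_real (bump (Re z - x)) * k (Complex x y)))
        has_vector_derivative G1 (Complex x y)) (at x)" for x
    proof -
      have "((\<lambda>x. bump (Re z - x)) has_real_derivative - dbump (Re z - x)) (at x)"
        by (rule bump_diff_has_derivative)
      then have "((\<lambda>x. of_real (bump (Re z - x)) :: complex) has_vector_derivative
          of_real (- dbump (Re z - x))) (at x)"
        by (rule has_vector_derivative_of_real)
      then have "((\<lambda>x. - of_real (bump (Im z - y)) * (of_real (bump (Re z - x)) * k (Complex x y)))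
          has_vector_derivative - of_real (bump (Im z - y)) * (of_real (bump (Re z - x)) * kx (Complex x y)
            + of_real (- dbump (Re z - x)) * k (Complex x y))) (at x)"
        by (intro has_vector_derivative_mult_right has_vector_derivative_mult k_der)
      moreover have "- of_real (bump (Im z - y)) * (of_real (bump (Re z - x)) * kx (Complex x y)
            + of_real (- dbump (Re z - x)) * k (Complex x y)) = G1 (Complex x y)"
        by (simp add: G1_def algebra_simps)
      ultimately show ?thesis by simp
    qed
    show "continuous_on UNIV (\<lambda>x. G1 (Complex x y))" by (rule contC cG)+
    fix x assume "\<bar>Re z\<bar> + 1 \<le> \<bar>x\<bar>"
    then have "1 \<le> \<bar>Re z - x\<bar>" by linarith
    then show "- of_real (bump (Im z - y)) * (of_real (bump (Re z - x)) * k (Complex x y)) = 0"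
      "G1 (Complex x y) = 0" by (simp_all add: G1_def bump_eq_0 dbump_eq_0)
  qed auto
  then have i1: "(\<integral>u. G1 u \<partial>lborel) = 0"
    by (subst complex_integral_iterated(2)[OF iG(1)]) simp
  have "(\<integral>y. G2 (Complex x y) \<partial>lborel) = 0" for x
  proof (rule integral_derivative_compact_support)
    show "((\<lambda>y. - of_real (bump (Re z - x)) * (of_real (bump (Im z - y)) * k (Complex x y)))
        has_vector_derivative G2 (Complex x y)) (at y)" for y
    proof -
      have "((\<lambda>x. bump (Im z - x)) has_real_derivative - dbump (Im z - y)) (at y)"
        by (rule bump_diff_has_derivative)
      then have "((\<lambda>x. of_real (bump (Im z - x)) :: complex) has_vector_derivative
          of_real (- dbump (Im z - y))) (at y)"
        by (rule has_vector_derivative_of_real)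
      then have "((\<lambda>y. - of_real (bump (Re z - x)) * (of_real (bump (Im z - y)) * k (Complex x y)))
          has_vector_derivative - of_real (bump (Re z - x)) * (of_real (bump (Im z - y)) * ky (Complex x y)
            + of_real (- dbump (Im z - y)) * k (Complex x y))) (at y)"
        by (intro has_vector_derivative_mult_right has_vector_derivative_mult k_der')
      moreover have "- of_real (bump (Re z - x)) * (of_real (bump (Im z - y)) * ky (Complex x y)
            + of_real (- dbump (Im z - y)) * k (Complex x y)) = G2 (Complex x y)"
        by (simp add: G2_def algebra_simps)
      ultimately show ?thesis by simp
    qed
    show "continuous_on UNIV (\<lambda>y. G2 (Complex x y))" by (rule contC cG)+
    fix y assume "\<bar>Im z\<bar> + 1 \<le> \<bar>y\<bar>"
    then have "1 \<le> \<bar>Im z - y\<bar>" by linarith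
    then show "- of_real (bump (Re z - x)) * (of_real (bump (Im z - y)) * k (Complex x y)) = 0"
      "G2 (Complex x y) = 0" by (simp_all add: G2_def bump_eq_0 dbump_eq_0)
  qed auto
  then have i2: "(\<integral>u. G2 u \<partial>lborel) = 0"
    by (subst complex_integral_iterated(1)[OF iG(2)]) simp
  have dbar_k: "(kx u + \<i> * ky u) / 2 = of_real (e\<^sup>2 / (S u)\<^sup>2)" for u
  proof -
    have n: "cnj u * u = of_real ((norm u)\<^sup>2)" using complex_norm_square[of u] by (simp add: mult.commute)
    have "(kx u + \<i> * ky u) / 2 = 1 / of_real (S u) - cnj u * (of_real (Re u) + \<i> * of_real (Im u)) / of_real ((S u)\<^sup>2)"
      by (simp add: kx_def ky_def algebra_simps add_divide_distrib diff_divide_distrib)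
    also have "\<dots> = 1 / of_real (S u) - of_real ((norm u)\<^sup>2) / of_real ((S u)\<^sup>2)"
      by (simp only: complex_eq[symmetric] n)
    also have "\<dots> = of_real (1 / S u - (norm u)\<^sup>2 / (S u)\<^sup>2)" by simp
    also have "1 / S u - (norm u)\<^sup>2 / (S u)\<^sup>2 = e\<^sup>2 / (S u)\<^sup>2"
    proof -
      have "1 / S u - (norm u)\<^sup>2 / (S u)\<^sup>2 = (S u - (norm u)\<^sup>2) / (S u)\<^sup>2"
        using S_pos[of u] by (simp add: field_simps power2_eq_square)
      then show ?thesis by (simp add: S_def)
    qed
    finally show ?thesis .
  qed
  have eq: "(G1 u + \<i> * G2 u) / 2 =
      dcell (z - u) * k u - cell (z - u) * of_real (e\<^sup>2 / (S u)\<^sup>2)" for u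
    unfolding dbar_k[symmetric] G1_def G2_def dcell_def cell_def of_real_mult
    by (simp add: field_simps del: minus_complex.sel)
  have van: "cell (z - u) = 0" "dcell (z - u) = 0" if "R \<le> norm u" for u
    using far[OF that] by (auto simp: cell_def dcell_def bump_eq_0 dbump_eq_0)
  have S_ne: "(S u)\<^sup>2 \<noteq> 0" for u using S_pos[of u] by simp
  have c1: "integrable lborel (\<lambda>u. dcell (z - u) * k u)"
  proof (rule integrable_continuous_compact_support[where R=R])
    show "continuous_on UNIV (\<lambda>u. dcell (z - u) * k u)" by (intro continuous_intros cont)
  qed (use van in simp)
  have c2: "integrable lborel (\<lambda>u. cell (z - u) * of_real (e\<^sup>2 / (S u)\<^sup>2))"
  proof (rule integrable_continuous_compact_support[where R=R])
    show "continuous_on UNIV (\<lambda>u. cell (z - u) * of_real (e\<^sup>2 / (S u)\<^sup>2))"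
      using S_ne by (intro continuous_intros ballI)
  qed (use van in simp)
  have "0 = (\<integral>u. (G1 u + \<i> * G2 u) / 2 \<partial>lborel)"
    using iG i1 i2 by simp
  also have "\<dots> = (\<integral>u. dcell (z - u) * k u \<partial>lborel) - (\<integral>u. cell (z - u) * of_real (e\<^sup>2 / (S u)\<^sup>2) \<partial>lborel)"
    unfolding eq using c1 c2 by simp
  finally show ?thesis by (simp add: k_def S_def)
qed

text \<open>Let e tend to 0 in \<open>dcell_regularised_kernel\<close>. The left integrand is
  dominated by a multiple of 1/|u| on a disc; the substitution u = e v turns the right side into an
  integral of \<open>cell (z - e v)\<close> against a fixed weight, which tends to
  \<open>cell z\<close> times the mass.\<close>

lemma cauchy_pompeiu_cell:
  "(\<integral>\<zeta>. dcell \<zeta> / (z - \<zeta>) \<partial>lborel) = of_real kernel_mass * cell z"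
proof -
  define e where "e n = 1 / real (Suc n)" for n
  have e_pos: "e n > 0" for n by (simp add: e_def)
  have e_lim: "e \<longlonglongrightarrow> 0" unfolding e_def by (rule LIMSEQ_Suc[OF lim_1_over_n])
  define k where "k n u = cnj u / of_real ((norm u)\<^sup>2 + (e n)\<^sup>2)" for n and u :: complex
  have k_meas [measurable]: "k n \<in> borel_measurable borel" for n
    unfolding k_def using e_pos[of n]
    by (intro borel_measurable_continuous_onI continuous_intros ballI)
      (metis add_nonneg_pos less_irrefl of_real_eq_0_iff zero_le_power2 zero_less_power)
  have L: "(\<lambda>n. \<integral>u. dcell (z - u) * k n u \<partial>lborel) \<longlonglongrightarrow> (\<integral>u. dcell (z - u) * (1 / u) \<partial>lborel)"
  proof (rule integral_dominated_convergence)
    let ?w = "\<lambda>u::complex. 2 * (indicator (cball 0 (norm z + 2)) u / norm u)"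
    show "integrable lborel ?w"
      by (intro integrable_mult_right integrable_inverse_norm_cball)
    have "(\<lambda>n. k n u) \<longlonglongrightarrow> 1 / u" for u
    proof (cases "u = 0")
      case False
      have "(\<lambda>n. k n u) \<longlonglongrightarrow> cnj u / of_real ((norm u)\<^sup>2 + 0\<^sup>2)"
        unfolding k_def using False by (intro tendsto_intros e_lim) auto
      moreover have "cnj u / of_real ((norm u)\<^sup>2 + 0\<^sup>2) = 1 / u"
        using False complex_norm_square[of u] by (simp add: divide_simps mult.commute)
      ultimately show ?thesis by simp
    qed (simp add: k_def)
    then show "AE u in lborel. (\<lambda>n. dcell (z - u) * k n u) \<longlonglongrightarrow> dcell (z - u) * (1 / u)"
      by (intro AE_I2 tendsto_intros)
    show "AE u in lborel. norm (dcell (z - u) * k n u) \<le> ?w u" for n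
    proof (rule AE_I2)
      fix u :: complex
      have kb: "norm (k n u) \<le> 1 / norm u"
      proof (cases "u = 0")
        case False
        have "norm (k n u) = norm u / ((norm u)\<^sup>2 + (e n)\<^sup>2)"
          unfolding k_def norm_divide norm_of_real by simp
        also have "\<dots> \<le> norm u / (norm u)\<^sup>2"
          using False by (intro divide_left_mono mult_pos_pos add_pos_nonneg) auto
        also have "\<dots> = 1 / norm u" using False by (simp add: power2_eq_square)
        finally show ?thesis .
      qed (simp add: k_def)
      show "norm (dcell (z - u) * k n u) \<le> ?w u"
      proof (cases "norm u \<le> norm z + 2")
        case True
        then show ?thesis
          using mult_mono[OF norm_dcell_le kb, of "z - u"] by (simp add: norm_mult)
      next
        case False
        then have "norm (z - u) \<ge> 2"
          using norm_triangle_ineq2[of u z] by (simp add: norm_minus_commute)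
        then show ?thesis by (simp add: dcell_eq_0)
      qed
    qed
  qed measurable
  have scale: "(\<integral>u. cell (z - u) * of_real ((e n)\<^sup>2 / ((norm u)\<^sup>2 + (e n)\<^sup>2)\<^sup>2) \<partial>lborel)
      = (\<integral>v. cell (z - e n *\<^sub>R v) * of_real (1 / (1 + (norm v)\<^sup>2)\<^sup>2) \<partial>lborel)" for n
  proof -
    have "(e n)\<^sup>2 * ((e n)\<^sup>2 / ((norm (e n *\<^sub>R v))\<^sup>2 + (e n)\<^sup>2)\<^sup>2) = 1 / (1 + (norm v)\<^sup>2)\<^sup>2" for v :: complex
    proof -
      have "(norm (e n *\<^sub>R v))\<^sup>2 + (e n)\<^sup>2 = (e n)\<^sup>2 * (1 + (norm v)\<^sup>2)"
        by (simp add: power_mult_distrib algebra_simps)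
      then show ?thesis using e_pos[of n] by (simp add: power_mult_distrib power2_eq_square)
    qed
    note sc = this
    have "(\<integral>u. cell (z - u) * of_real ((e n)\<^sup>2 / ((norm u)\<^sup>2 + (e n)\<^sup>2)\<^sup>2) \<partial>lborel)
        = (\<integral>v. (e n)\<^sup>2 *\<^sub>R (cell (z - e n *\<^sub>R v)
            * of_real ((e n)\<^sup>2 / ((norm (e n *\<^sub>R v))\<^sup>2 + (e n)\<^sup>2)\<^sup>2)) \<partial>lborel)"
      by (rule integral_scale_complex[OF _ e_pos[of n]]) measurable
    also have "\<dots> = (\<integral>v. cell (z - e n *\<^sub>R v) * of_real (1 / (1 + (norm v)\<^sup>2)\<^sup>2) \<partial>lborel)"
    proof (rule Bochner_Integration.integral_cong[OF refl])
      fix v :: complex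
      have "(e n)\<^sup>2 *\<^sub>R (cell (z - e n *\<^sub>R v) * of_real x) = cell (z - e n *\<^sub>R v) * of_real ((e n)\<^sup>2 * x)" for x
        by (simp only: scaleR_conv_of_real of_real_mult mult.left_commute)
      then show "(e n)\<^sup>2 *\<^sub>R (cell (z - e n *\<^sub>R v)
            * of_real ((e n)\<^sup>2 / ((norm (e n *\<^sub>R v))\<^sup>2 + (e n)\<^sup>2)\<^sup>2))
          = cell (z - e n *\<^sub>R v) * of_real (1 / (1 + (norm v)\<^sup>2)\<^sup>2)"
        by (simp only: sc)
    qed
    finally show ?thesis .
  qed
  have Rlim: "(\<lambda>n. \<integral>v. cell (z - e n *\<^sub>R v) * of_real (1 / (1 + (norm v)\<^sup>2)\<^sup>2) \<partial>lborel)
      \<longlonglongrightarrow> (\<integral>v. cell z * of_real (1 / (1 + (norm v)\<^sup>2)\<^sup>2) \<partial>(lborel :: complex measure))"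
  proof (rule integral_dominated_convergence)
    show "integrable lborel (\<lambda>v::complex. 1 / (1 + (norm v)\<^sup>2)\<^sup>2)" by (rule integrable_poisson_kernel)
    show "AE v in lborel. (\<lambda>n. cell (z - e n *\<^sub>R v) * of_real (1 / (1 + (norm v)\<^sup>2)\<^sup>2))
        \<longlonglongrightarrow> cell z * of_real (1 / (1 + (norm v)\<^sup>2)\<^sup>2)"
    proof (rule AE_I2)
      fix v :: complex
      have "continuous_on UNIV cell" by (intro continuous_intros)
      then have c: "isCont cell z" by (simp add: continuous_on_eq_continuous_at)
      have "(\<lambda>n. z - e n *\<^sub>R v) \<longlonglongrightarrow> z - 0 *\<^sub>R v"
        by (intro tendsto_intros e_lim)
      then have "(\<lambda>n. z - e n *\<^sub>R v) \<longlonglongrightarrow> z" by simp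
      from isCont_tendsto_compose[OF c this]
      have "(\<lambda>n. cell (z - e n *\<^sub>R v)) \<longlonglongrightarrow> cell z" .
      then show "(\<lambda>n. cell (z - e n *\<^sub>R v) * of_real (1 / (1 + (norm v)\<^sup>2)\<^sup>2))
        \<longlonglongrightarrow> cell z * of_real (1 / (1 + (norm v)\<^sup>2)\<^sup>2)"
        by (intro tendsto_intros)
    qed
    show "AE v in lborel. norm (cell (z - e n *\<^sub>R v) * of_real (1 / (1 + (norm v)\<^sup>2)\<^sup>2))
        \<le> 1 / (1 + (norm v)\<^sup>2)\<^sup>2" for n
    proof (rule AE_I2)
      fix v
      have "norm (cell w) \<le> 1" for w
        using mult_mono[OF bump_le bump_le, of "Re w" "Im w"] by (simp add: cell_def abs_mult norm_mult mult.commute)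
      from mult_right_mono[OF this, of "1 / (1 + (norm v)\<^sup>2)\<^sup>2" "z - e n *\<^sub>R v"]
      show "norm (cell (z - e n *\<^sub>R v) * of_real (1 / (1 + (norm v)\<^sup>2)\<^sup>2)) \<le> 1 / (1 + (norm v)\<^sup>2)\<^sup>2"
        unfolding norm_mult norm_of_real by simp
    qed
  qed measurable
  have "(\<integral>u. dcell (z - u) * (1 / u) \<partial>lborel)
      = (\<integral>v. cell z * of_real (1 / (1 + (norm v)\<^sup>2)\<^sup>2) \<partial>(lborel :: complex measure))"
    using L Rlim unfolding k_def dcell_regularised_kernel[OF e_pos] scale by (rule LIMSEQ_unique)
  also have "\<dots> = of_real kernel_mass * cell z"
    by (simp only: integral_mult_right_zero integral_complex_of_real kernel_mass_def mult.commute)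
  finally show ?thesis
    by (subst integral_reflect_complex[where z=z]) simp_all
qed

section \<open>Cauchy transforms\<close>

text \<open>Bounds the integral of 1/|v| over every disc of radius 2, wherever its centre: within
  distance 1 of the singularity the first summand suffices, and elsewhere the kernel is at most 1,
  so the area suffices. Cauchy transforms are thus estimated uniformly in the point of
  evaluation.\<close>

definition singular_mass :: real where
  "singular_mass = (\<integral>v. indicator (cball 0 1) v / norm v \<partial>(lborel :: complex measure))
     + measure lborel (cball (0 :: complex) 2)"

lemma singular_mass_ge: "measure lborel (cball (0 :: complex) 2) \<le> singular_mass"
  unfolding singular_mass_def by (simp add: integral_nonneg)

lemma measure_cball_complex: "measure lborel (cball (c :: complex) r) = measure lborel (cball (0 :: complex) r)"
  by (cases "r \<ge> 0") (simp_all add: content_cball)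

lemma integrable_indicator_cball:
  "integrable lborel (\<lambda>v. indicator (cball (c :: complex) r) v :: real)"
  using emeasure_lborel_cball_finite[of c r] by (simp add: integrable_indicator_iff)

lemma norm_integral_le_integral:
  fixes f :: "'a \<Rightarrow> complex" and h :: "'a \<Rightarrow> real"
  assumes "integrable M f" "integrable M h" "\<And>x. norm (f x) \<le> h x"
  shows "norm (\<integral>x. f x \<partial>M) \<le> (\<integral>x. h x \<partial>M)"
proof -
  have "norm (\<integral>x. f x \<partial>M) \<le> (\<integral>x. norm (f x) \<partial>M)" by (rule integral_norm_bound)
  also have "\<dots> \<le> (\<integral>x. h x \<partial>M)" using assms by (intro integral_mono) auto
  finally show ?thesis .
qed

text \<open>Collects the estimates shared by the various densities built from a translate of
  \<open>dcell\<close>: with a constant, with \<open>F\<close>, with a difference of values of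
  \<open>F\<close>, and with the integrands of the moments.\<close>

locale bump_density =
  fixes g :: "complex \<Rightarrow> complex" and B R :: real and k :: complex
  assumes g_meas [measurable]: "g \<in> borel_measurable borel"
    and g_bound: "\<And>\<zeta>. norm (g \<zeta>) \<le> B"
    and g_supp: "\<And>\<zeta>. R < norm (\<zeta> - k) \<Longrightarrow> g \<zeta> = 0"
begin

lemma B_nonneg: "B \<ge> 0"
  using g_bound[of 0] norm_ge_zero order_trans by blast

lemma g_le_indicator: "norm (g \<zeta>) \<le> B * indicator (cball k R) \<zeta>"
  using g_bound[of \<zeta>] g_supp[of \<zeta>] B_nonneg by (auto simp: indicator_def dist_norm norm_minus_commute)

lemma integrable_density: "integrable lborel g"
proof (rule Bochner_Integration.integrable_bound)
  show "integrable lborel (\<lambda>\<zeta>. B * indicator (cball k R) \<zeta>)"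
    by (intro integrable_mult_right integrable_indicator_cball)
qed (use g_le_indicator in \<open>auto intro!: AE_I2 order_trans[OF _ abs_ge_self]\<close>)

lemma integral_density_le: "norm (\<integral>\<zeta>. g \<zeta> \<partial>lborel) \<le> B * measure lborel (cball (0 :: complex) R)"
proof -
  have "norm (\<integral>\<zeta>. g \<zeta> \<partial>lborel) \<le> (\<integral>\<zeta>. B * indicator (cball k R) \<zeta> \<partial>lborel)"
    by (intro norm_integral_le_integral integrable_density integrable_mult_right
        integrable_indicator_cball g_le_indicator)
  then show ?thesis by (simp add: measure_cball_complex[of k])
qed

lemma integrable_cauchy_kernel: "integrable lborel (\<lambda>\<zeta>. g \<zeta> / (z - \<zeta>))"
proof -
  \<comment> \<open>The reflection \<zeta> = z - v moves the singularity of the kernel to 0.\<close>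
  have "integrable lborel (\<lambda>v. g (z - v) / (z - (z - v)))"
  proof (rule Bochner_Integration.integrable_bound)
    show "integrable lborel (\<lambda>v :: complex. B * (indicator (cball 0 (R + norm (z - k))) v / norm v))"
      by (intro integrable_mult_right integrable_inverse_norm_cball)
    show "AE v in lborel. norm (g (z - v) / (z - (z - v)))
        \<le> norm (B * (indicator (cball 0 (R + norm (z - k))) v / norm v))"
    proof (rule AE_I2)
      fix v
      have "norm v \<le> R + norm (z - k)" if "norm (z - v - k) \<le> R"
        using that norm_triangle_ineq4[of "z - k" "z - v - k"] by simp
      then have "norm (g (z - v)) \<le> B * indicator (cball 0 (R + norm (z - k))) v"
        using g_le_indicator[of "z - v"] g_supp[of "z - v"] B_nonneg
        by (cases "norm (z - v - k) \<le> R") (auto simp: indicator_def dist_norm norm_minus_commute)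
      from divide_right_mono[OF this, of "norm v"]
      show "norm (g (z - v) / (z - (z - v)))
        \<le> norm (B * (indicator (cball 0 (R + norm (z - k))) v / norm v))"
        using B_nonneg by (simp add: norm_divide norm_mult)
    qed
  qed measurable
  then show ?thesis
    by (subst (asm) integrable_reflect_complex_iff) measurable
qed

lemma cauchy_integral_le:
  "norm (\<integral>\<zeta>. g \<zeta> / (z - \<zeta>) \<partial>lborel) \<le> B * ((\<integral>v. indicator (cball 0 1) v / norm v \<partial>(lborel :: complex measure))
     + measure lborel (cball (0 :: complex) R))"
proof -
  let ?w = "\<lambda>v. B * (indicator (cball 0 1) v / norm v + indicator (cball (z - k) R) v)"
  have "norm (\<integral>\<zeta>. g \<zeta> / (z - \<zeta>) \<partial>lborel) = norm (\<integral>v. g (z - v) / v \<partial>lborel)"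
    by (subst integral_reflect_complex[where z=z]) simp_all
  also have "\<dots> \<le> (\<integral>v. ?w v \<partial>lborel)"
  proof (rule norm_integral_le_integral)
    show "integrable lborel (\<lambda>v. g (z - v) / v)"
      using integrable_reflect_complex_iff[of "\<lambda>\<zeta>. g \<zeta> / (z - \<zeta>)" z] integrable_cauchy_kernel by simp
    show "integrable lborel ?w"
      by (intro integrable_mult_right Bochner_Integration.integrable_add integrable_inverse_norm_cball)
        (rule integrable_indicator_cball)
    fix v
    have a: "norm (g (z - v)) \<le> B * indicator (cball (z - k) R) v"
      using g_le_indicator[of "z - v"] by (simp add: indicator_def dist_norm algebra_simps norm_minus_commute)
    show "norm (g (z - v) / v) \<le> ?w v"
    proof (cases "norm v \<le> 1")
      case True
      have "norm (g (z - v) / v) \<le> B / norm v"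
        using g_bound[of "z - v"] by (simp add: norm_divide divide_right_mono)
      then show ?thesis
        using True B_nonneg by (auto simp: distrib_left indicator_def)
    next
      case False
      then have "norm (g (z - v) / v) \<le> norm (g (z - v))"
        using mult_left_mono[of 1 "norm v" "norm (g (z - v))"] by (simp add: norm_divide divide_le_eq)
      then show ?thesis using a False by (simp add: indicator_def)
    qed
  qed
  also have "\<dots> = B * ((\<integral>v. indicator (cball 0 1) v / norm v \<partial>(lborel :: complex measure))
     + measure lborel (cball (0 :: complex) R))"
    by (subst integral_mult_right_zero, subst Bochner_Integration.integral_add)
      (simp_all add: integrable_inverse_norm_cball integrable_indicator_cball
        measure_cball_complex[of "z - k"])
  finally show ?thesis .
qed

text \<open>The kernel is replaced inside the disc of radius \<open>e n\<close> by a multiple of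
  \<open>cnj v\<close> that matches 1/v on its boundary. The new kernels are continuous and bounded,
  so their transforms are continuous; the error is at most \<open>B\<close> times the integral of
  1/|v| over a shrinking disc, uniformly in \<open>z\<close>.\<close>

lemma continuous_on_cauchy_integral: "continuous_on UNIV (\<lambda>z. \<integral>\<zeta>. g \<zeta> / (z - \<zeta>) \<partial>lborel)"
proof -
  define e where "e n = 1 / real (Suc n)" for n
  have e_pos: "e n > 0" for n by (simp add: e_def)
  define kk where "kk n v = cnj v / of_real ((max (e n) (norm v))\<^sup>2)" for n v
  have kk_cont: "continuous_on UNIV (kk n)" for n
    unfolding kk_def using e_pos[of n] by (intro continuous_intros) (auto simp: max_def)
  then have kk_meas [measurable]: "kk n \<in> borel_measurable borel" for n
    by (rule borel_measurable_continuous_onI)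
  have kk_le: "norm (kk n v) \<le> 1 / e n" for n v
  proof -
    let ?m = "max (e n) (norm v)"
    have "norm (kk n v) = norm v / ?m\<^sup>2" unfolding kk_def norm_divide norm_of_real by simp
    also have "\<dots> \<le> ?m / ?m\<^sup>2" by (intro divide_right_mono) auto
    also have "\<dots> = 1 / ?m" using e_pos[of n] by (simp add: power2_eq_square)
    also have "\<dots> \<le> 1 / e n" using e_pos[of n] by (intro divide_left_mono) auto
    finally show ?thesis .
  qed
  have kk_diff: "norm (1 / v - kk n v) \<le> indicator (cball 0 (e n)) v / norm v" for n v
  proof (cases "v = 0")
    case False
    have inv: "1 / v = cnj v / of_real ((norm v)\<^sup>2)"
      using False complex_norm_square[of v] by (simp add: divide_simps mult.commute)
    show ?thesis
    proof (cases "norm v \<le> e n")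
      case True
      have "1 / v - kk n v = cnj v * of_real (1 / (norm v)\<^sup>2 - 1 / (e n)\<^sup>2)"
        using True by (simp add: kk_def inv max_absorb1 right_diff_distrib)
      then have "norm (1 / v - kk n v) = norm v * \<bar>1 / (norm v)\<^sup>2 - 1 / (e n)\<^sup>2\<bar>"
        by (simp only: norm_mult norm_of_real complex_mod_cnj)
      also have "\<bar>1 / (norm v)\<^sup>2 - 1 / (e n)\<^sup>2\<bar> \<le> 1 / (norm v)\<^sup>2"
      proof -
        have "1 / (e n)\<^sup>2 \<le> 1 / (norm v)\<^sup>2"
          using True False e_pos[of n] by (intro divide_left_mono power_mono) auto
        moreover have "0 \<le> 1 / (e n)\<^sup>2" by simp
        ultimately show ?thesis by linarith
      qed
      finally show ?thesis using True False by (simp add: power2_eq_square)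
    next
      case F: False
      then have "kk n v = 1 / v" by (simp add: kk_def inv max_absorb2)
      then show ?thesis by simp
    qed
  \<comment> \<open>At 0 both sides vanish, since division by 0 gives 0.\<close>
  qed (simp add: kk_def)
  define Cn where "Cn n z = (\<integral>\<zeta>. g \<zeta> * kk n (z - \<zeta>) \<partial>lborel)" for n z
  have gk_le: "norm (g \<zeta> * kk n v) \<le> B * indicator (cball k R) \<zeta> * (1 / e n)" for \<zeta> n v
    unfolding norm_mult using g_le_indicator[of \<zeta>] kk_le[of n v] B_nonneg
    by (intro mult_mono) auto
  have int_w: "integrable lborel (\<lambda>\<zeta>. B * indicator (cball k R) \<zeta> * (1 / e n))" for n
    by (intro integrable_mult_right integrable_mult_left)
      (rule integrable_indicator_cball)
  have gk_int: "integrable lborel (\<lambda>\<zeta>. g \<zeta> * kk n (z - \<zeta>))" for n z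
  proof (rule Bochner_Integration.integrable_bound[OF int_w[of n]])
    show "AE \<zeta> in lborel. norm (g \<zeta> * kk n (z - \<zeta>)) \<le> norm (B * indicator (cball k R) \<zeta> * (1 / e n))"
      unfolding real_norm_def by (intro AE_I2 order_trans[OF gk_le abs_ge_self])
  qed simp
  have Cn_cont: "continuous_on UNIV (Cn n)" for n
    unfolding continuous_on_sequentially
  proof (intro allI ballI impI, elim conjE)
    fix x :: "nat \<Rightarrow> complex" and a assume "x \<longlonglongrightarrow> a"
    show "(Cn n \<circ> x) \<longlonglongrightarrow> Cn n a"
      unfolding o_def Cn_def
    proof (rule integral_dominated_convergence[OF _ _ int_w[of n]])
      show "AE \<zeta> in lborel. (\<lambda>i. g \<zeta> * kk n (x i - \<zeta>)) \<longlonglongrightarrow> g \<zeta> * kk n (a - \<zeta>)"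
      proof (intro AE_I2 tendsto_mult_left)
        fix \<zeta>
        have "(\<lambda>i. x i - \<zeta>) \<longlonglongrightarrow> a - \<zeta>" using \<open>x \<longlonglongrightarrow> a\<close> by (intro tendsto_intros)
        then show "(\<lambda>i. kk n (x i - \<zeta>)) \<longlonglongrightarrow> kk n (a - \<zeta>)"
          using kk_cont[of n] by (intro isCont_tendsto_compose[where g="kk n"]) (auto simp: continuous_on_eq_continuous_at)
      qed
    qed (use gk_le in auto)
  qed
  have "uniform_limit UNIV Cn (\<lambda>z. \<integral>\<zeta>. g \<zeta> / (z - \<zeta>) \<partial>lborel) sequentially"
  proof -
    define d where "d n = B * (\<integral>v. indicator (cball 0 (e n)) v / norm v \<partial>(lborel :: complex measure))" for n
    have bound: "norm (Cn n z - (\<integral>\<zeta>. g \<zeta> / (z - \<zeta>) \<partial>lborel)) \<le> d n" for n z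
    proof -
      have "(\<integral>\<zeta>. g \<zeta> / (z - \<zeta>) \<partial>lborel) - Cn n z = (\<integral>\<zeta>. g \<zeta> / (z - \<zeta>) - g \<zeta> * kk n (z - \<zeta>) \<partial>lborel)"
        unfolding Cn_def using gk_int integrable_cauchy_kernel by simp
      also have "\<dots> = (\<integral>v. g (z - v) * (1 / v - kk n v) \<partial>lborel)"
        by (subst integral_reflect_complex[where z=z]) (simp_all add: right_diff_distrib)
      also have "norm \<dots> \<le> (\<integral>v. B * (indicator (cball 0 (e n)) v / norm v) \<partial>(lborel :: complex measure))"
      proof (rule norm_integral_le_integral)
        have "integrable lborel (\<lambda>v. (\<lambda>\<zeta>. g \<zeta> / (z - \<zeta>) - g \<zeta> * kk n (z - \<zeta>)) (z - v))"
          using gk_int integrable_cauchy_kernel by (subst integrable_reflect_complex_iff) auto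
        then show "integrable lborel (\<lambda>v. g (z - v) * (1 / v - kk n v))"
          by (simp add: right_diff_distrib)
        show "integrable lborel (\<lambda>v. B * (indicator (cball 0 (e n)) v / norm (v::complex)))"
          by (intro integrable_mult_right integrable_inverse_norm_cball)
        fix v show "norm (g (z - v) * (1 / v - kk n v)) \<le> B * (indicator (cball 0 (e n)) v / norm v)"
          unfolding norm_mult by (intro mult_mono g_bound kk_diff B_nonneg) simp
      qed
      finally show ?thesis
        unfolding d_def by (subst norm_minus_commute) (simp only: integral_mult_right_zero)
    qed
    have "d \<longlonglongrightarrow> 0"
    proof -
      have "(\<lambda>n. \<integral>v. indicator (cball 0 (e n)) v / norm v \<partial>(lborel :: complex measure)) \<longlonglongrightarrow>
          (\<integral>v. 0 \<partial>(lborel :: complex measure))"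
      proof (rule integral_dominated_convergence[OF _ _ integrable_inverse_norm_cball[of 1]])
        show "AE v in lborel. (\<lambda>n. indicator (cball 0 (e n)) v / norm (v::complex)) \<longlonglongrightarrow> 0"
        proof (rule AE_I2)
          fix v :: complex
          show "(\<lambda>n. indicator (cball 0 (e n)) v / norm v) \<longlonglongrightarrow> 0"
          proof (cases "v = 0")
            case False
            have "e \<longlonglongrightarrow> 0" unfolding e_def by (rule LIMSEQ_Suc[OF lim_1_over_n])
            then have "\<forall>\<^sub>F n in sequentially. e n < norm v"
              using False by (intro order_tendstoD(2)) auto
            then have "\<forall>\<^sub>F n in sequentially. indicator (cball 0 (e n)) v / norm v = (0 :: real)"
              by eventually_elim (simp add: indicator_def)
            then show ?thesis by (rule tendsto_eventually)
          qed simp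
        qed
        have "e n \<le> 1" for n by (simp add: e_def)
        then show "AE v in lborel. norm (indicator (cball 0 (e n)) v / norm (v::complex))
            \<le> indicator (cball 0 1) v / norm v" for n
          by (intro AE_I2) (auto simp: indicator_def intro: order_trans)
        show "(\<lambda>v::complex. indicat_real (cball 0 (e n)) v / norm v) \<in> borel_measurable lborel" for n
          using integrable_inverse_norm_cball[of "e n"] by (rule borel_measurable_integrable)
      qed simp
      then show ?thesis unfolding d_def by (auto intro: tendsto_eq_intros)
    qed
    note lim = this
    show ?thesis
    proof (rule uniform_limitI)
      fix \<epsilon> :: real assume "\<epsilon> > 0"
      then have "\<forall>\<^sub>F n in sequentially. d n < \<epsilon>" using order_tendstoD(2)[OF lim] by blast
      then show "\<forall>\<^sub>F n in sequentially. \<forall>z\<in>UNIV. dist (Cn n z) (\<integral>\<zeta>. g \<zeta> / (z - \<zeta>) \<partial>lborel) < \<epsilon>"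
        by (rule eventually_mono) (auto simp: dist_norm intro: le_less_trans[OF bound])
    qed
  qed
  from uniform_limit_theorem[OF always_eventually[OF allI[OF Cn_cont]] this sequentially_bot]
  show ?thesis .
qed

end

section \<open>Vitushkin localisation\<close>

text \<open>For \<zeta> near \<open>z0\<close> the quotient is controlled by the derivative of
  \<open>F\<close>; for the other \<zeta> the denominator is at least \<open>r\<close> and the
  boundedness of \<open>F\<close> suffices. Nothing is asked of \<open>F\<close> off
  \<open>U\<close> beyond boundedness, as the extension used later is not even continuous
  there.\<close>

lemma difference_quotient_bound:
  assumes "cball z0 (2 * r) \<subseteq> U" "open U" "r > 0" and hol: "F holomorphic_on U"
    and bdd: "\<And>\<zeta>. norm (F \<zeta>) \<le> S"
  obtains L where "\<And>z \<zeta>. z \<in> ball z0 r \<Longrightarrow>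
    norm (if z = \<zeta> then deriv F \<zeta> else (F z - F \<zeta>) / (z - \<zeta>)) \<le> L"
proof -
  have S: "S \<ge> 0" using bdd[of 0] norm_ge_zero order_trans by blast
  have "continuous_on (cball z0 (2 * r)) (deriv F)"
    using holomorphic_deriv[OF hol \<open>open U\<close>] assms(1) holomorphic_on_imp_continuous_on continuous_on_subset by blast
  then have "bounded (deriv F ` cball z0 (2 * r))"
    by (intro compact_imp_bounded compact_continuous_image) auto
  then obtain D where D: "\<And>w. w \<in> cball z0 (2 * r) \<Longrightarrow> norm (deriv F w) \<le> D"
    unfolding bounded_iff by blast
  show ?thesis
  proof (rule that)
    fix z \<zeta> assume z: "z \<in> ball z0 r"
    have zin: "z \<in> ball z0 (2 * r)" using z \<open>r > 0\<close> by auto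
    show "norm (if z = \<zeta> then deriv F \<zeta> else (F z - F \<zeta>) / (z - \<zeta>)) \<le> max D (2 * S / r)"
    proof (cases "z = \<zeta>")
      case True
      then show ?thesis using D[of z] zin by (auto simp: le_max_iff_disj)
    next
      case ne: False
      show ?thesis
      proof (cases "\<zeta> \<in> ball z0 (2 * r)")
        case True
        have "norm (F z - F \<zeta>) \<le> D * norm (z - \<zeta>)"
        proof (rule field_differentiable_bound[where S="ball z0 (2 * r)"])
          fix w assume w: "w \<in> ball z0 (2 * r)"
          then have "w \<in> U" using assms(1) ball_subset_cball by blast
          then show "(F has_field_derivative deriv F w) (at w within ball z0 (2 * r))"
            using holomorphic_derivI[OF hol \<open>open U\<close>] has_field_derivative_at_within by blast
          show "norm (deriv F w) \<le> D" using D w by auto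
        qed (use True zin in auto)
        then show ?thesis using ne by (simp add: norm_divide divide_le_eq le_max_iff_disj)
      next
        case False
        have "r \<le> norm (z - \<zeta>)"
          using False z dist_triangle[of z0 \<zeta> z] by (simp add: dist_norm)
        moreover have "norm (F z - F \<zeta>) \<le> 2 * S"
          using bdd[of z] bdd[of \<zeta>] norm_triangle_ineq4[of "F z" "F \<zeta>"] by linarith
        ultimately have "norm (F z - F \<zeta>) / norm (z - \<zeta>) \<le> 2 * S / r"
          using S \<open>r > 0\<close> by (intro frac_le) auto
        then show ?thesis using ne by (simp add: norm_divide le_max_iff_disj)
      qed
    qed
  qed
qed

lemma cauchy_pompeiu_cell_shift:
  "(\<integral>\<zeta>. dcell (\<zeta> - k) / (z - \<zeta>) \<partial>lborel) = of_real kernel_mass * cell (z - k)"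
proof -
  have "(\<integral>\<zeta>. dcell (\<zeta> - k) / (z - \<zeta>) \<partial>lborel)
      = (\<integral>v. dcell (z - v - k) / (z - (z - v)) \<partial>lborel)"
    by (rule integral_reflect_complex[where z=z]) measurable
  also have "\<dots> = (\<integral>v. dcell (z - k - v) / ((z - k) - (z - k - v)) \<partial>lborel)"
    by (simp add: algebra_simps)
  also have "\<dots> = (\<integral>\<zeta>. dcell \<zeta> / (z - k - \<zeta>) \<partial>lborel)"
    by (rule integral_reflect_complex[where z="z - k", symmetric]) measurable
  finally show ?thesis by (simp add: cauchy_pompeiu_cell)
qed

text \<open>Vitushkin's localisation operator for the translate of \<^const>\<open>cell\<close> to \<open>k\<close>, multiplied by
  the constant \<^const>\<open>kernel_mass\<close>, whose value (namely pi) never matters.\<close>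

definition localise :: "complex \<Rightarrow> (complex \<Rightarrow> complex) \<Rightarrow> complex \<Rightarrow> complex" where
  "localise k F z = of_real kernel_mass * cell (z - k) * F z - (\<integral>\<zeta>. F \<zeta> * dcell (\<zeta> - k) / (z - \<zeta>) \<partial>lborel)"

text \<open>Sign and powers come from expanding 1/(z - \<zeta>) in powers of 1/(z - k). The
  subtraction of \<open>F k\<close> makes the integrand as small as the oscillation of
  \<open>F\<close> on the cell instead of its size.\<close>

definition moment :: "nat \<Rightarrow> complex \<Rightarrow> (complex \<Rightarrow> complex) \<Rightarrow> complex" where
  "moment j k F = - (\<integral>\<zeta>. (F \<zeta> - F k) * dcell (\<zeta> - k) * (\<zeta> - k) ^ j \<partial>lborel)"

context
  fixes F :: "complex \<Rightarrow> complex" and S e :: real and k :: complex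
  assumes F_meas [measurable]: "F \<in> borel_measurable borel"
    and F_bdd: "\<And>\<zeta>. norm (F \<zeta>) \<le> S"
begin

lemma bound_nonneg: "S \<ge> 0"
  using F_bdd[of 0] norm_ge_zero order_trans by blast

lemma bump_density_dcell: "bump_density (\<lambda>\<zeta>. dcell (\<zeta> - k)) 2 2 k"
  by unfold_locales (use norm_dcell_le dcell_eq_0 in auto)

lemma bump_density_F_dcell: "bump_density (\<lambda>\<zeta>. F \<zeta> * dcell (\<zeta> - k)) (S * 2) 2 k"
proof unfold_locales
  show "norm (F \<zeta> * dcell (\<zeta> - k)) \<le> S * 2" for \<zeta>
    unfolding norm_mult using F_bdd bound_nonneg by (intro mult_mono norm_dcell_le) auto
qed (use dcell_eq_0 in auto)

text \<open>By Cauchy--Pompeiu a constant contributes only a multiple of the cell. Hence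
  \<open>localise\<close> can be written with any convenient constant: \<open>c = F z\<close> in
  general, and \<open>c = F k\<close> where the cell vanishes.\<close>

lemma cauchy_integral_difference:
  "(\<integral>\<zeta>. (c - F \<zeta>) * dcell (\<zeta> - k) / (z - \<zeta>) \<partial>lborel)
    = c * (of_real kernel_mass * cell (z - k)) - (\<integral>\<zeta>. F \<zeta> * dcell (\<zeta> - k) / (z - \<zeta>) \<partial>lborel)"
proof -
  have i: "integrable lborel (\<lambda>\<zeta>. c * (dcell (\<zeta> - k) / (z - \<zeta>)))"
    by (intro integrable_mult_right bump_density.integrable_cauchy_kernel[OF bump_density_dcell])
  have "(c - F \<zeta>) * dcell (\<zeta> - k) / (z - \<zeta>)
      = c * (dcell (\<zeta> - k) / (z - \<zeta>)) - F \<zeta> * dcell (\<zeta> - k) / (z - \<zeta>)" for \<zeta>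
    by (simp add: diff_divide_distrib left_diff_distrib)
  then show ?thesis
    using Bochner_Integration.integral_diff[OF i
        bump_density.integrable_cauchy_kernel[OF bump_density_F_dcell, of z]]
    by (simp only: integral_mult_right_zero cauchy_pompeiu_cell_shift)
qed

text \<open>In this form the integrand is a difference quotient of \<open>F\<close> times a fixed
  weight, which makes holomorphy and smallness visible.\<close>

lemma localise_eq:
  "localise k F z = (\<integral>\<zeta>. (F z - F \<zeta>) * dcell (\<zeta> - k) / (z - \<zeta>) \<partial>lborel)"
  unfolding cauchy_integral_difference localise_def by (simp add: mult_ac)

lemma continuous_on_localise:
  assumes "continuous_on K F"
  shows "continuous_on K (localise k F)"
proof -
  have "continuous_on K (\<lambda>z. \<integral>\<zeta>. F \<zeta> * dcell (\<zeta> - k) / (z - \<zeta>) \<partial>lborel)"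
    using bump_density.continuous_on_cauchy_integral[OF bump_density_F_dcell] continuous_on_subset
    by blast
  then show ?thesis
    unfolding localise_def[abs_def]
    by (intro continuous_on_diff continuous_on_mult continuous_on_const continuous_on_cell
        continuous_on_id assms)
qed

text \<open>Where \<open>F\<close> is holomorphic its difference quotient has a removable
  singularity at z = \<zeta> and is locally uniformly bounded, so one may differentiate under the
  integral in \<open>localise_eq\<close>.\<close>

lemma localise_holomorphic:
  assumes U: "open U" and hol: "F holomorphic_on U"
  shows "localise k F holomorphic_on U"
proof -
  have "localise k F field_differentiable at z0" if z0: "z0 \<in> U" for z0
  proof -
    obtain r0 where "r0 > 0" and r0: "cball z0 r0 \<subseteq> U"
      using z0 U[unfolded open_contains_cball] by blast
    define r where "r = r0 / 2"
    have r: "r > 0" and rU: "cball z0 (2 * r) \<subseteq> U"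
      using \<open>r0 > 0\<close> r0 by (auto simp: r_def)
    have bU: "ball z0 r \<subseteq> U" using rU r by (auto simp: subset_iff)
    \<comment> \<open>The value on the diagonal makes \<open>Q\<close> holomorphic in
      \<open>z\<close>; for fixed \<open>z\<close> it alters the integrand at a single
      point.\<close>
    define Q where "Q z \<zeta> = (if z = \<zeta> then deriv F \<zeta> else (F z - F \<zeta>) / (z - \<zeta>))" for z \<zeta>
    obtain L where L: "\<And>z \<zeta>. z \<in> ball z0 r \<Longrightarrow> norm (Q z \<zeta>) \<le> L"
      by (rule difference_quotient_bound[OF rU U r hol F_bdd, folded Q_def]) (rule that, blast)
    have "L \<ge> 0" using order_trans[OF norm_ge_zero L[of z0 z0]] r by simp
    have Q_eq: "Q z = (\<lambda>\<zeta>. if \<zeta> = z then deriv F z else (F z - F \<zeta>) / (z - \<zeta>))" for z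
      unfolding Q_def by (rule ext) auto
    have "(\<lambda>z. \<integral>\<zeta>. Q z \<zeta> * dcell (\<zeta> - k) \<partial>lborel) holomorphic_on ball z0 r"
    proof (rule holomorphic_on_lebesgue_integral)
      show "(\<lambda>\<zeta>. Q z \<zeta> * dcell (\<zeta> - k)) \<in> borel_measurable lborel" for z
        unfolding Q_eq by measurable
      show "integrable lborel (\<lambda>\<zeta>. L * (2 * indicator (cball k 2) \<zeta>))"
        by (intro integrable_mult_right integrable_indicator_cball)
      show "norm (Q z \<zeta> * dcell (\<zeta> - k)) \<le> L * (2 * indicator (cball k 2) \<zeta>)" if "z \<in> ball z0 r" for z \<zeta>
        unfolding norm_mult
        by (intro mult_mono L that bump_density.g_le_indicator[OF bump_density_dcell] \<open>L \<ge> 0\<close>) simp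
      show "(\<lambda>z. Q z \<zeta> * dcell (\<zeta> - k)) holomorphic_on ball z0 r" for \<zeta>
      proof (rule holomorphic_on_mult[OF _ holomorphic_on_const])
        have hF: "F holomorphic_on ball z0 r" by (rule holomorphic_on_subset[OF hol bU])
        show "(\<lambda>z. Q z \<zeta>) holomorphic_on ball z0 r"
        proof (cases "\<zeta> \<in> ball z0 r")
          case True
          then show ?thesis unfolding Q_def by (intro pole_lemma[OF hF]) simp
        next
          case False
          have "(\<lambda>z. (F z - F \<zeta>) / (z - \<zeta>)) holomorphic_on ball z0 r"
            using False by (intro holomorphic_intros hF) auto
          then show ?thesis
            by (rule holomorphic_transform) (use False in \<open>auto simp: Q_def\<close>)
        qed
      qed
    qed simp
    moreover have "(\<integral>\<zeta>. Q z \<zeta> * dcell (\<zeta> - k) \<partial>lborel) = localise k F z" for z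
      unfolding localise_eq
    proof (rule integral_cong_AE)
      have "AE \<zeta> in lborel. \<zeta> \<noteq> z" by (rule AE_lborel_singleton)
      then show "AE \<zeta> in lborel. Q z \<zeta> * dcell (\<zeta> - k) = (F z - F \<zeta>) * dcell (\<zeta> - k) / (z - \<zeta>)"
        by eventually_elim (simp add: Q_def)
      show "(\<lambda>\<zeta>. Q z \<zeta> * dcell (\<zeta> - k)) \<in> borel_measurable lborel"
        unfolding Q_eq by measurable
    qed measurable
    ultimately have "localise k F holomorphic_on ball z0 r" by (simp only:)
    then show ?thesis
      using r holomorphic_on_imp_differentiable_at[of "localise k F" "ball z0 r" z0] by simp
  qed
  then show ?thesis
    unfolding holomorphic_on_def by (blast intro: field_differentiable_at_within)
qed

text \<open>The distance 4 is the diameter of the disc of radius 2 about \<open>k\<close> outside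
  which the weight vanishes.\<close>

context
  assumes osc: "\<And>z \<zeta>. norm (z - \<zeta>) \<le> 4 \<Longrightarrow> norm (F z - F \<zeta>) \<le> e"
begin

lemma oscillation_nonneg: "e \<ge> 0"
  using osc[of 0 0] by simp

lemma bump_density_osc:
  assumes "norm (z - k) \<le> 2"
  shows "bump_density (\<lambda>\<zeta>. (F z - F \<zeta>) * dcell (\<zeta> - k)) (e * 2) 2 k"
proof unfold_locales
  show "norm ((F z - F \<zeta>) * dcell (\<zeta> - k)) \<le> e * 2" for \<zeta>
  proof (cases "norm (\<zeta> - k) \<ge> 2")
    case False
    then have "norm (z - \<zeta>) \<le> 4"
      using assms norm_triangle_ineq4[of "z - k" "\<zeta> - k"] by simp
    then show ?thesis
      unfolding norm_mult using oscillation_nonneg by (intro mult_mono norm_dcell_le osc) auto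
  qed (use oscillation_nonneg in \<open>simp add: dcell_eq_0\<close>)
qed (use dcell_eq_0 in auto)

lemma localise_far_eq:
  assumes "norm (z - k) \<ge> 2"
  shows "localise k F z = (\<integral>\<zeta>. (F k - F \<zeta>) * dcell (\<zeta> - k) / (z - \<zeta>) \<partial>lborel)"
  unfolding cauchy_integral_difference localise_def using cell_eq_0[OF assms] by simp

text \<open>The value subtracted from \<open>F\<close> must be taken within distance 2 of
  \<open>k\<close> for the oscillation to apply: at \<open>z\<close> if \<open>z\<close> is that
  close, and at \<open>k\<close> otherwise.\<close>

lemma norm_localise_le: "norm (localise k F z) \<le> e * 2 * singular_mass"
proof (cases "norm (z - k) \<ge> 2")
  case True
  show ?thesis
    unfolding localise_far_eq[OF True] singular_mass_def
    by (intro bump_density.cauchy_integral_le[OF bump_density_osc]) simp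
next
  case False
  then show ?thesis
    unfolding localise_eq singular_mass_def
    by (intro bump_density.cauchy_integral_le[OF bump_density_osc]) simp
qed

lemma bump_density_moment:
  "bump_density (\<lambda>\<zeta>. (F \<zeta> - F k) * dcell (\<zeta> - k) * (\<zeta> - k) ^ j) (e * 2 * 2 ^ j) 2 k"
proof unfold_locales
  show "norm ((F \<zeta> - F k) * dcell (\<zeta> - k) * (\<zeta> - k) ^ j) \<le> e * 2 * 2 ^ j" for \<zeta>
  proof (cases "norm (\<zeta> - k) \<ge> 2")
    case False
    then show ?thesis
      unfolding norm_mult norm_power using oscillation_nonneg
      by (intro mult_mono norm_dcell_le osc power_mono) auto
  qed (use oscillation_nonneg in \<open>simp add: dcell_eq_0\<close>)
qed (use dcell_eq_0 in auto)

lemma norm_moment_le: "norm (moment j k F) \<le> e * 2 * 2 ^ j * singular_mass"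
proof -
  have "norm (moment j k F) \<le> e * 2 * 2 ^ j * measure lborel (cball (0 :: complex) 2)"
    unfolding moment_def norm_minus_cancel
    by (rule bump_density.integral_density_le[OF bump_density_moment])
  also have "\<dots> \<le> e * 2 * 2 ^ j * singular_mass"
    using oscillation_nonneg by (intro mult_left_mono singular_mass_ge) auto
  finally show ?thesis .
qed

text \<open>With u = z - k and v = \<zeta> - k one has 1/(u - v) = 1/u + v/u^2 + v^2/(u^2 (u - v)).
  From |v| at most 2 and |u| at least 3 follows that |u - v| is at least |u|/3; hence 24 = 2 * 2^2 *
  3.\<close>

lemma localise_expansion:
  assumes far: "norm (z - k) \<ge> 3"
  shows "norm (localise k F z - moment 0 k F / (z - k) - moment 1 k F / (z - k)\<^sup>2)
    \<le> 24 * e * singular_mass / norm (z - k) ^ 3"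
proof -
  define u where "u = z - k"
  define G where "G \<zeta> = (F \<zeta> - F k) * dcell (\<zeta> - k)" for \<zeta>
  have u: "norm u \<ge> 3" "u \<noteq> 0" using far by (auto simp: u_def)
  have m: "moment 0 k F = - (\<integral>\<zeta>. G \<zeta> \<partial>lborel)" "moment 1 k F = - (\<integral>\<zeta>. G \<zeta> * (\<zeta> - k) \<partial>lborel)"
    by (simp_all add: moment_def G_def)
  have i0: "integrable lborel G" and i1: "integrable lborel (\<lambda>\<zeta>. G \<zeta> * (\<zeta> - k))"
    using bump_density.integrable_density[OF bump_density_moment, of 0]
      bump_density.integrable_density[OF bump_density_moment, of 1] by (simp_all add: G_def[abs_def])
  have neg: "(F k - F \<zeta>) * dcell (\<zeta> - k) / (z - \<zeta>) = - (G \<zeta> / (z - \<zeta>))" for \<zeta>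
    by (simp only: G_def minus_divide_left mult_minus_left[symmetric] minus_diff_eq)
  have i2: "integrable lborel (\<lambda>\<zeta>. G \<zeta> / (z - \<zeta>))"
    using integrable_mult_right[OF bump_density.integrable_cauchy_kernel[OF bump_density_osc, of k z], of "-1"]
    unfolding neg by simp
  have "localise k F z = - (\<integral>\<zeta>. G \<zeta> / (z - \<zeta>) \<partial>lborel)"
    using localise_far_eq[of z] far unfolding neg integral_minus by simp
  then have "localise k F z - moment 0 k F / u - moment 1 k F / u\<^sup>2
      = - ((\<integral>\<zeta>. G \<zeta> / (z - \<zeta>) \<partial>lborel) - (\<integral>\<zeta>. G \<zeta> \<partial>lborel) / u - (\<integral>\<zeta>. G \<zeta> * (\<zeta> - k) \<partial>lborel) / u\<^sup>2)"
    unfolding m by simp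
  also have "\<dots> = - (\<integral>\<zeta>. G \<zeta> / (z - \<zeta>) - G \<zeta> / u - G \<zeta> * (\<zeta> - k) / u\<^sup>2 \<partial>lborel)"
    using i0 i1 i2 by simp
  finally have eq: "localise k F z - moment 0 k F / u - moment 1 k F / u\<^sup>2
      = - (\<integral>\<zeta>. G \<zeta> / (z - \<zeta>) - G \<zeta> / u - G \<zeta> * (\<zeta> - k) / u\<^sup>2 \<partial>lborel)" .
  have pw: "norm (G \<zeta> / (z - \<zeta>) - G \<zeta> / u - G \<zeta> * (\<zeta> - k) / u\<^sup>2)
      \<le> 24 * e / norm u ^ 3 * indicator (cball k 2) \<zeta>" for \<zeta>
  proof (cases "norm (\<zeta> - k) \<ge> 2")
    case True
    then show ?thesis using oscillation_nonneg by (simp add: G_def dcell_eq_0)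
  next
    case False
    define v where "v = \<zeta> - k"
    have v: "norm v \<le> 2" using False by (simp add: v_def)
    have zv: "z - \<zeta> = u - v" by (simp add: u_def v_def)
    have uv: "norm u / 3 \<le> norm (u - v)"
      using u v norm_triangle_ineq2[of u v] by linarith
    then have "u - v \<noteq> 0" using u by auto
    then have "G \<zeta> / (z - \<zeta>) - G \<zeta> / u - G \<zeta> * (\<zeta> - k) / u\<^sup>2 = G \<zeta> * v\<^sup>2 / (u\<^sup>2 * (u - v))"
      unfolding zv v_def[symmetric] using u by (simp add: field_simps power2_eq_square)
    moreover have "norm (G \<zeta> * v\<^sup>2) \<le> e * 2 * 2\<^sup>2"
      unfolding G_def norm_mult norm_power using oscillation_nonneg False v
      by (intro mult_mono norm_dcell_le osc power_mono) auto
    moreover have "norm u ^ 3 / 3 \<le> norm (u\<^sup>2 * (u - v))"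
      using mult_left_mono[OF uv, of "(norm u)\<^sup>2"]
      by (simp add: norm_mult norm_power power2_eq_square power3_eq_cube)
    ultimately have "norm (G \<zeta> / (z - \<zeta>) - G \<zeta> / u - G \<zeta> * (\<zeta> - k) / u\<^sup>2) \<le> (e * 2 * 2\<^sup>2) / (norm u ^ 3 / 3)"
      unfolding norm_divide using u oscillation_nonneg by (simp only: norm_divide) (intro frac_le, auto)
    also have "\<dots> = 24 * e / norm u ^ 3" by simp
    finally show ?thesis using False by (simp add: indicator_def dist_norm norm_minus_commute)
  qed
  have "norm (localise k F z - moment 0 k F / u - moment 1 k F / u\<^sup>2)
      \<le> (\<integral>\<zeta>. 24 * e / norm u ^ 3 * indicator (cball k 2) \<zeta> \<partial>lborel)"
    unfolding eq norm_minus_cancel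
    by (intro norm_integral_le_integral Bochner_Integration.integrable_diff integrable_mult_right
        integrable_indicator_cball pw) (use i0 i1 i2 in auto)
  also have "\<dots> = 24 * e / norm u ^ 3 * measure lborel (cball (0 :: complex) 2)"
    by (simp add: measure_cball_complex[of k])
  also have "\<dots> \<le> 24 * e / norm u ^ 3 * singular_mass"
    using oscillation_nonneg by (intro mult_left_mono singular_mass_ge) auto
  finally show ?thesis by (simp add: u_def)
qed

end

end

section \<open>Cancelling the leading coefficients\<close>

text \<open>The coefficients \<open>a\<close>, \<open>b\<close> need not be determined by \<open>h\<close>, since \<open>K\<close> may lie close to \<open>k\<close>.\<close>

definition localised :: "complex set \<Rightarrow> complex \<Rightarrow> real \<Rightarrow> (complex \<Rightarrow> complex) \<Rightarrow> complex \<Rightarrow> complex \<Rightarrow> bool" where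
  "localised K k s h a b \<longleftrightarrow> continuous_on K h \<and> h holomorphic_on interior K \<and>
    (\<forall>z\<in>K. norm (h z) \<le> s) \<and> norm a \<le> s \<and> norm b \<le> s \<and>
    (\<forall>z\<in>K. norm (z - k) \<ge> 3 \<longrightarrow> norm (h z - a / (z - k) - b / (z - k)\<^sup>2) \<le> s / norm (z - k) ^ 3)"

lemma localised_mult:
  assumes "localised K k s h a b"
  shows "localised K k (norm m * s) (\<lambda>z. m * h z) (m * a) (m * b)"
proof -
  have "m * h z - m * a / (z - k) - m * b / (z - k)\<^sup>2 = m * (h z - a / (z - k) - b / (z - k)\<^sup>2)" for z
    by (simp add: algebra_simps)
  moreover have "norm m * x \<le> norm m * s / norm (z - k) ^ 3" if "x \<le> s / norm (z - k) ^ 3" for x z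
    using mult_left_mono[OF that, of "norm m"] by simp
  ultimately show ?thesis
    using assms unfolding localised_def
    by (auto simp: norm_mult mult_left_mono intro!: continuous_intros holomorphic_intros)
qed

lemma localised_diff:
  assumes h: "localised K k s h a b" and g: "localised K k t g c d"
  shows "localised K k (s + t) (\<lambda>z. h z - g z) (a - c) (b - d)"
proof -
  have tri: "norm (x - y) \<le> s' + t'" if "norm x \<le> s'" "norm y \<le> t'" for x y :: complex and s' t'
    using that norm_triangle_ineq4[of x y] by linarith
  have "norm (h z - g z - (a - c) / (z - k) - (b - d) / (z - k)\<^sup>2) \<le> (s + t) / norm (z - k) ^ 3"
    if "z \<in> K" "norm (z - k) \<ge> 3" for z
  proof -
    have "h z - g z - (a - c) / (z - k) - (b - d) / (z - k)\<^sup>2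
        = (h z - a / (z - k) - b / (z - k)\<^sup>2) - (g z - c / (z - k) - d / (z - k)\<^sup>2)"
      by (simp add: diff_divide_distrib)
    moreover have "norm (h z - a / (z - k) - b / (z - k)\<^sup>2) \<le> s / norm (z - k) ^ 3"
      "norm (g z - c / (z - k) - d / (z - k)\<^sup>2) \<le> t / norm (z - k) ^ 3"
      using h g that unfolding localised_def by blast+
    ultimately show ?thesis
      unfolding add_divide_distrib by (metis tri)
  qed
  then show ?thesis
    using h g tri unfolding localised_def
    by (auto intro!: continuous_intros holomorphic_intros)
qed

text \<open>The factor 2 spares a compactness argument for attaining the supremum. If the supremum
  is 0, nothing exceeds half of it, but then every element will do.\<close>

lemma nearly_maximal_exists:
  fixes f :: "'a \<Rightarrow> real"
  assumes "X \<noteq> {}" and bdd: "\<And>x. x \<in> X \<Longrightarrow> f x \<le> c" and nn: "\<And>x. x \<in> X \<Longrightarrow> 0 \<le> f x"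
  obtains p where "p \<in> X" "\<And>x. x \<in> X \<Longrightarrow> f x \<le> 2 * f p"
proof -
  have bd: "bdd_above (f ` X)" using bdd by (auto intro!: bdd_aboveI[of _ c])
  show ?thesis
  proof (cases "Sup (f ` X) \<le> 0")
    case True
    then have "f x \<le> 0" if "x \<in> X" for x
      using cSUP_upper[OF that bd] by linarith
    moreover obtain p where "p \<in> X" using \<open>X \<noteq> {}\<close> by blast
    ultimately have "f x \<le> 2 * f p" if "x \<in> X" for x
      using nn[OF \<open>p \<in> X\<close>] that by force
    then show ?thesis by (rule that[OF \<open>p \<in> X\<close>])
  next
    case False
    then have "Sup (f ` X) / 2 < Sup (f ` X)" by linarith
    from less_cSup_iff[THEN iffD1, OF _ bd this]
    obtain p where p: "p \<in> X" "Sup (f ` X) / 2 < f p"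
      using \<open>X \<noteq> {}\<close> by auto
    have "f x \<le> 2 * f p" if "x \<in> X" for x
      using cSUP_upper[OF that bd] p by linarith
    then show ?thesis by (rule that[OF p(1)])
  qed
qed

lemma localised_mono:
  assumes "localised K k s h a b" "s \<le> t"
  shows "localised K k t h a b"
proof -
  have "x \<le> t / norm (z - k) ^ 3" if "x \<le> s / norm (z - k) ^ 3" for x z
    using that divide_right_mono[OF assms(2), of "norm (z - k) ^ 3"] by simp
  then show ?thesis
    using assms unfolding localised_def by (auto intro: order_trans)
qed

lemma localised_zero: "s \<ge> 0 \<Longrightarrow> localised K k s (\<lambda>z. 0) 0 0"
  by (simp add: localised_def)

lemma localised_size_nonneg: "localised K k s h a b \<Longrightarrow> s \<ge> 0"
  unfolding localised_def using norm_ge_zero order_trans by blast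

text \<open>Replaces the estimates for analytic capacity in Vitushkin's construction. The pair is chosen
  greedily: \<open>p\<close> nearly maximises the first coefficient, then \<open>q\<close> nearly maximises the second among
  the members whose first coefficient vanishes.\<close>

lemma extremal_pair_exists:
  obtains p q \<alpha> \<beta> \<gamma> where
    "continuous_on K p" "p holomorphic_on interior K" "continuous_on K q" "q holomorphic_on interior K"
    "\<And>s h a b. localised K k s h a b \<Longrightarrow>
      localised K k (9 * s) (\<lambda>z. h z - \<alpha> * a * p z - (\<beta> * a + \<gamma> * b) * q z) 0 0"
proof -
  define X where "X = {(h, a, b). localised K k 1 h a b}"
  define Y where "Y = {(h, a, b). localised K k 1 h a b \<and> a = 0}"
  have ne: "((\<lambda>z. 0), 0, 0) \<in> X" "((\<lambda>z. 0), 0, 0) \<in> Y"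
    by (simp_all add: X_def Y_def localised_zero)
  obtain p' where p': "p' \<in> X"
      and p_max: "\<And>x. x \<in> X \<Longrightarrow> norm (fst (snd x)) \<le> 2 * norm (fst (snd p'))"
  proof (rule nearly_maximal_exists[of X "\<lambda>x. norm (fst (snd x))" 1])
    show "X \<noteq> {}" using ne by blast
  qed (auto simp: X_def localised_def)
  obtain q' where q': "q' \<in> Y"
      and q_max: "\<And>x. x \<in> Y \<Longrightarrow> norm (snd (snd x)) \<le> 2 * norm (snd (snd q'))"
  proof (rule nearly_maximal_exists[of Y "\<lambda>x. norm (snd (snd x))" 1])
    show "Y \<noteq> {}" using ne by blast
  qed (auto simp: Y_def localised_def)
  obtain p c d where p_eq: "p' = (p, c, d)" by (cases p')
  obtain q c' f where q_eq: "q' = (q, c', f)" by (cases q')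
  have p: "localised K k 1 p c d" using p' p_eq by (simp add: X_def)
  have q: "localised K k 1 q 0 f" using q' q_eq by (auto simp: Y_def)
  have scale: "localised K k 1 (\<lambda>z. of_real (1 / s) * h z) (of_real (1 / s) * a) (of_real (1 / s) * b)"
    if "localised K k s h a b" "s > 0" for s h a b
    using localised_mult[OF that(1), of "of_real (1 / s)"] that(2) by (simp add: norm_divide)
  \<comment> \<open>Scaled to size 1, \<open>h\<close> competes with \<open>p\<close> in
    \<open>X\<close>; below, \<open>b_le\<close> is the same argument for \<open>q\<close> in
    \<open>Y\<close>.\<close>
  have a_le: "norm a \<le> 2 * s * norm c" if h: "localised K k s h a b" for s h a b
  proof (cases "s = 0")
    case True
    then show ?thesis using h by (simp add: localised_def)
  next
    case False
    then have "s > 0" using localised_size_nonneg[OF h] by simp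
    then show ?thesis
      using p_max[of "(\<lambda>z. of_real (1 / s) * h z, of_real (1 / s) * a, of_real (1 / s) * b)"] scale[OF h]
      by (simp add: X_def p_eq norm_divide field_simps)
  qed
  have b_le: "norm b \<le> 2 * s * norm f" if h: "localised K k s h 0 b" for s h b
  proof (cases "s = 0")
    case True
    then show ?thesis using h by (simp add: localised_def)
  next
    case False
    then have "s > 0" using localised_size_nonneg[OF h] by simp
    then show ?thesis
      using q_max[of "(\<lambda>z. of_real (1 / s) * h z, 0, of_real (1 / s) * b)"] scale[OF h]
      by (simp add: Y_def q_eq norm_divide field_simps)
  qed
  show ?thesis
  \<comment> \<open>Solving \<open>m * c = a\<close> and \<open>m * d + n * f = b\<close> for
    \<open>m\<close> and \<open>n\<close> and expanding in \<open>a\<close>, \<open>b\<close> gives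
    these coefficients. If \<open>c = 0\<close> or \<open>f = 0\<close>, near-maximality forces the
    coefficient to be removed to vanish, and division by 0 gives 0, so the two equations still
    hold.\<close>
  proof (rule that[of p q "1 / c" "- (d / c / f)" "1 / f"])
    show "continuous_on K p" "p holomorphic_on interior K" "continuous_on K q" "q holomorphic_on interior K"
      using p q by (auto simp: localised_def)
    fix s h a b assume h: "localised K k s h a b"
    note s = localised_size_nonneg[OF h]
    define m where "m = 1 / c * a"
    define n where "n = (b - m * d) / f"
    have m_c: "m * c = a" using a_le[OF h] by (cases "c = 0") (auto simp: m_def)
    \<comment> \<open>Removing the first coefficient raises the size from \<open>s\<close> to
      \<open>s + 2 * s\<close>; removing the second adds at most \<open>2 * (3 * s)\<close>, which
      makes 9 in all.\<close>
    have "norm m \<le> 2 * s"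
      using a_le[OF h] s by (cases "c = 0") (auto simp: m_def norm_divide divide_le_eq)
    then have "localised K k (3 * s) (\<lambda>z. h z - m * p z) (a - m * c) (b - m * d)"
      by (intro localised_mono[OF localised_diff[OF h localised_mult[OF p]]]) simp
    then have h1: "localised K k (3 * s) (\<lambda>z. h z - m * p z) 0 (b - m * d)"
      by (simp add: m_c)
    have n_f: "n * f = b - m * d" using b_le[OF h1] by (cases "f = 0") (auto simp: n_def)
    have "norm n \<le> 6 * s"
      using b_le[OF h1] s by (cases "f = 0") (auto simp: n_def norm_divide divide_le_eq)
    then have "localised K k (9 * s) (\<lambda>z. h z - m * p z - n * q z) (0 - n * 0) (b - m * d - n * f)"
      by (intro localised_mono[OF localised_diff[OF h1 localised_mult[OF q]]]) simp
    then have "localised K k (9 * s) (\<lambda>z. h z - m * p z - n * q z) 0 0"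
      by (simp add: n_f)
    moreover have "n = - (d / c / f) * a + 1 / f * b" by (simp add: n_def m_def diff_divide_distrib)
    ultimately show "localised K k (9 * s) (\<lambda>z. h z - 1 / c * a * p z - (- (d / c / f) * a + 1 / f * b) * q z) 0 0"
      by (simp only: m_def)
  qed
qed

section \<open>Sums of reciprocal powers over the lattice\<close>

lemma sum_le_telescoping:
  fixes \<phi> g :: "real \<Rightarrow> real"
  assumes der: "\<And>t. (g has_real_derivative \<phi> t) (at t)"
    and compare: "\<And>t \<xi>. t < \<xi> \<Longrightarrow> \<xi> < t + 1 \<Longrightarrow> \<phi> t \<le> C * \<phi> \<xi>"
    and bdd: "\<And>t. \<bar>g t\<bar> \<le> G" and C: "C \<ge> 0"
  shows "(\<Sum>i\<le>n. \<phi> (x - real i)) \<le> C * (2 * G)"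
proof -
  \<comment> \<open>An integral test without integrals: the mean value theorem compares a term with
    the increment of the antiderivative over a unit interval, and the increments telescope.\<close>
  have step: "\<phi> t \<le> C * (g (t + 1) - g t)" for t
  proof -
    obtain \<xi> where "t < \<xi>" "\<xi> < t + 1" "g (t + 1) - g t = (t + 1 - t) * \<phi> \<xi>"
      using MVT2[of t "t + 1" g \<phi>] der by auto
    then show ?thesis using compare[of t \<xi>] by simp
  qed
  have "(\<Sum>i\<le>n. \<phi> (x - real i)) \<le> (\<Sum>i\<le>n. C * (g (x + 1 - real i) - g (x + 1 - real (Suc i))))"
  proof (intro sum_mono)
    fix i
    have "x + 1 - real i = x - real i + 1" "x + 1 - real (Suc i) = x - real i" by simp_all
    then show "\<phi> (x - real i) \<le> C * (g (x + 1 - real i) - g (x + 1 - real (Suc i)))"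
      using step[of "x - real i"] by (simp only:)
  qed
  also have "\<dots> = C * (g (x + 1) - g (x + 1 - real (Suc n)))"
    by (subst sum_distrib_left[symmetric], subst sum_telescope) simp
  also have "\<dots> \<le> C * (2 * G)"
    using bdd[of "x + 1"] bdd[of "x + 1 - real (Suc n)"] C by (intro mult_left_mono) linarith+
  finally show ?thesis .
qed

text \<open>Supplies the comparison over unit steps that \<open>sum_le_telescoping\<close> asks for;
  \<open>A \<ge> 1\<close> absorbs the square of the step.\<close>

lemma square_shift_le:
  fixes t \<xi> :: real
  assumes "t < \<xi>" "\<xi> < t + 1" "A \<ge> 1"
  shows "A + \<xi>\<^sup>2 \<le> 3 * (A + t\<^sup>2)"
proof -
  have "(\<xi> - t)\<^sup>2 \<le> 1\<^sup>2" using assms by (intro power_mono) auto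
  moreover have "\<xi>\<^sup>2 \<le> 2 * t\<^sup>2 + 2 * (\<xi> - t)\<^sup>2"
    using zero_le_power2[of "\<xi> - 2 * t"] by (simp add: power2_eq_square algebra_simps)
  moreover have "0 \<le> t\<^sup>2" by simp
  ultimately show ?thesis using \<open>A \<ge> 1\<close> by (simp only: power_one distrib_left)
qed

lemma sum_inverse_1_plus_square_le: "(\<Sum>i\<le>n. 1 / (1 + (x - real i)\<^sup>2)) \<le> 12"
proof -
  have "(\<Sum>i\<le>n. (\<lambda>t. 1 / (1 + t\<^sup>2)) (x - real i)) \<le> 3 * (2 * 2)"
  proof (rule sum_le_telescoping[where g=arctan])
    show "(arctan has_real_derivative 1 / (1 + t\<^sup>2)) (at t)" for t
      using DERIV_arctan[of t] by (simp add: inverse_eq_divide)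
    show "1 / (1 + t\<^sup>2) \<le> 3 * (1 / (1 + \<xi>\<^sup>2))" if "t < \<xi>" "\<xi> < t + 1" for t \<xi> :: real
      using square_shift_le[OF that, of 1] by (simp add: divide_simps add_pos_nonneg)
    show "\<bar>arctan t\<bar> \<le> 2" for t
      using arctan_lbound[of t] arctan_ubound[of t] pi_half_less_two by linarith
  qed simp
  then show ?thesis by simp
qed

text \<open>The summand has the antiderivative t / (A sqrt (A + t^2)), bounded by 1/A. In the
  comparison 3^(3/2) is rounded up to 6. In the application A is 1 plus the squared distance in the
  other coordinate.\<close>

lemma sum_inverse_cubed_norm_le:
  assumes A: "A \<ge> 1"
  shows "(\<Sum>i\<le>n. 1 / (sqrt (A + (x - real i)\<^sup>2)) ^ 3) \<le> 12 * (1 / A)"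
proof -
  have pos: "A + t\<^sup>2 > 0" for t :: real using A by (simp add: add_pos_nonneg)
  have sq: "(sqrt (A + t\<^sup>2))\<^sup>2 = A + t\<^sup>2" for t using pos[of t] by simp
  have sp: "sqrt (A + t\<^sup>2) > 0" for t using pos[of t] by simp
  have "(\<Sum>i\<le>n. (\<lambda>t. 1 / (sqrt (A + t\<^sup>2)) ^ 3) (x - real i)) \<le> 6 * (2 * (1 / A))"
  proof (rule sum_le_telescoping[where g="\<lambda>t. t / sqrt (A + t\<^sup>2) / A"])
    fix t :: real
    define w where "w = sqrt (A + t\<^sup>2)"
    have w: "w > 0" "w\<^sup>2 = A + t\<^sup>2" using sp[of t] sq[of t] by (simp_all add: w_def)
    have "((\<lambda>t. sqrt (A + t\<^sup>2)) has_real_derivative t / w) (at t)"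
      using pos[of t] by (auto intro!: derivative_eq_intros simp: w_def field_simps)
    then have "((\<lambda>t. t / sqrt (A + t\<^sup>2) / A) has_real_derivative (1 * w - t * (t / w)) / (w * w) / A) (at t)"
      using w(1) unfolding w_def by (intro DERIV_cdivide DERIV_divide DERIV_ident) auto
    moreover have "(1 * w - t * (t / w)) / (w * w) / A = 1 / w ^ 3"
    proof -
      have "1 * w - t * (t / w) = A / w" using w by (simp add: field_simps power2_eq_square)
      then show ?thesis using w(1) A by (simp add: power3_eq_cube)
    qed
    ultimately show "((\<lambda>t. t / sqrt (A + t\<^sup>2) / A) has_real_derivative 1 / (sqrt (A + t\<^sup>2)) ^ 3) (at t)"
      by (simp add: w_def)
    have "\<bar>t\<bar> \<le> w" unfolding w_def using A by (intro real_le_rsqrt) simp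
    then have "\<bar>t\<bar> / w / A \<le> 1 / A" using w A by (intro divide_right_mono) auto
    then show "\<bar>t / sqrt (A + t\<^sup>2) / A\<bar> \<le> 1 / A"
      using w A by (simp add: w_def abs_divide)
  next
    fix t \<xi> :: real assume t: "t < \<xi>" "\<xi> < t + 1"
    have "sqrt (A + \<xi>\<^sup>2) \<le> sqrt 3 * sqrt (A + t\<^sup>2)"
      using square_shift_le[OF t A] by (simp flip: real_sqrt_mult)
    then have "(sqrt (A + \<xi>\<^sup>2)) ^ 3 \<le> (sqrt 3 * sqrt (A + t\<^sup>2)) ^ 3"
      using pos[of \<xi>] by (intro power_mono) auto
    also have "\<dots> = (sqrt 3) ^ 3 * (sqrt (A + t\<^sup>2)) ^ 3" by (rule power_mult_distrib)
    also have "\<dots> \<le> 6 * (sqrt (A + t\<^sup>2)) ^ 3"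
    proof (rule mult_right_mono)
      have "sqrt 3 \<le> 2" by (rule real_le_lsqrt) auto
      then show "(sqrt 3) ^ 3 \<le> (6 :: real)" by (simp add: power3_eq_cube)
    qed (use pos[of t] in simp)
    finally show "1 / (sqrt (A + t\<^sup>2)) ^ 3 \<le> 6 * (1 / (sqrt (A + \<xi>\<^sup>2)) ^ 3)"
      using sp[of t] sp[of \<xi>] by (simp add: divide_simps)
  qed simp
  then show ?thesis by simp
qed

text \<open>The Gaussian integers with coordinates from -M to M, indexed by naturals shifted by M to
  fit \<open>sum_bump\<close>.\<close>

definition lattice_point :: "nat \<Rightarrow> nat \<times> nat \<Rightarrow> complex" where
  "lattice_point M = (\<lambda>(i, j). Complex (real i - real M) (real j - real M))"

definition lattice :: "nat \<Rightarrow> (nat \<times> nat) set" where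
  "lattice M = {..2 * M} \<times> {..2 * M}"

lemma finite_lattice [simp]: "finite (lattice M)"
  by (simp add: lattice_def)

text \<open>Summing the cubes over one coordinate leaves an inverse square, which is summable over
  the other: 144 = 12 * 12, independently of \<open>z\<close> and \<open>M\<close>.\<close>

lemma lattice_sum_le:
  "(\<Sum>\<kappa>\<in>lattice M. 1 / (sqrt (1 + (norm (z - lattice_point M \<kappa>))\<^sup>2)) ^ 3) \<le> 144"
proof -
  define x where "x = Re z + M"
  define y where "y = Im z + M"
  have "(\<Sum>\<kappa>\<in>lattice M. 1 / (sqrt (1 + (norm (z - lattice_point M \<kappa>))\<^sup>2)) ^ 3)
      = (\<Sum>i\<le>2 * M. \<Sum>j\<le>2 * M. 1 / (sqrt ((1 + (x - real i)\<^sup>2) + (y - real j)\<^sup>2)) ^ 3)"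
    unfolding lattice_def sum.cartesian_product
    by (intro sum.cong) (auto simp: lattice_point_def cmod_power2 x_def y_def algebra_simps)
  also have "\<dots> \<le> (\<Sum>i\<le>2 * M. 12 * (1 / (1 + (x - real i)\<^sup>2)))"
    by (intro sum_mono sum_inverse_cubed_norm_le) simp
  also have "\<dots> \<le> 12 * 12"
    using sum_inverse_1_plus_square_le[of x "2 * M"] unfolding sum_distrib_left[symmetric] by linarith
  finally show ?thesis by simp
qed

lemma sum_cell: 
  assumes "norm z \<le> real M"
  shows "(\<Sum>\<kappa>\<in>lattice M. cell (z - lattice_point M \<kappa>)) = 1"
    and "(\<Sum>\<kappa>\<in>lattice M. dcell (z - lattice_point M \<kappa>)) = 0"
proof -
  have xy: "\<bar>Re z\<bar> \<le> real M" "\<bar>Im z\<bar> \<le> real M"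
    using assms abs_Re_le_cmod[of z] abs_Im_le_cmod[of z] by linarith+
  have prod: "(\<Sum>\<kappa>\<in>lattice M. f (Re (z - lattice_point M \<kappa>)) * g (Im (z - lattice_point M \<kappa>)))
      = (\<Sum>i\<le>2 * M. f (Re z - (real i - real M))) * (\<Sum>j\<le>2 * M. g (Im z - (real j - real M)))"
    for f g :: "real \<Rightarrow> real"
    unfolding lattice_def sum_product sum.cartesian_product
    by (intro sum.cong) (auto simp: lattice_point_def)
  show "(\<Sum>\<kappa>\<in>lattice M. cell (z - lattice_point M \<kappa>)) = 1"
    unfolding cell_def of_real_sum[symmetric] prod sum_bump[OF xy(1)] sum_bump[OF xy(2)] by simp
  show "(\<Sum>\<kappa>\<in>lattice M. dcell (z - lattice_point M \<kappa>)) = 0"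
    unfolding dcell_def sum_divide_distrib[symmetric] sum.distrib sum_distrib_left[symmetric]
      of_real_sum[symmetric] prod sum_bump[OF xy(1)] sum_bump[OF xy(2)] by simp
qed

text \<open>Merges the bound near \<open>k\<close> and the decay away from it into one summable
  expression. Near \<open>k\<close> the root is at most sqrt 10 < 16/5 and its cube at most 10 *
  16/5 = 32; far away it is at most 2 |z - k|, where 8 would do.\<close>

lemma localised_norm_le:
  assumes "localised K k s h 0 0" "z \<in> K"
  shows "norm (h z) \<le> s * 32 * (1 / (sqrt (1 + (norm (z - k))\<^sup>2)) ^ 3)"
proof -
  define u where "u = norm (z - k)"
  define w where "w = sqrt (1 + u\<^sup>2)"
  have s: "s \<ge> 0" using localised_size_nonneg[OF assms(1)] .
  have w: "w > 0" by (simp add: w_def add_pos_nonneg)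
  have "norm (h z) * w ^ 3 \<le> s * 32"
  proof (cases "u \<ge> 3")
    case False
    have "u\<^sup>2 \<le> 3\<^sup>2" using False by (intro power_mono) (auto simp: u_def)
    then have w2: "w\<^sup>2 \<le> 10" by (simp add: w_def)
    moreover have "(16 / 5)\<^sup>2 = (256 / 25 :: real)" by (simp add: power2_eq_square)
    ultimately have "w\<^sup>2 \<le> (16 / 5)\<^sup>2" by linarith
    then have "w \<le> 16 / 5" by (rule power2_le_imp_le) simp
    then have "w\<^sup>2 * w \<le> 10 * (16 / 5)" using w w2 by (intro mult_mono) auto
    then have "w ^ 3 \<le> 32" by (simp add: power2_eq_square power3_eq_cube)
    then show ?thesis
      using assms s w by (intro mult_mono) (auto simp: localised_def)
  next
    case True
    have "3\<^sup>2 \<le> u\<^sup>2" using True by (intro power_mono) auto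
    then have "1 + u\<^sup>2 \<le> (2 * u)\<^sup>2" by (simp add: power_mult_distrib)
    then have "w \<le> 2 * u" unfolding w_def using True by (intro real_le_lsqrt) auto
    then have "w ^ 3 \<le> (2 * u) ^ 3" using w by (intro power_mono) auto
    moreover have "norm (h z) \<le> s / u ^ 3"
      using assms True by (auto simp: localised_def u_def)
    ultimately have "norm (h z) * w ^ 3 \<le> (s / u ^ 3) * (2 * u) ^ 3"
      using w s True by (intro mult_mono) auto
    also have "\<dots> = s * 8" using True by (simp add: power_mult_distrib)
    finally show ?thesis using s by simp
  qed
  then show ?thesis using w by (simp add: u_def w_def field_simps)
qed

section \<open>Global approximation by localised pieces\<close>

text \<open>The cells add up to 1 at \<open>z\<close>, and their d-bar derivatives add up to 0
  wherever \<open>F\<close> is nonzero, so the Cauchy integrals cancel in the sum.\<close>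

lemma sum_localise:
  assumes [measurable]: "F \<in> borel_measurable borel" and bdd: "\<And>\<zeta>. norm (F \<zeta>) \<le> S"
    and supp: "\<And>\<zeta>. real M < norm \<zeta> \<Longrightarrow> F \<zeta> = 0" and z: "norm z \<le> real M"
  shows "(\<Sum>\<kappa>\<in>lattice M. localise (lattice_point M \<kappa>) F z) = of_real kernel_mass * F z"
proof -
  let ?k = "lattice_point M"
  have zero: "(\<Sum>\<kappa>\<in>lattice M. F \<zeta> * dcell (\<zeta> - ?k \<kappa>) / (z - \<zeta>)) = 0" for \<zeta>
  proof -
    have "(\<Sum>\<kappa>\<in>lattice M. F \<zeta> * dcell (\<zeta> - ?k \<kappa>) / (z - \<zeta>))
        = F \<zeta> * (\<Sum>\<kappa>\<in>lattice M. dcell (\<zeta> - ?k \<kappa>)) / (z - \<zeta>)"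
      by (simp only: sum_divide_distrib sum_distrib_left)
    also have "\<dots> = 0"
      using supp[of \<zeta>] sum_cell(2)[of \<zeta> M] by (cases "norm \<zeta> \<le> real M") simp_all
    finally show ?thesis .
  qed
  have int: "integrable lborel (\<lambda>\<zeta>. F \<zeta> * dcell (\<zeta> - ?k \<kappa>) / (z - \<zeta>))" for \<kappa>
    by (rule bump_density.integrable_cauchy_kernel[OF bump_density_F_dcell]) (use bdd in auto)
  have "(\<Sum>\<kappa>\<in>lattice M. localise (?k \<kappa>) F z)
      = of_real kernel_mass * F z * (\<Sum>\<kappa>\<in>lattice M. cell (z - ?k \<kappa>))
        - (\<Sum>\<kappa>\<in>lattice M. (\<integral>\<zeta>. F \<zeta> * dcell (\<zeta> - ?k \<kappa>) / (z - \<zeta>) \<partial>lborel))"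
    unfolding localise_def sum_subtractf sum_distrib_left by (simp only: mult_ac)
  also have "(\<Sum>\<kappa>\<in>lattice M. (\<integral>\<zeta>. F \<zeta> * dcell (\<zeta> - ?k \<kappa>) / (z - \<zeta>) \<partial>lborel))
      = (\<integral>\<zeta>. (\<Sum>\<kappa>\<in>lattice M. F \<zeta> * dcell (\<zeta> - ?k \<kappa>) / (z - \<zeta>)) \<partial>lborel)"
    by (rule Bochner_Integration.integral_sum[symmetric]) (rule int)
  also have "\<dots> = 0" unfolding zero by simp
  finally show ?thesis by (simp add: sum_cell(1)[OF z])
qed

text \<open>The order of the quantifiers matters: p, q and the coefficients are fixed before
  \<open>F\<close>, which enters the approximating sum through its moments alone. The slices f(., w)
  can therefore all be approximated with the same p and q.\<close>

lemma lattice_approximation: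
  fixes K :: "complex set" and M :: nat
  obtains p q :: "nat \<times> nat \<Rightarrow> complex \<Rightarrow> complex" and \<alpha> \<beta> \<gamma> :: "nat \<times> nat \<Rightarrow> complex" where
    "\<And>\<kappa>. continuous_on K (p \<kappa>)" "\<And>\<kappa>. p \<kappa> holomorphic_on interior K"
    "\<And>\<kappa>. continuous_on K (q \<kappa>)" "\<And>\<kappa>. q \<kappa> holomorphic_on interior K"
    "\<And>F S e z. F \<in> borel_measurable borel \<Longrightarrow> (\<And>\<zeta>. norm (F \<zeta>) \<le> S) \<Longrightarrow>
      (\<And>z \<zeta>. norm (z - \<zeta>) \<le> 4 \<Longrightarrow> norm (F z - F \<zeta>) \<le> e) \<Longrightarrow>
      (\<And>\<zeta>. real M < norm \<zeta> \<Longrightarrow> F \<zeta> = 0) \<Longrightarrow>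
      continuous_on K F \<Longrightarrow> F holomorphic_on interior K \<Longrightarrow> z \<in> K \<Longrightarrow> norm z \<le> real M \<Longrightarrow>
      norm (of_real kernel_mass * F z - (\<Sum>\<kappa>\<in>lattice M.
        \<alpha> \<kappa> * moment 0 (lattice_point M \<kappa>) F * p \<kappa> z
        + (\<beta> \<kappa> * moment 0 (lattice_point M \<kappa>) F + \<gamma> \<kappa> * moment 1 (lattice_point M \<kappa>) F) * q \<kappa> z))
      \<le> 995328 * singular_mass * e"
proof -
  let ?P = "\<lambda>k (p, q, \<alpha>, \<beta>, \<gamma>). continuous_on K p \<and> p holomorphic_on interior K \<and>
    continuous_on K q \<and> q holomorphic_on interior K \<and>
    (\<forall>s h a b. localised K k s h a b \<longrightarrow>
      localised K k (9 * s) (\<lambda>z. h z - \<alpha> * a * p z - (\<beta> * a + \<gamma> * b) * q z) 0 0)"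
  have "\<exists>x. ?P k x" for k
  proof (rule extremal_pair_exists[of K k])
    fix p q \<alpha> \<beta> \<gamma>
    assume "continuous_on K p" "p holomorphic_on interior K" "continuous_on K q" "q holomorphic_on interior K"
      "\<And>s h a b. localised K k s h a b \<Longrightarrow>
        localised K k (9 * s) (\<lambda>z. h z - \<alpha> * a * p z - (\<beta> * a + \<gamma> * b) * q z) 0 0"
    then have "?P k (p, q, \<alpha>, \<beta>, \<gamma>)" by simp
    then show "\<exists>x. ?P k x" by (rule exI)
  qed
  then have "\<forall>k. \<exists>x. ?P k x" by (rule allI)
  from choice[OF this] obtain X where X: "\<forall>k. ?P k (X k)" by (rule exE)
  define x where "x \<kappa> = X (lattice_point M \<kappa>)" for \<kappa>
  have x: "?P (lattice_point M \<kappa>) (x \<kappa>)" for \<kappa> unfolding x_def using X by (rule spec)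
  define p where "p \<kappa> = fst (x \<kappa>)" for \<kappa>
  define q where "q \<kappa> = fst (snd (x \<kappa>))" for \<kappa>
  define \<alpha> where "\<alpha> \<kappa> = fst (snd (snd (x \<kappa>)))" for \<kappa>
  define \<beta> where "\<beta> \<kappa> = fst (snd (snd (snd (x \<kappa>))))" for \<kappa>
  define \<gamma> where "\<gamma> \<kappa> = snd (snd (snd (snd (x \<kappa>))))" for \<kappa>
  note defs = p_def q_def \<alpha>_def \<beta>_def \<gamma>_def
  have pq: "continuous_on K (p \<kappa>)" "p \<kappa> holomorphic_on interior K"
      "continuous_on K (q \<kappa>)" "q \<kappa> holomorphic_on interior K" for \<kappa>
    using x[of \<kappa>] unfolding defs case_prod_beta by simp_all
  have ext: "localised K (lattice_point M \<kappa>) (9 * s)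
      (\<lambda>z. h z - \<alpha> \<kappa> * a * p \<kappa> z - (\<beta> \<kappa> * a + \<gamma> \<kappa> * b) * q \<kappa> z) 0 0"
    if "localised K (lattice_point M \<kappa>) s h a b" for \<kappa> s h a b
    using x[of \<kappa>] that unfolding defs case_prod_beta by blast
  show ?thesis
  proof (rule that[of p q \<alpha> \<beta> \<gamma>])
    fix F S e z
    assume F [measurable]: "F \<in> borel_measurable borel" and bdd: "\<And>\<zeta>. norm (F \<zeta>) \<le> S"
      and osc: "\<And>z \<zeta>. norm (z - \<zeta>) \<le> 4 \<Longrightarrow> norm (F z - F \<zeta>) \<le> e"
      and supp: "\<And>\<zeta>. real M < norm \<zeta> \<Longrightarrow> F \<zeta> = 0"
      and cont: "continuous_on K F" and hol: "F holomorphic_on interior K"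
      and z: "z \<in> K" "norm z \<le> real M"
    let ?k = "lattice_point M"
    \<comment> \<open>24 is the largest of the constants 2, 2, 4 and 24 in the bounds for the
      function, its two moments and its expansion.\<close>
    define s where "s = 24 * e * singular_mass"
    have "e \<ge> 0" using osc[of 0 0] by simp
    have sm: "singular_mass \<ge> 0" using singular_mass_ge measure_nonneg order_trans by blast
    then have em: "e * singular_mass \<ge> 0" using \<open>e \<ge> 0\<close> by simp
    have loc: "localised K (?k \<kappa>) s (localise (?k \<kappa>) F) (moment 0 (?k \<kappa>) F) (moment 1 (?k \<kappa>) F)" for \<kappa>
      unfolding localised_def
    proof (intro conjI ballI impI)
      show "continuous_on K (localise (?k \<kappa>) F)"
        by (rule continuous_on_localise[OF F bdd cont])
      show "localise (?k \<kappa>) F holomorphic_on interior K"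
        by (rule localise_holomorphic[OF F bdd _ hol]) simp
      show "norm (localise (?k \<kappa>) F z) \<le> s" for z
        using norm_localise_le[OF F bdd osc, of "?k \<kappa>" z] em by (simp add: s_def)
      show "norm (moment 0 (?k \<kappa>) F) \<le> s"
        using norm_moment_le[OF F bdd osc, of 0 "?k \<kappa>"] em by (simp add: s_def)
      show "norm (moment 1 (?k \<kappa>) F) \<le> s"
        using norm_moment_le[OF F bdd osc, of 1 "?k \<kappa>"] em by (simp add: s_def)
      show "norm (localise (?k \<kappa>) F z - moment 0 (?k \<kappa>) F / (z - ?k \<kappa>) - moment 1 (?k \<kappa>) F / (z - ?k \<kappa>)\<^sup>2)
          \<le> s / norm (z - ?k \<kappa>) ^ 3" if "3 \<le> norm (z - ?k \<kappa>)" for z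
        unfolding s_def by (rule localise_expansion[OF F bdd osc that])
    qed
    define err where "err \<kappa> = localise (?k \<kappa>) F z - \<alpha> \<kappa> * moment 0 (?k \<kappa>) F * p \<kappa> z
        - (\<beta> \<kappa> * moment 0 (?k \<kappa>) F + \<gamma> \<kappa> * moment 1 (?k \<kappa>) F) * q \<kappa> z" for \<kappa>
    have "norm (err \<kappa>) \<le> 9 * s * 32 * (1 / (sqrt (1 + (norm (z - ?k \<kappa>))\<^sup>2)) ^ 3)" for \<kappa>
      unfolding err_def by (rule localised_norm_le[OF ext[OF loc] z(1)])
    then have "norm (\<Sum>\<kappa>\<in>lattice M. err \<kappa>)
        \<le> (\<Sum>\<kappa>\<in>lattice M. 9 * s * 32 * (1 / (sqrt (1 + (norm (z - ?k \<kappa>))\<^sup>2)) ^ 3))"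
      by (intro order_trans[OF norm_sum] sum_mono)
    also have "\<dots> \<le> 9 * s * 32 * 144"
      unfolding sum_distrib_left[symmetric] using em
      by (intro mult_left_mono lattice_sum_le) (simp add: s_def)
    \<comment> \<open>995328 = 9 * 24 * 32 * 144: cancellation, size, decay and lattice sum.\<close>
    also have "\<dots> = 995328 * singular_mass * e" by (simp add: s_def)
    finally have "norm (\<Sum>\<kappa>\<in>lattice M. err \<kappa>) \<le> 995328 * singular_mass * e" .
    moreover have "(\<Sum>\<kappa>\<in>lattice M. err \<kappa>) = of_real kernel_mass * F z - (\<Sum>\<kappa>\<in>lattice M.
        \<alpha> \<kappa> * moment 0 (?k \<kappa>) F * p \<kappa> z
        + (\<beta> \<kappa> * moment 0 (?k \<kappa>) F + \<gamma> \<kappa> * moment 1 (?k \<kappa>) F) * q \<kappa> z)"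
      using sum_localise[OF F bdd supp z(2)] by (simp add: err_def sum_subtractf sum.distrib)
    ultimately show "norm (of_real kernel_mass * F z - (\<Sum>\<kappa>\<in>lattice M.
        \<alpha> \<kappa> * moment 0 (?k \<kappa>) F * p \<kappa> z
        + (\<beta> \<kappa> * moment 0 (?k \<kappa>) F + \<gamma> \<kappa> * moment 1 (?k \<kappa>) F) * q \<kappa> z)) \<le> 995328 * singular_mass * e"
      by simp
  qed (use pq in auto)
qed

section \<open>The algebras in several variables\<close>

lemma holo_n_subset: "holo_n U g \<Longrightarrow> V \<subseteq> U \<Longrightarrow> holo_n V g"
  unfolding holo_n_def by blast

lemma holo_n_add:
  assumes "holo_n U g" "holo_n U h"
  shows "holo_n U (\<lambda>z. g z + h z)"
  unfolding holo_n_def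
proof
  fix z assume "z \<in> U"
  with assms obtain g' h' where "(g has_derivative g') (at z)" "\<forall>c v. g' (c *s v) = c * g' v"
    "(h has_derivative h') (at z)" "\<forall>c v. h' (c *s v) = c * h' v"
    unfolding holo_n_def by blast
  then show "\<exists>d. ((\<lambda>z. g z + h z) has_derivative d) (at z) \<and> (\<forall>c v. d (c *s v) = c * d v)"
    by (intro exI[of _ "\<lambda>v. g' v + h' v"]) (auto intro: has_derivative_add simp: distrib_left)
qed

lemma holo_n_mult:
  assumes "holo_n U g" "holo_n U h"
  shows "holo_n U (\<lambda>z. g z * h z)"
  unfolding holo_n_def
proof
  fix z assume "z \<in> U"
  with assms obtain g' h' where "(g has_derivative g') (at z)" "\<forall>c v. g' (c *s v) = c * g' v"
    "(h has_derivative h') (at z)" "\<forall>c v. h' (c *s v) = c * h' v"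
    unfolding holo_n_def by blast
  then show "\<exists>d. ((\<lambda>z. g z * h z) has_derivative d) (at z) \<and> (\<forall>c v. d (c *s v) = c * d v)"
    by (intro exI[of _ "\<lambda>v. g z * h' v + g' v * h z"]) (auto intro: has_derivative_mult simp: algebra_simps)
qed

lemma holo_n_const: "holo_n U (\<lambda>z. c)"
  unfolding holo_n_def by (auto intro!: exI[of _ "\<lambda>v. 0"])

lemma holo_n_compose_linear:
  fixes L :: "complex ^ 'a \<Rightarrow> complex ^ 'b"
  assumes g: "holo_n U g" and L: "bounded_linear L" and CL: "\<And>c v. L (c *s v) = c *s L v"
  shows "holo_n (L -` U) (\<lambda>z. g (L z))"
  unfolding holo_n_def
proof
  fix z assume "z \<in> L -` U"
  then obtain g' where "(g has_derivative g') (at (L z))" "\<forall>c v. g' (c *s v) = c * g' v"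
    using g unfolding holo_n_def by blast
  then show "\<exists>d. ((\<lambda>z. g (L z)) has_derivative d) (at z) \<and> (\<forall>c v. d (c *s v) = c * d v)"
    by (intro exI[of _ "\<lambda>v. g' (L v)"])
      (auto simp: CL intro: has_derivative_compose[OF bounded_linear_imp_has_derivative[OF L]])
qed

lemma holo_n_compose_disc:
  fixes \<phi> :: "complex \<Rightarrow> complex ^ 'n"
  assumes g: "holo_n U g" and S: "open S" and \<phi>: "\<And>i. (\<lambda>t. \<phi> t $ i) holomorphic_on S"
    and sub: "\<phi> ` S \<subseteq> U"
  shows "(g \<circ> \<phi>) holomorphic_on S"
  unfolding holomorphic_on_open[OF S]
proof
  fix t assume t: "t \<in> S"
  define v where "v = (\<chi> i. deriv (\<lambda>t. \<phi> t $ i) t)"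
  have "((\<lambda>t. \<phi> t $ i) has_derivative (\<lambda>h. h * v $ i)) (at t)" for i :: 'n
    using holomorphic_derivI[OF \<phi> S t, of i] by (simp add: has_field_derivative_def v_def mult.commute[of _ "deriv _ _"])
  then have "(\<phi> has_derivative (\<lambda>h. h *s v)) (at t)"
    by (intro has_derivative_componentwise_within[THEN iffD2, of _ _ _ UNIV])
      (auto simp: Basis_vec_def inner_axis intro: has_derivative_inner_left)
  moreover obtain g' where "(g has_derivative g') (at (\<phi> t))" "\<forall>c v. g' (c *s v) = c * g' v"
    using g t sub unfolding holo_n_def by blast
  ultimately have "(g \<circ> \<phi> has_derivative (\<lambda>h. h * g' v)) (at t)"
    using has_derivative_compose[of \<phi> "\<lambda>h. h *s v" t UNIV g g'] by (simp add: o_def)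
  moreover have "(\<lambda>h. h * g' v) = (*) (g' v)" by (auto simp: mult.commute)
  ultimately show "\<exists>d. (g \<circ> \<phi> has_field_derivative d) (at t)"
    by (intro exI[of _ "g' v"]) (simp add: has_field_derivative_def)
qed

text \<open>Along a disc in \<open>K\<close> the approximants become holomorphic functions of one
  variable that converge uniformly, and holomorphy passes to the limit.\<close>

lemma Obar_subset_A_D:
  fixes K :: "(complex ^ 'n) set"
  shows "Obar K \<subseteq> A_D K"
proof
  fix f assume f: "f \<in> Obar K"
  have "(f \<circ> \<phi>) holomorphic_on ball c r"
    if \<phi>: "\<forall>i. (\<lambda>t. \<phi> t $ i) holomorphic_on ball c r" and sub: "\<phi> ` ball c r \<subseteq> K"
    for c r and \<phi> :: "complex \<Rightarrow> complex ^ 'n"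
  proof -
    have "\<exists>g. (g \<circ> \<phi>) holomorphic_on ball c r \<and> (\<forall>z\<in>K. norm (f z - g z) < e)" if "e > 0" for e
    proof -
      obtain U g where U: "K \<subseteq> U" and g: "holo_n U g" "\<forall>z\<in>K. norm (f z - g z) < e"
        using f \<open>e > 0\<close> unfolding Obar_def by blast
      have "(g \<circ> \<phi>) holomorphic_on ball c r"
        by (rule holo_n_compose_disc[OF g(1)]) (use \<phi> sub U in auto)
      then show ?thesis using g(2) by blast
    qed
    then have "\<forall>n. \<exists>g. (g \<circ> \<phi>) holomorphic_on ball c r \<and> (\<forall>z\<in>K. norm (f z - g z) < 1 / real (Suc n))"
      by simp
    then obtain g where g: "\<And>n. (g n \<circ> \<phi>) holomorphic_on ball c r"
      "\<And>n z. z \<in> K \<Longrightarrow> norm (f z - g n z) < 1 / real (Suc n)"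
      by metis
    have ul: "uniform_limit (ball c r) (\<lambda>n. g n \<circ> \<phi>) (f \<circ> \<phi>) sequentially"
    proof (rule uniform_limitI)
      fix e :: real assume "e > 0"
      have "(\<lambda>n. 1 / real (Suc n)) \<longlonglongrightarrow> 0" by (rule LIMSEQ_Suc[OF lim_1_over_n])
      then have "\<forall>\<^sub>F n in sequentially. 1 / real (Suc n) < e"
        using \<open>e > 0\<close> by (rule order_tendstoD)
      then show "\<forall>\<^sub>F n in sequentially. \<forall>t\<in>ball c r. dist ((g n \<circ> \<phi>) t) ((f \<circ> \<phi>) t) < e"
      proof (rule eventually_mono, intro ballI)
        fix n t assume n: "1 / real (Suc n) < e" and "t \<in> ball c r"
        then have "\<phi> t \<in> K" using sub by blast
        from less_trans[OF g(2)[OF this] n]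
        show "dist ((g n \<circ> \<phi>) t) ((f \<circ> \<phi>) t) < e" by (simp add: dist_norm norm_minus_commute)
      qed
    qed
    show ?thesis
    proof (rule holomorphic_uniform_sequence[OF open_ball g(1)])
      fix x assume "x \<in> ball c r"
      then obtain d where "d > 0" "cball x d \<subseteq> ball c r"
        using open_ball[of c r] unfolding open_contains_cball by blast
      then show "\<exists>d. 0 < d \<and> cball x d \<subseteq> ball c r \<and> uniform_limit (cball x d) (\<lambda>n. g n \<circ> \<phi>) (f \<circ> \<phi>) sequentially"
        using uniform_limit_on_subset[OF ul] by blast
    qed
  qed
  then show "f \<in> A_D K" using f unfolding A_D_def Obar_def by blast
qed

lemma Obar_closed:
  assumes "continuous_on K f" "\<And>e. e > 0 \<Longrightarrow> \<exists>g\<in>Obar K. \<forall>z\<in>K. norm (f z - g z) < e"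
  shows "f \<in> Obar K"
  unfolding Obar_def
proof (intro CollectI conjI allI impI assms(1))
  fix e :: real assume "e > 0"
  then obtain g where g: "g \<in> Obar K" "\<forall>z\<in>K. norm (f z - g z) < e / 2"
    using assms(2)[of "e / 2"] by auto
  then obtain U h where h: "open U" "K \<subseteq> U" "holo_n U h" "\<forall>z\<in>K. norm (g z - h z) < e / 2"
    using \<open>e > 0\<close> half_gt_zero[of e] unfolding Obar_def by blast
  have "norm (f z - h z) < e" if "z \<in> K" for z
    using norm_triangle_ineq[of "f z - g z" "g z - h z"] g(2) h(4) that by fastforce
  then show "\<exists>U g. open U \<and> K \<subseteq> U \<and> holo_n U g \<and> (\<forall>z\<in>K. norm (f z - g z) < e)"
    using h by blast
qed

lemma Obar_add:
  assumes f: "f \<in> Obar K" and g: "g \<in> Obar K"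
  shows "(\<lambda>z. f z + g z) \<in> Obar K"
  unfolding Obar_def
proof (intro CollectI conjI allI impI)
  show "continuous_on K (\<lambda>z. f z + g z)"
    using f g by (auto simp: Obar_def intro: continuous_on_add)
  fix e :: real assume "e > 0"
  then have "e / 2 > 0" by simp
  then obtain U f' V g' where UV: "open U" "K \<subseteq> U" "open V" "K \<subseteq> V"
    and h: "holo_n U f'" "holo_n V g'" "\<forall>z\<in>K. norm (f z - f' z) < e / 2" "\<forall>z\<in>K. norm (g z - g' z) < e / 2"
    using f g unfolding Obar_def by blast
  have "norm (f z + g z - (f' z + g' z)) < e" if "z \<in> K" for z
    using norm_triangle_ineq[of "f z - f' z" "g z - g' z"] h(3,4) that by (fastforce simp: algebra_simps)
  moreover have "holo_n (U \<inter> V) (\<lambda>z. f' z + g' z)"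
    by (intro holo_n_add holo_n_subset[OF h(1)] holo_n_subset[OF h(2)]) auto
  ultimately show "\<exists>U h. open U \<and> K \<subseteq> U \<and> holo_n U h \<and> (\<forall>z\<in>K. norm (f z + g z - h z) < e)"
    using UV by (intro exI[of _ "U \<inter> V"] exI[of _ "\<lambda>z. f' z + g' z"]) auto
qed

lemma Obar_const: "(\<lambda>z. c) \<in> Obar K"
  unfolding Obar_def using holo_n_const[of UNIV c] by (auto intro!: exI[of _ UNIV] exI[of _ "\<lambda>z. c"])

lemma Obar_sum:
  assumes "\<And>i. i \<in> I \<Longrightarrow> f i \<in> Obar K"
  shows "(\<lambda>z. \<Sum>i\<in>I. f i z) \<in> Obar K"
  using assms by (induction I rule: infinite_finite_induct) (auto intro: Obar_const Obar_add)

lemma Obar_mult: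
  assumes K: "compact K" and f: "f \<in> Obar K" and g: "g \<in> Obar K"
  shows "(\<lambda>z. f z * g z) \<in> Obar K"
  unfolding Obar_def
proof (intro CollectI conjI allI impI)
  have cf: "continuous_on K f" and cg: "continuous_on K g" using f g by (auto simp: Obar_def)
  show "continuous_on K (\<lambda>z. f z * g z)" using cf cg by (rule continuous_on_mult)
  fix e :: real assume "e > 0"
  have "bounded (f ` K)" "bounded (g ` K)"
    using compact_imp_bounded compact_continuous_image K cf cg by blast+
  then obtain B1 B2 where "\<forall>z\<in>K. norm (f z) \<le> B1" "\<forall>z\<in>K. norm (g z) \<le> B2"
    unfolding bounded_iff by auto
  then obtain B where B: "B \<ge> 1" "\<And>z. z \<in> K \<Longrightarrow> norm (f z) \<le> B" "\<And>z. z \<in> K \<Longrightarrow> norm (g z) \<le> B"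
    by (intro that[of "max 1 (max B1 B2)"]) (auto simp: le_max_iff_disj)
  \<comment> \<open>Errors \<open>d\<close> in both factors give at most
    \<open>d * (2 * B + 1)\<close> in the product; \<open>d \<le> 1\<close> bounds the approximant
    by \<open>B + 1\<close>, and \<open>e / (4 * B)\<close> makes the total at most 3/4 of
    \<open>e\<close>.\<close>
  define d where "d = min 1 (e / (4 * B))"
  have d: "d > 0" "d \<le> 1" using \<open>e > 0\<close> B by (auto simp: d_def)
  have dB: "d * (2 * B + 1) < e"
  proof -
    have "d * (2 * B + 1) \<le> e / (4 * B) * (3 * B)"
      using B \<open>e > 0\<close> by (intro mult_mono) (auto simp: d_def)
    also have "\<dots> < e" using B \<open>e > 0\<close> by simp
    finally show ?thesis .
  qed
  obtain U f' V g' where UV: "open U" "K \<subseteq> U" "open V" "K \<subseteq> V"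
    and h: "holo_n U f'" "holo_n V g'" "\<forall>z\<in>K. norm (f z - f' z) < d" "\<forall>z\<in>K. norm (g z - g' z) < d"
    using f g d unfolding Obar_def by blast
  have "norm (f z * g z - f' z * g' z) < e" if z: "z \<in> K" for z
  proof -
    have "norm (f' z) \<le> B + 1"
      using norm_triangle_ineq2[of "f' z" "f z"] h(3) z B(2)[OF z] d by (fastforce simp: norm_minus_commute)
    have "f z * g z - f' z * g' z = (f z - f' z) * g z + f' z * (g z - g' z)" by (simp add: algebra_simps)
    also have "norm \<dots> \<le> norm (f z - f' z) * norm (g z) + norm (f' z) * norm (g z - g' z)"
      by (metis norm_mult norm_triangle_ineq)
    also have "\<dots> \<le> d * B + (B + 1) * d"
      using h(3,4) z B(3)[OF z] \<open>norm (f' z) \<le> B + 1\<close> d B by (intro add_mono mult_mono) (auto intro: less_imp_le)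
    also have "\<dots> = d * (2 * B + 1)" by (simp add: algebra_simps)
    finally show ?thesis using dB by linarith
  qed
  moreover have "holo_n (U \<inter> V) (\<lambda>z. f' z * g' z)"
    by (intro holo_n_mult holo_n_subset[OF h(1)] holo_n_subset[OF h(2)]) auto
  ultimately show "\<exists>U h. open U \<and> K \<subseteq> U \<and> holo_n U h \<and> (\<forall>z\<in>K. norm (f z * g z - h z) < e)"
    using UV by (intro exI[of _ "U \<inter> V"] exI[of _ "\<lambda>z. f' z * g' z"]) auto
qed

text \<open>Applied to the two coordinate projections, it lifts functions from the factors to the
  product.\<close>

lemma Obar_compose_linear:
  fixes L :: "complex ^ 'a \<Rightarrow> complex ^ 'b"
  assumes f: "f \<in> Obar K" and L: "bounded_linear L" and CL: "\<And>c v. L (c *s v) = c *s L v"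
    and sub: "L ` K' \<subseteq> K"
  shows "(\<lambda>z. f (L z)) \<in> Obar K'"
  unfolding Obar_def
proof (intro CollectI conjI allI impI)
  have cL: "continuous_on S L" for S using L by (rule linear_continuous_on)
  show "continuous_on K' (\<lambda>z. f (L z))"
    using f sub by (intro continuous_on_compose2[OF _ cL]) (auto simp: Obar_def)
  fix e :: real assume "e > 0"
  then obtain U g where g: "open U" "K \<subseteq> U" "holo_n U g" "\<forall>z\<in>K. norm (f z - g z) < e"
    using f unfolding Obar_def by blast
  have "open (L -` U)" using open_vimage[OF g(1) cL] .
  then show "\<exists>U g. open U \<and> K' \<subseteq> U \<and> holo_n U g \<and> (\<forall>z\<in>K'. norm (f (L z) - g z) < e)"
    using g sub holo_n_compose_linear[OF g(3) L CL]
    by (intro exI[of _ "L -` U"] exI[of _ "\<lambda>z. g (L z)"]) (auto simp: image_subset_iff subset_iff)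
qed

section \<open>Discs, moments and extensions\<close>

lemma A_D_discI:
  fixes K :: "(complex ^ 'n) set"
  assumes "continuous_on K f"
    and "\<And>c r (\<phi> :: complex \<Rightarrow> complex ^ 'n). r > 0 \<Longrightarrow> (\<And>i. (\<lambda>t. \<phi> t $ i) holomorphic_on ball c r) \<Longrightarrow> inj_on \<phi> (ball c r) \<Longrightarrow>
      \<phi> ` ball c r \<subseteq> K \<Longrightarrow> (f \<circ> \<phi>) holomorphic_on ball c r"
  shows "f \<in> A_D K"
  using assms unfolding A_D_def by blast

lemma A_D_discD:
  fixes \<phi> :: "complex \<Rightarrow> complex ^ 'n"
  assumes "f \<in> A_D K" "r > 0" "\<And>i. (\<lambda>t. \<phi> t $ i) holomorphic_on ball c r" "inj_on \<phi> (ball c r)"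
    "\<phi> ` ball c r \<subseteq> K"
  shows "(f \<circ> \<phi>) holomorphic_on ball c r"
  using assms unfolding A_D_def by blast

lemma A_D_cmult:
  fixes K :: "(complex ^ 'a) set"
  assumes "f \<in> A_D K"
  shows "(\<lambda>w. a * f w) \<in> A_D K"
proof (rule A_D_discI)
  show "continuous_on K (\<lambda>w. a * f w)"
    using assms by (auto simp: A_D_def intro: continuous_on_mult_left)
  fix c r and \<phi> :: "complex \<Rightarrow> complex ^ 'a"
  assume "r > 0" "\<And>i. (\<lambda>t. \<phi> t $ i) holomorphic_on ball c r" "inj_on \<phi> (ball c r)" "\<phi> ` ball c r \<subseteq> K"
  from A_D_discD[OF assms this] show "((\<lambda>w. a * f w) \<circ> \<phi>) holomorphic_on ball c r"
    by (auto simp: o_def intro: holomorphic_intros)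
qed

text \<open>The integration runs over \<zeta>, with \<open>w\<close> as a parameter, and has an
  integrable majorant independent of \<open>w\<close>. So continuity follows by dominated
  convergence, and holomorphy along each disc by differentiation under the integral.\<close>

lemma moment_in_A_D:
  fixes G :: "complex \<Rightarrow> complex ^ 'm \<Rightarrow> complex"
  assumes G: "\<And>\<zeta>. G \<zeta> \<in> A_D W" and bdd: "\<And>\<zeta> w. w \<in> W \<Longrightarrow> norm (G \<zeta> w) \<le> S"
    and meas: "\<And>w. w \<in> W \<Longrightarrow> (\<lambda>\<zeta>. G \<zeta> w) \<in> borel_measurable borel"
  shows "(\<lambda>w. moment j k (\<lambda>\<zeta>. G \<zeta> w)) \<in> A_D W"
proof -
  define h where "h w \<zeta> = (G \<zeta> w - G k w) * dcell (\<zeta> - k) * (\<zeta> - k) ^ j" for w \<zeta>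
  define B where "B \<zeta> = 2 * S * (2 * 2 ^ j) * indicator (cball k 2) \<zeta>" for \<zeta>
  have B_int: "integrable lborel B"
    unfolding B_def by (intro integrable_mult_right integrable_indicator_cball)
  have S: "S \<ge> 0" if "w \<in> W" for w
    using bdd[OF that, of 0] norm_ge_zero order_trans by blast
  have h_le: "norm (h w \<zeta>) \<le> B \<zeta>" if "w \<in> W" for w \<zeta>
  proof (cases "norm (\<zeta> - k) \<ge> 2")
    case True
    then show ?thesis using S[OF \<open>w \<in> W\<close>] by (simp add: h_def B_def dcell_eq_0)
  next
    case False
    have "norm (G \<zeta> w - G k w) \<le> 2 * S"
      using bdd[OF that, of \<zeta>] bdd[OF that, of k] norm_triangle_ineq4[of "G \<zeta> w" "G k w"] by linarith
    then have "norm (h w \<zeta>) \<le> 2 * S * 2 * 2 ^ j"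
      unfolding h_def norm_mult norm_power using False S[OF that]
      by (intro mult_mono norm_dcell_le power_mono) auto
    then show ?thesis using False by (simp add: B_def dist_norm norm_minus_commute)
  qed
  have h_meas: "h w \<in> borel_measurable lborel" if "w \<in> W" for w
  proof -
    note [measurable] = meas[OF that]
    show ?thesis unfolding h_def by measurable
  qed
  have eq: "moment j k (\<lambda>\<zeta>. G \<zeta> w) = - (\<integral>\<zeta>. h w \<zeta> \<partial>lborel)" for w
    by (simp add: moment_def h_def)
  show ?thesis
    unfolding eq
  proof (rule A_D_discI)
    show "continuous_on W (\<lambda>w. - (\<integral>\<zeta>. h w \<zeta> \<partial>lborel))"
    proof (rule continuous_on_minus, unfold continuous_on_sequentially, intro allI ballI impI, elim conjE)
      fix x :: "nat \<Rightarrow> complex ^ 'm" and a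
      assume a: "a \<in> W" and xW: "\<forall>n. x n \<in> W" and x: "x \<longlonglongrightarrow> a"
      show "((\<lambda>w. \<integral>\<zeta>. h w \<zeta> \<partial>lborel) \<circ> x) \<longlonglongrightarrow> (\<integral>\<zeta>. h a \<zeta> \<partial>lborel)"
        unfolding o_def
      proof (rule integral_dominated_convergence[OF _ _ B_int])
        show "AE \<zeta> in lborel. (\<lambda>n. h (x n) \<zeta>) \<longlonglongrightarrow> h a \<zeta>"
        proof (rule AE_I2)
          fix \<zeta>
          have "(\<lambda>n. G u (x n)) \<longlonglongrightarrow> G u a" for u
          proof -
            have "continuous_on W (G u)" using G[of u] by (simp add: A_D_def)
            then show ?thesis
              using a xW x unfolding continuous_on_sequentially o_def by blast
          qed
          then show "(\<lambda>n. h (x n) \<zeta>) \<longlonglongrightarrow> h a \<zeta>"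
            unfolding h_def by (intro tendsto_mult tendsto_diff tendsto_const)
        qed
      qed (use h_meas h_le a xW in auto)
    qed
    fix c r and \<phi> :: "complex \<Rightarrow> complex ^ 'm"
    assume \<phi>: "r > 0" "\<And>i. (\<lambda>t. \<phi> t $ i) holomorphic_on ball c r" "inj_on \<phi> (ball c r)" "\<phi> ` ball c r \<subseteq> W"
    have "(\<lambda>t. \<integral>\<zeta>. h (\<phi> t) \<zeta> \<partial>lborel) holomorphic_on ball c r"
    proof (rule holomorphic_on_lebesgue_integral[OF open_ball _ _ _ B_int])
      fix \<zeta>
      have "(\<lambda>t. G u (\<phi> t)) holomorphic_on ball c r" for u
        using A_D_discD[OF G[of u] \<phi>] by (simp add: o_def)
      then show "(\<lambda>t. h (\<phi> t) \<zeta>) holomorphic_on ball c r"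
        unfolding h_def by (intro holomorphic_on_mult holomorphic_on_diff holomorphic_on_const)
    qed (use \<phi>(4) h_meas h_le in \<open>auto simp: image_subset_iff\<close>)
    then show "((\<lambda>w. - (\<integral>\<zeta>. h w \<zeta> \<partial>lborel)) \<circ> \<phi>) holomorphic_on ball c r"
      unfolding o_def by (rule holomorphic_on_minus)
  qed
qed

text \<open>A Borel extension by scaled values \<open>\<theta> \<zeta> * g (s \<zeta>)\<close> from \<open>K\<close>. It need not be continuous off \<open>K\<close>,
  where \<open>s\<close> is locally constant on small squares, but it oscillates slowly at the scale \<open>\<delta>\<close>.
  The retraction \<open>s\<close> does not depend on \<open>g\<close>, which keeps the extension holomorphic in parameters.\<close>

lemma slow_extension:
  fixes K :: "complex set"
  assumes K: "compact K" "K \<noteq> {}" and "\<rho> > 0" "\<epsilon> > 0"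
  obtains s :: "complex \<Rightarrow> complex" and \<theta> :: "complex \<Rightarrow> real" and \<delta> R :: real where
    "\<delta> > 0" "\<And>\<zeta>. s \<zeta> \<in> K" "\<And>\<zeta>. \<zeta> \<in> K \<Longrightarrow> s \<zeta> = \<zeta>" "\<And>\<zeta>. \<zeta> \<in> K \<Longrightarrow> \<theta> \<zeta> = 1"
    "\<And>\<zeta>. 0 \<le> \<theta> \<zeta>" "\<And>\<zeta>. \<theta> \<zeta> \<le> 1" "\<And>\<zeta>. R < norm \<zeta> \<Longrightarrow> \<theta> \<zeta> = 0"
    "\<And>z \<zeta>. norm (z - \<zeta>) \<le> \<delta> \<Longrightarrow> \<bar>\<theta> z - \<theta> \<zeta>\<bar> \<le> \<epsilon>"
    "\<And>z \<zeta>. norm (z - \<zeta>) \<le> \<delta> \<Longrightarrow> \<theta> z \<noteq> 0 \<Longrightarrow> \<theta> \<zeta> \<noteq> 0 \<Longrightarrow> norm (s z - s \<zeta>) \<le> \<rho>"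
    "\<And>g :: complex \<Rightarrow> complex. continuous_on K g \<Longrightarrow> (\<lambda>\<zeta>. of_real (\<theta> \<zeta>) * g (s \<zeta>)) \<in> borel_measurable borel"
proof -
  \<comment> \<open>11 = 5 + 1 + 5: where \<theta> is nonzero, \<open>s\<close> moves a point by at
    most 5 \<eta>, and the two points compared are at most \<eta> apart.\<close>
  define \<eta> where "\<eta> = \<rho> / 11"
  have \<eta>: "\<eta> > 0" using \<open>\<rho> > 0\<close> by (simp add: \<eta>_def)
  \<comment> \<open>Rounding to the lower left corner of a square of side \<eta> leaves countably
    many arguments of the closest point map, so its measurability is never at issue.\<close>
  define corner where "corner \<zeta> = (of_int \<lfloor>Re \<zeta> / \<eta>\<rfloor> * \<eta>, of_int \<lfloor>Im \<zeta> / \<eta>\<rfloor> * \<eta>)" for \<zeta>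
  define cp where "cp \<zeta> = closest_point K (case corner \<zeta> of (x, y) \<Rightarrow> Complex x y)" for \<zeta>
  define s where "s \<zeta> = (if \<zeta> \<in> K then \<zeta> else cp \<zeta>)" for \<zeta>
  define \<theta> where "\<theta> \<zeta> = max 0 (1 - infdist \<zeta> K / \<eta>)" for \<zeta>
  \<comment> \<open>\<theta> has Lipschitz constant 1 / \<eta>, which gives the factor
    \<open>min 1 \<epsilon>\<close>.\<close>
  define \<delta> where "\<delta> = \<eta> * min 1 \<epsilon>"
  have cl: "closed K" using K(1) by (rule compact_imp_closed)
  have cpK: "cp \<zeta> \<in> K" for \<zeta> unfolding cp_def by (rule closest_point_in_set[OF cl K(2)])
  then have sK: "s \<zeta> \<in> K" for \<zeta> by (simp add: s_def)
  \<comment> \<open>The rounding error, at most 2 \<eta>, counts twice: on the way to the corner and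
    in the distance from the corner to \<open>K\<close>.\<close>
  have s_near: "norm (s \<zeta> - \<zeta>) \<le> infdist \<zeta> K + 4 * \<eta>" for \<zeta>
  proof (cases "\<zeta> \<in> K")
    case True
    then show ?thesis using \<eta> by (simp add: s_def)
  next
    case False
    define c where "c = (case corner \<zeta> of (x, y) \<Rightarrow> Complex x y)"
    have fl: "\<bar>of_int \<lfloor>x / \<eta>\<rfloor> * \<eta> - x\<bar> \<le> \<eta>" for x
    proof -
      have "of_int \<lfloor>x / \<eta>\<rfloor> \<le> x / \<eta>" "x / \<eta> < of_int \<lfloor>x / \<eta>\<rfloor> + 1" by linarith+
      then have "of_int \<lfloor>x / \<eta>\<rfloor> * \<eta> \<le> x" "x < (of_int \<lfloor>x / \<eta>\<rfloor> + 1) * \<eta>"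
        by (simp_all only: pos_le_divide_eq[OF \<eta>] pos_divide_less_eq[OF \<eta>])
      then show ?thesis by (simp add: distrib_right)
    qed
    have "norm (c - \<zeta>) \<le> \<bar>Re (c - \<zeta>)\<bar> + \<bar>Im (c - \<zeta>)\<bar>" by (rule cmod_le)
    also have "\<dots> \<le> \<eta> + \<eta>"
      using fl[of "Re \<zeta>"] fl[of "Im \<zeta>"] by (intro add_mono) (simp_all add: c_def corner_def)
    finally have c: "dist c \<zeta> \<le> 2 * \<eta>" by (simp add: dist_norm)
    have "dist c (cp \<zeta>) = infdist c K"
      unfolding cp_def c_def[symmetric]
      by (simp add: infdist_eq_setdist setdist_closest_point[OF cl K(2)])
    also have "\<dots> \<le> infdist \<zeta> K + dist c \<zeta>" by (rule infdist_triangle)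
    finally have "dist (cp \<zeta>) \<zeta> \<le> infdist \<zeta> K + 4 * \<eta>"
      using c dist_triangle[of "cp \<zeta>" \<zeta> c] by (simp add: dist_commute)
    then show ?thesis using False by (simp add: s_def dist_norm)
  qed
  have lip: "\<bar>\<theta> z - \<theta> \<zeta>\<bar> \<le> norm (z - \<zeta>) / \<eta>" for z \<zeta>
  proof -
    have "\<bar>infdist z K - infdist \<zeta> K\<bar> \<le> norm (z - \<zeta>)"
      using infdist_triangle[of z K \<zeta>] infdist_triangle[of \<zeta> K z] by (simp add: dist_norm norm_minus_commute abs_le_iff)
    then have "\<bar>infdist z K / \<eta> - infdist \<zeta> K / \<eta>\<bar> \<le> norm (z - \<zeta>) / \<eta>"
      using \<eta> by (simp add: diff_divide_distrib[symmetric] divide_right_mono)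
    then show ?thesis unfolding \<theta>_def by linarith
  qed
  have \<delta>: "\<delta> > 0" "\<delta> \<le> \<eta>" "\<delta> / \<eta> \<le> \<epsilon>" using \<eta> \<open>\<epsilon> > 0\<close> by (auto simp: \<delta>_def)
  obtain R0 where R0: "\<And>z. z \<in> K \<Longrightarrow> norm z \<le> R0"
    using compact_imp_bounded[OF K(1)] unfolding bounded_iff by blast
  show ?thesis
  proof (rule that[of \<delta> s \<theta> "R0 + 5 * \<eta>"])
    show "s \<zeta> \<in> K" for \<zeta> by (rule sK)
    show "s \<zeta> = \<zeta>" "\<theta> \<zeta> = 1" if "\<zeta> \<in> K" for \<zeta> using that by (simp_all add: s_def \<theta>_def)
    show "0 \<le> \<theta> \<zeta>" for \<zeta> by (simp add: \<theta>_def)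
    show "\<theta> \<zeta> \<le> 1" for \<zeta> using \<eta> by (simp add: \<theta>_def infdist_nonneg)
    have near: "norm (s \<zeta> - \<zeta>) \<le> 5 * \<eta>" if "\<theta> \<zeta> \<noteq> 0" for \<zeta>
    proof -
      have "infdist \<zeta> K \<le> \<eta>" using that \<eta> by (auto simp: \<theta>_def max_def divide_simps split: if_splits)
      then show ?thesis using s_near[of \<zeta>] by linarith
    qed
    show "\<theta> \<zeta> = 0" if "R0 + 5 * \<eta> < norm \<zeta>" for \<zeta>
    proof (rule ccontr)
      assume "\<theta> \<zeta> \<noteq> 0"
      from near[OF this] R0[OF sK[of \<zeta>]] that show False
        using norm_triangle_ineq2[of \<zeta> "s \<zeta>"] by (simp add: norm_minus_commute)
    qed
    show "\<bar>\<theta> z - \<theta> \<zeta>\<bar> \<le> \<epsilon>" if "norm (z - \<zeta>) \<le> \<delta>" for z \<zeta>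
      using lip[of z \<zeta>] divide_right_mono[OF that, of \<eta>] \<delta>(3) \<eta> by linarith
    show "norm (s z - s \<zeta>) \<le> \<rho>" if "norm (z - \<zeta>) \<le> \<delta>" "\<theta> z \<noteq> 0" "\<theta> \<zeta> \<noteq> 0" for z \<zeta>
    proof -
      have "s z - s \<zeta> = (s z - z) + (z - \<zeta>) - (s \<zeta> - \<zeta>)" by simp
      also have "norm \<dots> \<le> norm (s z - z) + norm (z - \<zeta>) + norm (s \<zeta> - \<zeta>)"
        using norm_triangle_ineq4 norm_triangle_ineq by (metis add_right_mono order_trans)
      also have "\<dots> \<le> 5 * \<eta> + \<eta> + 5 * \<eta>"
        using near[OF that(2)] near[OF that(3)] that(1) \<delta>(2) by linarith
      finally show ?thesis by (simp add: \<eta>_def)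
    qed
    fix g :: "complex \<Rightarrow> complex" assume g: "continuous_on K g"
    have [measurable]: "K \<in> sets borel" using cl by (rule borel_closed)
    have "(\<lambda>\<zeta>. if \<zeta> \<in> K then g \<zeta> else 0) \<in> borel_measurable borel"
      using borel_measurable_continuous_on_indicator[OF _ g] cl
      by (simp add: borel_closed indicator_scaleR_eq_if)
    \<comment> \<open>The map factors through pairs of integers, a countable space on which every
      function is measurable.\<close>
    moreover have "(\<lambda>\<zeta>. g (cp \<zeta>)) \<in> borel_measurable borel"
    proof -
      have "(\<lambda>\<zeta>. (\<lfloor>Re \<zeta> / \<eta>\<rfloor>, \<lfloor>Im \<zeta> / \<eta>\<rfloor>)) \<in> borel \<rightarrow>\<^sub>M count_space UNIV \<Otimes>\<^sub>M count_space UNIV"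
        by measurable
      then have "(\<lambda>\<zeta>. (\<lfloor>Re \<zeta> / \<eta>\<rfloor>, \<lfloor>Im \<zeta> / \<eta>\<rfloor>)) \<in> borel \<rightarrow>\<^sub>M count_space UNIV"
        by (simp add: pair_measure_countable)
      from measurable_compose[OF this, of "\<lambda>(i, j). g (closest_point K (Complex (of_int i * \<eta>) (of_int j * \<eta>)))" borel]
      show ?thesis by (simp add: cp_def corner_def)
    qed
    ultimately have "(\<lambda>\<zeta>. if \<zeta> \<in> K then (if \<zeta> \<in> K then g \<zeta> else 0) else g (cp \<zeta>)) \<in> borel_measurable borel"
      by measurable
    moreover have "(\<lambda>\<zeta>. g (s \<zeta>)) = (\<lambda>\<zeta>. if \<zeta> \<in> K then (if \<zeta> \<in> K then g \<zeta> else 0) else g (cp \<zeta>))"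
      by (auto simp: s_def)
    ultimately have "(\<lambda>\<zeta>. g (s \<zeta>)) \<in> borel_measurable borel" by simp
    moreover have "(\<lambda>\<zeta>. complex_of_real (\<theta> \<zeta>)) \<in> borel_measurable borel"
      unfolding \<theta>_def by (intro borel_measurable_continuous_onI continuous_intros) (use \<eta> in auto)
    ultimately show "(\<lambda>\<zeta>. of_real (\<theta> \<zeta>) * g (s \<zeta>)) \<in> borel_measurable borel"
      by (intro borel_measurable_times)
  qed (use \<delta> in auto)
qed

section \<open>Products\<close>

text \<open>Pairs a scalar, rather than a vector of length one, with a point of the second factor,
  so that one-variable theory applies directly to the first coordinate.\<close>

definition join_vec :: "complex \<Rightarrow> complex ^ 'm \<Rightarrow> complex ^ (1 + 'm)" where
  "join_vec z w = (\<chi> i. case i of Inl _ \<Rightarrow> z | Inr j \<Rightarrow> w $ j)"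

lemma join_vec_nth [simp]: "vec_nth (join_vec z w) (Inl i) = z" "vec_nth (join_vec z w) (Inr j) = vec_nth w j"
  by (simp_all add: join_vec_def)

lemma vec_1_eq: "(\<chi> i. vec_nth x 1) = (x :: 'a ^ 1)"
  by (simp add: vec_eq_iff forall_1)

lemma join_mem_prod_set: "join_vec z w \<in> prod_set K1 K2 \<longleftrightarrow> z \<in> (\<lambda>v. vec_nth v 1) ` K1 \<and> w \<in> K2"
proof -
  have "(\<chi> i. z) \<in> K1 \<longleftrightarrow> z \<in> (\<lambda>v. vec_nth v 1) ` K1" for K1 :: "(complex ^ 1) set"
    by (auto simp: image_iff vec_1_eq intro!: bexI[of _ "\<chi> i. z"])
  then show ?thesis by (simp add: prod_set_def)
qed

lemma join_surj: "z = join_vec (vec_nth z (Inl 1)) (\<chi> j. vec_nth z (Inr j))"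
  by (auto simp: vec_eq_iff join_vec_def split: sum.split)

lemma prod_setE:
  assumes "z \<in> prod_set K1 K2"
  obtains x w where "z = join_vec x w" "x \<in> (\<lambda>v. vec_nth v 1) ` K1" "w \<in> K2"
  using assms join_surj[of z] join_mem_prod_set by metis

text \<open>The open mapping theorem makes the image open. This is why A_D and A agree in the
  plane.\<close>

lemma inj_holomorphic_in_interior:
  assumes "f holomorphic_on ball c r" "inj_on f (ball c r)" "f ` ball c r \<subseteq> K"
  shows "f ` ball c r \<subseteq> interior K"
  using open_mapping_thm3[OF assms(1) open_ball assms(2)] assms(3) by (rule interior_maximal[rotated])

lemma A_D_planar:
  fixes K1 :: "(complex ^ 1) set"
  assumes cont: "continuous_on ((\<lambda>v. vec_nth v 1) ` K1) h"
    and hol: "h holomorphic_on interior ((\<lambda>v. vec_nth v 1) ` K1)"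
  shows "(\<lambda>v. h (vec_nth v 1)) \<in> A_D K1"
proof (rule A_D_discI)
  show "continuous_on K1 (\<lambda>v. h (vec_nth v 1))"
    by (rule continuous_on_compose2[OF cont]) (auto intro: continuous_intros)
  fix c r and \<phi> :: "complex \<Rightarrow> complex ^ 1"
  assume \<phi>: "\<And>i. (\<lambda>t. vec_nth (\<phi> t) i) holomorphic_on ball c r" "inj_on \<phi> (ball c r)" "\<phi> ` ball c r \<subseteq> K1"
  let ?g = "\<lambda>t. vec_nth (\<phi> t) 1"
  have "inj_on ?g (ball c r)"
    using \<phi>(2) by (auto simp: inj_on_def vec_eq_iff forall_1)
  moreover have "?g ` ball c r \<subseteq> (\<lambda>v. vec_nth v 1) ` K1" using \<phi>(3) by auto
  ultimately have "?g ` ball c r \<subseteq> interior ((\<lambda>v. vec_nth v 1) ` K1)"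
    using inj_holomorphic_in_interior[OF \<phi>(1)] by blast
  then have "(h \<circ> ?g) holomorphic_on ball c r"
    using holomorphic_on_compose_gen[OF \<phi>(1) hol] by blast
  then show "((\<lambda>v. h (vec_nth v 1)) \<circ> \<phi>) holomorphic_on ball c r" by (simp add: o_def)
qed

text \<open>A disc in \<open>K2\<close> stays an injective disc when a constant first coordinate is
  added.\<close>

lemma A_D_section:
  assumes f: "f \<in> A_D (prod_set K1 K2)" and z: "z \<in> (\<lambda>v. vec_nth v 1) ` K1"
  shows "(\<lambda>w. f (join_vec z w)) \<in> A_D K2"
proof (rule A_D_discI)
  have cf: "continuous_on (prod_set K1 K2) f" using f by (simp add: A_D_def)
  show "continuous_on K2 (\<lambda>w. f (join_vec z w))"
  proof (rule continuous_on_compose2[OF cf])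
    show "continuous_on K2 (join_vec z)"
      unfolding join_vec_def
    proof (rule continuous_on_vec_lambda)
      show "continuous_on K2 (\<lambda>w. case i of Inl _ \<Rightarrow> z | Inr j \<Rightarrow> vec_nth w j)" for i
        by (cases i) (auto intro!: continuous_intros)
    qed
  qed (use z join_mem_prod_set in blast)
  fix c r and \<phi> :: "complex \<Rightarrow> complex ^ 'a"
  assume \<phi>: "r > 0" "\<And>i. (\<lambda>t. vec_nth (\<phi> t) i) holomorphic_on ball c r" "inj_on \<phi> (ball c r)" "\<phi> ` ball c r \<subseteq> K2"
  have "(f \<circ> (\<lambda>t. join_vec z (\<phi> t))) holomorphic_on ball c r"
  proof (rule A_D_discD[OF f \<phi>(1)])
    show "(\<lambda>t. vec_nth (join_vec z (\<phi> t)) i) holomorphic_on ball c r" for i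
      by (cases i) (simp_all add: \<phi>(2))
    show "inj_on (\<lambda>t. join_vec z (\<phi> t)) (ball c r)"
      using \<phi>(3) by (auto simp: inj_on_def vec_eq_iff join_vec_def split: sum.split_asm)
    show "(\<lambda>t. join_vec z (\<phi> t)) ` ball c r \<subseteq> prod_set K1 K2"
      using \<phi>(4) z by (auto simp: join_mem_prod_set)
  qed
  then show "((\<lambda>w. f (join_vec z w)) \<circ> \<phi>) holomorphic_on ball c r" by (simp add: o_def)
qed

lemma A_D_slice_holomorphic:
  assumes f: "f \<in> A_D (prod_set K1 K2)" and w: "w \<in> K2"
  shows "(\<lambda>z. f (join_vec z w)) holomorphic_on interior ((\<lambda>v. vec_nth v 1) ` K1)"
proof -
  let ?K = "(\<lambda>v. vec_nth v 1) ` K1"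
  have "(\<lambda>z. f (join_vec z w)) field_differentiable at a" if "a \<in> interior ?K" for a
  proof -
    obtain r where r: "r > 0" "ball a r \<subseteq> ?K"
      using \<open>a \<in> interior ?K\<close> mem_interior by blast
    have "(f \<circ> (\<lambda>z. join_vec z w)) holomorphic_on ball a r"
    proof (rule A_D_discD[OF f r(1)])
      show "(\<lambda>t. vec_nth (join_vec t w) i) holomorphic_on ball a r" for i
        by (cases i) simp_all
      show "inj_on (\<lambda>t. join_vec t w) (ball a r)"
        by (auto simp: inj_on_def vec_eq_iff join_vec_def split: sum.split_asm)
      show "(\<lambda>t. join_vec t w) ` ball a r \<subseteq> prod_set K1 K2"
        using r(2) w by (auto simp: join_mem_prod_set)
    qed
    then show ?thesis
      using r(1) holomorphic_on_imp_differentiable_at[of _ "ball a r" a] by (simp add: o_def)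
  qed
  then show ?thesis
    unfolding holomorphic_on_def by (blast intro: field_differentiable_at_within)
qed

lemma continuous_on_join:
  fixes S :: "(complex \<times> (complex ^ 'm)) set"
  shows "continuous_on S (\<lambda>p. join_vec (fst p) (snd p))"
  unfolding join_vec_def
proof (rule continuous_on_vec_lambda)
  show "continuous_on S (\<lambda>p. case i of Inl _ \<Rightarrow> fst p | Inr j \<Rightarrow> vec_nth (snd p) j)" for i
    by (cases i) (auto intro!: continuous_intros)
qed

lemma scaled_interior:
  assumes "d > 0" "z \<in> interior {z :: complex. of_real d * z \<in> K}"
  shows "of_real d * z \<in> interior K"
proof -
  have "open ((\<lambda>z. of_real d * z) ` interior {z. of_real d * z \<in> K})"
    using open_scaling[of d "interior {z. of_real d * z \<in> K}"] assms(1) by (simp add: scaleR_conv_of_real)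
  moreover have "(\<lambda>z. of_real d * z) ` interior {z. of_real d * z \<in> K} \<subseteq> K"
    using interior_subset by blast
  ultimately show ?thesis using assms(2) interior_maximal by blast
qed

lemma unscaled_interior:
  assumes "d > 0" "z \<in> interior K"
  shows "z / of_real d \<in> interior {z :: complex. of_real d * z \<in> K}"
proof -
  have "open ((\<lambda>z. of_real (1 / d) * z) ` interior K)"
    using open_scaling[of "1 / d" "interior K"] assms(1) by (simp add: scaleR_conv_of_real)
  moreover have "(\<lambda>z. of_real (1 / d) * z) ` interior K \<subseteq> {z. of_real d * z \<in> K}"
    using interior_subset[of K] assms(1) by auto
  moreover have "z / of_real d \<in> (\<lambda>z. of_real (1 / d) * z) ` interior K"
    using assms(2) by (auto simp: image_iff intro!: bexI[of _ z])
  ultimately show ?thesis using interior_maximal by blast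
qed

lemma A_D_prod_subset_Obar:
  fixes K1 :: "(complex ^ 1) set" and K2 :: "(complex ^ 'm) set"
  assumes K1: "compact K1" and K2: "compact K2"
    and O1: "A_D K1 \<subseteq> Obar K1" and O2: "A_D K2 \<subseteq> Obar K2"
  shows "A_D (prod_set K1 K2) \<subseteq> Obar (prod_set K1 K2)"
proof
  fix f assume f: "f \<in> A_D (prod_set K1 K2)"
  let ?P = "prod_set K1 K2"
  define K where "K = (\<lambda>v. vec_nth v 1) ` K1"
  have K: "compact K"
    unfolding K_def by (intro compact_continuous_image K1 continuous_intros)
  have join_P: "join_vec z w \<in> ?P \<longleftrightarrow> z \<in> K \<and> w \<in> K2" for z w
    by (simp add: join_mem_prod_set K_def)
  have P_eq: "?P = (\<lambda>p. join_vec (fst p) (snd p)) ` (K \<times> K2)"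
  proof
    show "?P \<subseteq> (\<lambda>p. join_vec (fst p) (snd p)) ` (K \<times> K2)"
    proof
      fix z assume "z \<in> ?P"
      then obtain x w where "z = join_vec x w" "x \<in> K" "w \<in> K2"
        unfolding K_def by (rule prod_setE)
      then show "z \<in> (\<lambda>p. join_vec (fst p) (snd p)) ` (K \<times> K2)"
        by (intro image_eqI[of _ _ "(x, w)"]) auto
    qed
  qed (use join_P in auto)
  have P: "compact ?P"
    unfolding P_eq by (intro compact_continuous_image continuous_on_join compact_Times K K2)
  have cf: "continuous_on ?P f" using f by (simp add: A_D_def)
  define f0 where "f0 z w = f (join_vec z w)" for z w
  have cont0: "continuous_on (K \<times> K2) (\<lambda>p. f0 (fst p) (snd p))"
    unfolding f0_def by (rule continuous_on_compose2[OF cf continuous_on_join]) (simp add: P_eq)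
  have uc: "uniformly_continuous_on (K \<times> K2) (\<lambda>p. f0 (fst p) (snd p))"
    by (intro compact_uniformly_continuous cont0 compact_Times K K2)
  obtain S where S: "S > 0" "\<And>z w. z \<in> K \<Longrightarrow> w \<in> K2 \<Longrightarrow> norm (f0 z w) \<le> S"
  proof -
    have "bounded ((\<lambda>p. f0 (fst p) (snd p)) ` (K \<times> K2))"
      by (intro compact_imp_bounded compact_continuous_image cont0 compact_Times K K2)
    then obtain S where "S > 0" "\<forall>x\<in>(\<lambda>p. f0 (fst p) (snd p)) ` (K \<times> K2). norm x \<le> S"
      unfolding bounded_pos by blast
    then show ?thesis using that[of S] by force
  qed
  have f0_w: "f0 z \<in> A_D K2" if "z \<in> K" for z
    using A_D_section[OF f] that unfolding K_def f0_def by blast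
  have f0_z: "(\<lambda>z. f0 z w) holomorphic_on interior K" if "w \<in> K2" for w
    using A_D_slice_holomorphic[OF f that] unfolding K_def f0_def .
  have f0_cont: "continuous_on K (\<lambda>z. f0 z w)" if "w \<in> K2" for w
  proof -
    have "continuous_on K (\<lambda>z. (z, w))" by (intro continuous_intros)
    from continuous_on_compose2[OF cont0 this] show ?thesis using that by auto
  qed
  show "f \<in> Obar ?P"
  proof (cases "K = {}")
    case True
    then have "?P = {}" using P_eq by simp
    then show ?thesis using Obar_closed[of "{}" f] Obar_const by auto
  next
    case ne: False
    show ?thesis
    proof (rule Obar_closed[OF cf])
      fix \<epsilon> :: real assume "\<epsilon> > 0"
      define C where "C = 995328 * singular_mass / kernel_mass"
      have "singular_mass \<ge> 0" using singular_mass_ge measure_nonneg order_trans by blast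
      then have "C \<ge> 0" using kernel_mass_pos by (simp add: C_def)
      \<comment> \<open>The summand 1 keeps the denominator positive, and the factor 2 makes the
        inequality \<open>C * e < \<epsilon>\<close> strict.\<close>
      define e where "e = \<epsilon> / (2 * (C + 1))"
      have e: "e > 0" and Ce: "C * e < \<epsilon>"
      proof -
        show "e > 0" using \<open>\<epsilon> > 0\<close> \<open>C \<ge> 0\<close> by (simp add: e_def)
        then have "0 \<le> C * e" using \<open>C \<ge> 0\<close> by simp
        have "2 * (C + 1) * e = \<epsilon>" using \<open>C \<ge> 0\<close> by (simp add: e_def)
        then have "\<epsilon> = 2 * (C * e) + 2 * e" by (simp add: algebra_simps)
        then show "C * e < \<epsilon>" using \<open>e > 0\<close> \<open>0 \<le> C * e\<close> by linarith
      qed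
      \<comment> \<open>Uniform continuity on the whole product gives a modulus of continuity in
        \<open>z\<close> that serves all \<open>w\<close> at once; one lattice then suffices for all
        slices.\<close>
      obtain \<rho>' where \<rho>': "\<rho>' > 0" "\<And>p p'. p \<in> K \<times> K2 \<Longrightarrow> p' \<in> K \<times> K2 \<Longrightarrow> dist p' p < \<rho>' \<Longrightarrow>
          dist (f0 (fst p') (snd p')) (f0 (fst p) (snd p)) < e / 2"
        using uc e unfolding uniformly_continuous_on_def by (metis half_gt_zero)
      define \<rho> where "\<rho> = \<rho>' / 2"
      have \<rho>: "\<rho> > 0" "\<And>z z' w. z \<in> K \<Longrightarrow> z' \<in> K \<Longrightarrow> w \<in> K2 \<Longrightarrow> norm (z - z') \<le> \<rho> \<Longrightarrow> norm (f0 z w - f0 z' w) \<le> e / 2"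
      proof -
        fix z z' w assume *: "z \<in> K" "z' \<in> K" "w \<in> K2" "norm (z - z') \<le> \<rho>"
        then have "dist (z, w) (z', w) < \<rho>'"
          using \<rho>'(1) by (simp add: dist_Pair_Pair dist_norm \<rho>_def)
        then show "norm (f0 z w - f0 z' w) \<le> e / 2"
          using \<rho>'(2)[of "(z', w)" "(z, w)"] * by (simp add: dist_norm)
      qed (use \<rho>' in \<open>simp add: \<rho>_def\<close>)
      \<comment> \<open>The oscillation \<open>e\<close> is split in halves: variation of \<theta>
        times the bound \<open>S\<close>, and variation of \<open>f0\<close>.\<close>
      have "e / (2 * S) > 0" using e S(1) by simp
      obtain s \<theta> \<delta> R where ext: "\<delta> > 0" "\<And>\<zeta>. s \<zeta> \<in> K" "\<And>\<zeta>. \<zeta> \<in> K \<Longrightarrow> s \<zeta> = \<zeta>" "\<And>\<zeta>. \<zeta> \<in> K \<Longrightarrow> \<theta> \<zeta> = 1"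
        "\<And>\<zeta>. 0 \<le> \<theta> \<zeta>" "\<And>\<zeta>. \<theta> \<zeta> \<le> 1" "\<And>\<zeta>. R < norm \<zeta> \<Longrightarrow> \<theta> \<zeta> = 0"
        "\<And>z \<zeta>. norm (z - \<zeta>) \<le> \<delta> \<Longrightarrow> \<bar>\<theta> z - \<theta> \<zeta>\<bar> \<le> e / (2 * S)"
        "\<And>z \<zeta>. norm (z - \<zeta>) \<le> \<delta> \<Longrightarrow> \<theta> z \<noteq> 0 \<Longrightarrow> \<theta> \<zeta> \<noteq> 0 \<Longrightarrow> norm (s z - s \<zeta>) \<le> \<rho>"
        and ext_meas: "\<And>g :: complex \<Rightarrow> complex. continuous_on K g \<Longrightarrow> (\<lambda>\<zeta>. of_real (\<theta> \<zeta>) * g (s \<zeta>)) \<in> borel_measurable borel"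
      proof (rule slow_extension[OF K ne \<rho>(1) \<open>e / (2 * S) > 0\<close>], goal_cases)
        case (1 s \<theta> \<delta> R)
        show thesis by (rule 1(1)[where s=s and \<theta>=\<theta> and \<delta>=\<delta> and R=R]; fact 1)
      qed
      define E where "E \<zeta> w = of_real (\<theta> \<zeta>) * f0 (s \<zeta>) w" for \<zeta> w
      have E_bdd: "norm (E \<zeta> w) \<le> S" if "w \<in> K2" for \<zeta> w
        using mult_mono[OF ext(6)[of \<zeta>] S(2)[OF ext(2)[of \<zeta>] that]] ext(5)[of \<zeta>]
        by (simp add: E_def norm_mult)
      have E_osc: "norm (E z w - E \<zeta> w) \<le> e" if zz: "norm (z - \<zeta>) \<le> \<delta>" and w: "w \<in> K2" for z \<zeta> w
      proof -
        have part: "norm (of_real (\<theta> z - \<theta> \<zeta>) * f0 (s u) w) \<le> e / 2" for u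
        proof -
          have "norm (of_real (\<theta> z - \<theta> \<zeta>) * f0 (s u) w) \<le> e / (2 * S) * S"
            unfolding norm_mult norm_of_real
            by (intro mult_mono ext(8)[OF zz] S(2)[OF ext(2) w]) (use e S(1) in auto)
          then show ?thesis using S(1) by simp
        qed
        \<comment> \<open>If \<theta> vanishes at one of the points, nothing is known about
          \<open>s\<close> there, but then \<theta> is small at the other point and its variation
          alone gives the bound.\<close>
        show ?thesis
        proof (cases "\<theta> z = 0 \<or> \<theta> \<zeta> = 0")
          case True
          then have "E z w - E \<zeta> w = of_real (\<theta> z - \<theta> \<zeta>) * f0 (s (if \<theta> z = 0 then \<zeta> else z)) w"
            by (auto simp: E_def)
          then show ?thesis using part[of "if \<theta> z = 0 then \<zeta> else z"] e by simp
        next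
          case False
          have "norm (of_real (\<theta> z) * (f0 (s z) w - f0 (s \<zeta>) w)) \<le> 1 * (e / 2)"
            unfolding norm_mult norm_of_real
            using ext(5)[of z] ext(6)[of z] ext(9)[OF zz] False
            by (intro mult_mono \<rho>(2)[OF ext(2) ext(2) w]) auto
          moreover have "E z w - E \<zeta> w = of_real (\<theta> z) * (f0 (s z) w - f0 (s \<zeta>) w) + of_real (\<theta> z - \<theta> \<zeta>) * f0 (s \<zeta>) w"
            by (simp add: E_def algebra_simps)
          ultimately show ?thesis
            using part[of \<zeta>] norm_triangle_ineq[of "of_real (\<theta> z) * (f0 (s z) w - f0 (s \<zeta>) w)" "of_real (\<theta> z - \<theta> \<zeta>) * f0 (s \<zeta>) w"]
            by simp
        qed
      qed
      \<comment> \<open>After division by \<open>d\<close>, the distance \<delta> at which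
        \<open>E\<close> oscillates by at most \<open>e\<close> becomes 4, the distance required by
        the unit lattice.\<close>
      define d where "d = \<delta> / 4"
      have d: "d > 0" using ext(1) by (simp add: d_def)
      define Kd where "Kd = {z. of_real d * z \<in> K}"
      define F where "F w \<zeta> = E (of_real d * \<zeta>) w" for w \<zeta>
      obtain R1 where R1: "\<And>z. z \<in> K \<Longrightarrow> norm z \<le> R1"
        using compact_imp_bounded[OF K] unfolding bounded_iff by blast
      \<comment> \<open>The lattice must cover both the rescaled compact set (\<open>R1\<close>) and
        the rescaled support of the extension (\<open>R\<close>).\<close>
      obtain M :: nat where M: "max R R1 / d \<le> real M" using real_arch_simple by blast
      have M_R: "max R R1 \<le> real M * d" using M d by (simp add: pos_divide_le_eq)
      obtain p q :: "nat \<times> nat \<Rightarrow> complex \<Rightarrow> complex" and \<alpha> \<beta> \<gamma> :: "nat \<times> nat \<Rightarrow> complex" where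
        pq: "\<And>\<kappa>. continuous_on Kd (p \<kappa>)" "\<And>\<kappa>. p \<kappa> holomorphic_on interior Kd"
          "\<And>\<kappa>. continuous_on Kd (q \<kappa>)" "\<And>\<kappa>. q \<kappa> holomorphic_on interior Kd"
        and approx: "\<And>F S e z. F \<in> borel_measurable borel \<Longrightarrow> (\<And>\<zeta>. norm (F \<zeta>) \<le> S) \<Longrightarrow>
          (\<And>z \<zeta>. norm (z - \<zeta>) \<le> 4 \<Longrightarrow> norm (F z - F \<zeta>) \<le> e) \<Longrightarrow>
          (\<And>\<zeta>. real M < norm \<zeta> \<Longrightarrow> F \<zeta> = 0) \<Longrightarrow>
          continuous_on Kd F \<Longrightarrow> F holomorphic_on interior Kd \<Longrightarrow> z \<in> Kd \<Longrightarrow> norm z \<le> real M \<Longrightarrow>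
          norm (of_real kernel_mass * F z - (\<Sum>\<kappa>\<in>lattice M.
            \<alpha> \<kappa> * moment 0 (lattice_point M \<kappa>) F * p \<kappa> z
            + (\<beta> \<kappa> * moment 0 (lattice_point M \<kappa>) F + \<gamma> \<kappa> * moment 1 (lattice_point M \<kappa>) F) * q \<kappa> z))
          \<le> 995328 * singular_mass * e"
      proof (rule lattice_approximation[of Kd M], goal_cases)
        case (1 p q \<alpha> \<beta> \<gamma>)
        show thesis by (rule 1(1)[where p=p and q=q and \<alpha>=\<alpha> and \<beta>=\<beta> and \<gamma>=\<gamma>]; fact 1)
      qed
      let ?m = "\<lambda>j \<kappa> w. moment j (lattice_point M \<kappa>) (F w)"
      define H where "H z w = (\<Sum>\<kappa>\<in>lattice M. \<alpha> \<kappa> * ?m 0 \<kappa> w * p \<kappa> (z / of_real d)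
            + (\<beta> \<kappa> * ?m 0 \<kappa> w + \<gamma> \<kappa> * ?m 1 \<kappa> w) * q \<kappa> (z / of_real d))" for z w
      have F_K: "F w z = f0 (of_real d * z) w" if "z \<in> Kd" for w z
        using that ext(3,4) by (simp add: F_def E_def Kd_def)
      have F_meas: "F w \<in> borel_measurable borel" if "w \<in> K2" for w
        using measurable_compose[OF _ ext_meas[OF f0_cont[OF that]], of "\<lambda>\<zeta>. of_real d * \<zeta>" borel]
        unfolding F_def E_def by simp
      have H_approx: "norm (f0 z w - H z w / of_real kernel_mass) < \<epsilon>" if z: "z \<in> K" and w: "w \<in> K2" for z w
      proof -
        define u where "u = z / of_real d"
        have zu: "of_real d * u = z" using d by (simp add: u_def)
        have uK: "u \<in> Kd" using z by (simp add: Kd_def zu)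
        have "norm u = norm z / d" using d by (simp add: u_def norm_divide)
        then have uM: "norm u \<le> real M" using R1[OF z] M_R d by (simp add: pos_divide_le_eq)
        have "norm (of_real kernel_mass * F w u - H z w) \<le> 995328 * singular_mass * e"
          unfolding H_def u_def[symmetric]
        proof (rule approx[OF F_meas[OF w] _ _ _ _ _ uK uM])
          show "norm (F w \<zeta>) \<le> S" for \<zeta> unfolding F_def by (rule E_bdd[OF w])
          show "norm (F w z - F w \<zeta>) \<le> e" if "norm (z - \<zeta>) \<le> 4" for z \<zeta>
          proof -
            have "norm (of_real d * z - of_real d * \<zeta>) = d * norm (z - \<zeta>)"
              using d by (simp add: norm_mult flip: right_diff_distrib)
            also have "\<dots> \<le> d * 4" using that d by (intro mult_left_mono) auto
            finally show ?thesis unfolding F_def by (intro E_osc w) (simp add: d_def)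
          qed
          show "F w \<zeta> = 0" if "real M < norm \<zeta>" for \<zeta>
          proof -
            have "real M * d < norm \<zeta> * d" using that d by (rule mult_strict_right_mono)
            moreover have "norm (of_real d * \<zeta>) = norm \<zeta> * d" using d by (simp add: norm_mult)
            ultimately have "R < norm (of_real d * \<zeta>)" using M_R by linarith
            then show ?thesis using ext(7) by (simp add: F_def E_def)
          qed
          have "continuous_on Kd (\<lambda>z. f0 (of_real d * z) w)"
            by (rule continuous_on_compose2[OF f0_cont[OF w]]) (auto simp: Kd_def intro!: continuous_intros)
          then show "continuous_on Kd (F w)" by (simp add: F_K cong: continuous_on_cong)
          have "((\<lambda>z. f0 z w) \<circ> (\<lambda>z. of_real d * z)) holomorphic_on interior Kd"
            by (rule holomorphic_on_compose_gen[OF _ f0_z[OF w]])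
              (auto intro!: holomorphic_intros scaled_interior[OF d] simp: Kd_def)
          then show "F w holomorphic_on interior Kd"
            by (rule holomorphic_transform) (use interior_subset F_K in force)
        qed
        then have le: "norm (of_real kernel_mass * f0 z w - H z w) \<le> 995328 * singular_mass * e"
          using F_K[OF uK] zu by simp
        have "f0 z w - H z w / of_real kernel_mass = (of_real kernel_mass * f0 z w - H z w) / of_real kernel_mass"
          using kernel_mass_pos by (simp add: field_simps)
        then have "norm (f0 z w - H z w / of_real kernel_mass) = norm (of_real kernel_mass * f0 z w - H z w) / kernel_mass"
          using kernel_mass_pos by (simp add: norm_divide)
        also have "\<dots> \<le> C * e"
          using divide_right_mono[OF le, of kernel_mass] kernel_mass_pos by (simp add: C_def)
        finally show ?thesis using Ce by linarith
      qed
      let ?fst = "\<lambda>z :: complex ^ (1 + 'm). (\<chi> i. vec_nth z (Inl i)) :: complex ^ 1"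
      let ?snd = "\<lambda>z :: complex ^ (1 + 'm). (\<chi> j. vec_nth z (Inr j)) :: complex ^ 'm"
      have lin: "bounded_linear ?fst" "bounded_linear ?snd"
        by (auto simp: linear_conv_bounded_linear[symmetric] vec_eq_iff intro!: linearI)
      \<comment> \<open>The assumption on \<open>K1\<close> enters here: functions of class A on the
        rescaled set are scaled back and lie in A_D(K1), hence in \<open>Obar K1\<close>.\<close>
      have lift1: "(\<lambda>z. h (vec_nth z (Inl 1) / of_real d)) \<in> Obar ?P"
        if h: "continuous_on Kd h" "h holomorphic_on interior Kd" for h
      proof -
        have "continuous_on K (\<lambda>z. h (z / of_real d))"
          by (rule continuous_on_compose2[OF h(1)]) (use d in \<open>auto simp: Kd_def intro!: continuous_intros\<close>)
        moreover have "(h \<circ> (\<lambda>z. z / of_real d)) holomorphic_on interior K"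
          by (rule holomorphic_on_compose_gen[OF _ h(2)])
            (use d in \<open>auto intro!: holomorphic_intros unscaled_interior[OF d] simp: Kd_def\<close>)
        ultimately have "(\<lambda>v. h (vec_nth v 1 / of_real d)) \<in> Obar K1"
          using A_D_planar[of K1 "\<lambda>z. h (z / of_real d)"] O1 unfolding K_def o_def by blast
        from Obar_compose_linear[OF this lin(1), of ?P] show ?thesis
          by (auto simp: prod_set_def vec_eq_iff)
      qed
      \<comment> \<open>The assumption on \<open>K2\<close> enters here, for the moments as
        functions of \<open>w\<close>.\<close>
      have lift2: "(\<lambda>z. ?m j \<kappa> (?snd z)) \<in> Obar ?P" for j \<kappa>
      proof -
        have "(\<lambda>w. ?m j \<kappa> w) \<in> A_D K2"
          unfolding F_def
        proof (rule moment_in_A_D[of "\<lambda>\<zeta>. E (of_real d * \<zeta>)"])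
          show "E (of_real d * \<zeta>) \<in> A_D K2" for \<zeta>
            unfolding E_def by (rule A_D_cmult[OF f0_w[OF ext(2)]])
        qed (use E_bdd F_meas[unfolded F_def[abs_def]] in auto)
        then have "(\<lambda>w. ?m j \<kappa> w) \<in> Obar K2" using O2 by blast
        from Obar_compose_linear[OF this lin(2), of ?P] show ?thesis
          by (auto simp: prod_set_def vec_eq_iff)
      qed
      define h where "h z = H (vec_nth z (Inl 1)) (?snd z) / of_real kernel_mass" for z
      have "h \<in> Obar ?P"
        unfolding h_def H_def divide_inverse[of _ "of_real kernel_mass"]
        by (intro Obar_mult[OF P] Obar_sum Obar_add Obar_const lift1 lift2 pq)
      moreover have "norm (f z - h z) < \<epsilon>" if "z \<in> ?P" for z
      proof -
        from that obtain x w where z: "z = join_vec x w" "x \<in> K" "w \<in> K2"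
          unfolding K_def by (rule prod_setE)
        then show ?thesis
          using H_approx[OF z(2,3)] by (simp add: h_def f0_def)
      qed
      ultimately show "\<exists>g\<in>Obar ?P. \<forall>z\<in>?P. norm (f z - g z) < \<epsilon>" by blast
    qed
  qed
qed

theorem mainTheorem13:
  fixes K1 :: "(complex ^ 1) set" and K2 :: "(complex ^ 'm) set"
  assumes "compact K1" and "compact K2"
    and "Obar K1 = A_D K1" and "Obar K2 = A_D K2"
  shows "Obar (prod_set K1 K2) = A_D (prod_set K1 K2)"
  using A_D_prod_subset_Obar[OF assms(1,2)] assms(3,4) Obar_subset_A_D[of "prod_set K1 K2"] by auto

end
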